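(* Let $\sigma\in\{0,1\}$. If $u_0\in W^{\frac14,4}(\mathbb{T})$ with $\mathbb{P}_+u_0=u_0$, there exists a global weak solution $u\in L^\infty([0,\infty),W^{\frac14,4}(\mathbb{T}))$ of the filamentation equation $\partial_tu=\partial_x\mathcal{C}_\sigma[u]$ with data $u_0$.
   Context: $\mathbb{T}=\mathbb{R}/(2\pi\mathbb{Z})$; functions are complex valued. $\mathbb{P}_+$ is the Fourier projector onto positive frequencies: $\mathbb{P}_+e^{ikx}=\mathbf{1}_{[1,\infty)}(k)e^{ikx}$, and $$\mathcal{C}_\sigma[u](x)=\mathbb{P}_+\left[\frac1{4\pi}\int_0^{2\pi}\frac{|u(x)-u(y)|^2(u(x)-u(y))}{1-\cos(x-y)}\,dy-\sigma|u(x)|^2u(x)\right].$$ $W^{\frac14,4}(\mathbb{T})$ is the space of $u\in L^4(\mathbb{T})$ with $\int_0^{2\pi}\!\int_0^{2\pi}\frac{|u(x)-u(y)|^4}{1-\cos(x-y)}\,dx\,dy<\infty$, normed by the fourth root of $\|u\|_{L^4}^4$ plus this double integral. Definition (weak solution). For $T\in(0,\infty]$, a function $u\in L^\infty([0,T],W^{\frac14,4}(\mathbb{T}))$ with $\mathbb{P}_+u=u$ is a weak solution with data $u_0\in W^{\frac14,4}(\mathbb{T})$ if and only if $$\int_0^{2\pi}u_0(x)\overline{\varphi(0,x)}\,dx+\int_0^T\!\!\int_0^{2\pi}u(t,x)\overline{\partial_t\varphi(t,x)}\,dx\,dt$$ $$=\frac1{8\pi}\int_0^T\!\!\int_0^{2\pi}\!\!\int_0^{2\pi}\frac{|u(x)-u(y)|^2(u(x)-u(y))\overline{(\partial_x\varphi(x)-\partial_x\varphi(y))}}{1-\cos(x-y)}\,dx\,dy\,dt-\sigma\int_0^T\!\!\int_0^{2\pi}|u(x)|^2u(x)\overline{\partial_x\varphi(x)}\,dx\,dt$$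 (the dependence on $t$ is omitted in the second line) for every $\varphi(t,x)$ which is smooth, compactly supported on $[0,T)\times\mathbb{T}$ and has positive spectrum, $\mathbb{P}_+\varphi=\varphi$. Global means $T=\infty$. *)

theory Defs
  imports "HOL-Analysis.Analysis"
begin

text \<open>Functions on the torus \<open>\<real>/2\<pi>\<int>\<close> are represented by \<open>2\<pi>\<close>-periodic functions on \<open>\<real>\<close>,
  integrated over one period.\<close>

definition periodic_2pi :: "(real \<Rightarrow> complex) \<Rightarrow> bool" where
  "periodic_2pi f \<longleftrightarrow> (\<forall>x. f (x + 2 * pi) = f x)"

abbreviation torus_measure :: "real measure" where
  "torus_measure \<equiv> lebesgue_on {0..2 * pi}"

definition fourier_coeff :: "(real \<Rightarrow> complex) \<Rightarrow> int \<Rightarrow> complex" where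
  "fourier_coeff f k =
     (1 / (2 * pi)) *\<^sub>R (LINT x|torus_measure. f x * exp (- (\<i> * of_int k * of_real x)))"

text \<open>\<open>is_P_plus f g\<close> expresses \<open>P\<^sub>+ f = g\<close>. It is a relation because \<open>P\<^sub>+ f\<close> is determined only
  almost everywhere, by its Fourier coefficients.\<close>

definition is_P_plus :: "(real \<Rightarrow> complex) \<Rightarrow> (real \<Rightarrow> complex) \<Rightarrow> bool" where
  "is_P_plus f g \<longleftrightarrow>
     integrable torus_measure f \<and> integrable torus_measure g \<and>
     (\<forall>k. fourier_coeff g k = indicator {1..} k * fourier_coeff f k)"

text \<open>The fourth power of the norm of \<open>W\<^bsup>1/4,4\<^esup>\<close>. The value of the quotient on the null set
  where \<open>cos (x - y) = 1\<close> is irrelevant.\<close>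

definition W_norm_pow4 :: "(real \<Rightarrow> complex) \<Rightarrow> ennreal" where
  "W_norm_pow4 f =
     (\<integral>\<^sup>+x. ennreal (cmod (f x) ^ 4) \<partial>torus_measure) +
     (\<integral>\<^sup>+y. (\<integral>\<^sup>+x. ennreal (cmod (f x - f y) ^ 4 / (1 - cos (x - y))) \<partial>torus_measure) \<partial>torus_measure)"

definition W_space :: "(real \<Rightarrow> complex) set" where
  "W_space = {f. periodic_2pi f \<and> f \<in> borel_measurable torus_measure \<and> W_norm_pow4 f < \<infinity>}"

definition W_norm :: "(real \<Rightarrow> complex) \<Rightarrow> real" where
  "W_norm f = root 4 (enn2real (W_norm_pow4 f))"

text \<open>Measurability of Banach-space-valued functions is in the strong (Bochner) sense. The elements
  of \<open>W_space\<close> are representatives, so the space has only a seminorm and \<open>strongly_measurable_W\<close>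
  cannot be expressed by the type-class-based Bochner integration of the library.\<close>

definition strongly_measurable_W :: "real set \<Rightarrow> (real \<Rightarrow> real \<Rightarrow> complex) \<Rightarrow> bool" where
  "strongly_measurable_W I u \<longleftrightarrow>
     (\<exists>s :: nat \<Rightarrow> real \<Rightarrow> real \<Rightarrow> complex.
        (\<forall>n. simple_function (lebesgue_on I) (s n) \<and> (\<forall>t\<in>I. s n t \<in> W_space)) \<and>
        (AE t in lebesgue_on I. (\<lambda>n. W_norm (\<lambda>x. s n t x - u t x)) \<longlonglongrightarrow> 0))"

definition L_infinity_W :: "real set \<Rightarrow> (real \<Rightarrow> real \<Rightarrow> complex) set" where
  "L_infinity_W I =
     {u. (\<forall>t\<in>I. u t \<in> W_space) \<and> strongly_measurable_W I u \<and>
         (\<exists>M. AE t in lebesgue_on I. W_norm (u t) \<le> M)}"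

definition time_interval :: "ereal \<Rightarrow> real set" where
  "time_interval T = {t. 0 \<le> t \<and> ereal t < T}"

definition partial_t :: "real set \<Rightarrow> (real \<Rightarrow> real \<Rightarrow> complex) \<Rightarrow> real \<Rightarrow> real \<Rightarrow> complex" where
  "partial_t I \<phi> t x = vector_derivative (\<lambda>s. \<phi> s x) (at t within I)"

definition partial_x :: "(real \<Rightarrow> real \<Rightarrow> complex) \<Rightarrow> real \<Rightarrow> real \<Rightarrow> complex" where
  "partial_x \<phi> t x = vector_derivative (\<phi> t) (at x)"

text \<open>Smoothness on \<open>I \<times> \<real>\<close>, with one-sided time derivatives at an endpoint belonging to \<open>I\<close>.\<close>

primrec Ck_on :: "nat \<Rightarrow> real set \<Rightarrow> (real \<Rightarrow> real \<Rightarrow> complex) \<Rightarrow> bool" where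
  "Ck_on 0 I \<phi> \<longleftrightarrow> continuous_on (I \<times> UNIV) (\<lambda>(t, x). \<phi> t x)"
| "Ck_on (Suc n) I \<phi> \<longleftrightarrow>
     continuous_on (I \<times> UNIV) (\<lambda>(t, x). \<phi> t x) \<and>
     (\<forall>t\<in>I. \<forall>x. (\<lambda>s. \<phi> s x) differentiable (at t within I) \<and> \<phi> t differentiable (at x)) \<and>
     Ck_on n I (partial_t I \<phi>) \<and> Ck_on n I (partial_x \<phi>)"

text \<open>As the torus is compact, compact support in \<open>[0,T) \<times> \<real>/2\<pi>\<int>\<close> is a condition on time only.\<close>

definition test_function :: "ereal \<Rightarrow> (real \<Rightarrow> real \<Rightarrow> complex) \<Rightarrow> bool" where
  "test_function T \<phi> \<longleftrightarrow>
     (\<forall>t\<in>time_interval T. periodic_2pi (\<phi> t)) \<and>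
     (\<forall>n. Ck_on n (time_interval T) \<phi>) \<and>
     (\<exists>K. compact K \<and> K \<subseteq> time_interval T \<and> (\<forall>t\<in>time_interval T - K. \<forall>x. \<phi> t x = 0)) \<and>
     (\<forall>t\<in>time_interval T. is_P_plus (\<phi> t) (\<phi> t))"

text \<open>Weak solutions on \<open>[0,T]\<close> of the filamentation equation
  \<open>\<partial>\<^sub>t u = \<partial>\<^sub>x P\<^sub>+ [1/(4\<pi>) \<integral> |u(x) - u(y)|\<^sup>2 (u(x) - u(y)) / (1 - cos (x - y)) dy - \<sigma> |u|\<^sup>2 u]\<close>
  with data \<open>u0\<close>. The endpoint \<open>t = T\<close> is a null set and is left out of the time interval.\<close>

definition weak_solution ::
    "real \<Rightarrow> ereal \<Rightarrow> (real \<Rightarrow> complex) \<Rightarrow> (real \<Rightarrow> real \<Rightarrow> complex) \<Rightarrow> bool" where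
  "weak_solution \<sigma> T u0 u \<longleftrightarrow>
     0 < T \<and> u0 \<in> W_space \<and> u \<in> L_infinity_W (time_interval T) \<and>
     (AE t in lebesgue_on (time_interval T). is_P_plus (u t) (u t)) \<and>
     (\<forall>\<phi>. test_function T \<phi> \<longrightarrow>
        (LINT x|torus_measure. u0 x * cnj (\<phi> 0 x)) +
        (LINT t|lebesgue_on (time_interval T). LINT x|torus_measure.
           u t x * cnj (partial_t (time_interval T) \<phi> t x)) =
        1 / (8 * of_real pi) *
          (LINT t|lebesgue_on (time_interval T). LINT y|torus_measure. LINT x|torus_measure.
             of_real (cmod (u t x - u t y) ^ 2) * (u t x - u t y) *
             cnj (partial_x \<phi> t x - partial_x \<phi> t y) / of_real (1 - cos (x - y)))
        - of_real \<sigma> *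
          (LINT t|lebesgue_on (time_interval T). LINT x|torus_measure.
             of_real (cmod (u t x) ^ 2) * u t x * cnj (partial_x \<phi> t x)))"

end

theory Submission
  imports Defs "HOL-Complex_Analysis.Great_Picard"
begin

text \<open>The equation is Hamiltonian: up to a factor, its right-hand side is \<open>\<partial>\<^sub>x\<close> of the gradient of
\<open>H(u) = E(u) / (8\<pi>) - \<sigma> \<integral> |u|\<^sup>4\<close>, where \<open>E\<close> is the double integral in the fourth power of the norm
of \<open>W\<^bsup>1/4,4\<^esup>\<close>. Hence \<open>H\<close> is conserved, and translation invariance of \<open>H\<close> makes the \<open>L\<^sup>2\<close> norm
conserved as well. Since \<open>\<integral> |u|\<^sup>4\<close> is at most a small multiple of \<open>E(u)\<close> plus a constant depending on
the \<open>L\<^sup>2\<close> norm, both quantities together control \<open>u\<close> in \<open>W\<^bsup>1/4,4\<^esup>\<close> for either value of \<open>\<sigma>\<close>. A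
solution is a limit of Galerkin approximations that inherit these bounds.

The analysis of \<open>W\<^bsup>1/4,4\<^esup>\<close> rests on one observation about the Fejer kernel \<open>K\<^sub>M\<close>: it is bounded by
\<open>1 / (\<pi> M (1 - cos h))\<close>, which is the weight of \<open>E\<close>. By Jensen's inequality the Fejer mean
\<open>S\<^sub>M f\<close> satisfies \<open>\<integral> |S\<^sub>M f - f|\<^sup>4 \<le> E(f) / (\<pi> M)\<close> (\<open>fejer_mean_L4_error\<close>) and
\<open>E(S\<^sub>M f) \<le> E(f)\<close> (\<open>fejer_mean_W_energy\<close>). The first estimate gives compactness in \<open>L\<^sup>4\<close>: for functions with
bounded energy, convergence of every Fourier coefficient implies convergence in \<open>L\<^sup>4\<close>. It also gives the
interpolation inequality needed for \<open>\<sigma> = 1\<close>, and it allows a function to be rebuilt from Fourier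
coefficients whose Fejer sums have bounded energy (locale \<open>bounded_spectrum\<close>).

The nonlinear form \<open>nonlin_form\<close> pairs the gradient of \<open>H\<close> with a function \<open>g\<close>. If \<open>|g(x) - g(y)|\<close> is at
most a constant times the square root of \<open>1 - cos (x - y)\<close>, half of the singular weight is absorbed
by \<open>g\<close>, and Young's inequality leaves the difference of two arguments in plain \<open>L\<^sup>2\<close>. So
on bounded sets of \<open>W\<^bsup>1/4,4\<^esup>\<close> the form is continuous for \<open>L\<^sup>4\<close> convergence (\<open>nonlin_form_tendsto\<close>),
which is what the passage to the limit requires.

The Galerkin equations on the modes \<open>1, \<dots>, N\<close> are discretised by the explicit Euler scheme. One step
of length \<open>h\<close> changes the two conserved quantities by \<open>O(h\<^sup>2)\<close> only, so a step small enough in terms of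
\<open>N\<close> keeps both bounded on \<open>[0, N]\<close> (\<open>galerkin\<close>). A diagonal argument gives convergence of all Fourier
coefficients for all times, and the limit solves the equation in integrated form mode by mode
(locale \<open>mode_solution\<close>). For a test function \<open>\<phi>\<close>, adding these equations with Fejer weights is the
weak formulation with \<open>S\<^sub>M u\<^sub>0\<close>, \<open>S\<^sub>M u\<close> and \<open>S\<^sub>M \<partial>\<^sub>x\<phi>\<close> in place of \<open>u\<^sub>0\<close>, \<open>u\<close> and \<open>\<partial>\<^sub>x\<phi>\<close>; dominated
convergence as \<open>M \<rightarrow> \<infinity>\<close> finishes the proof. Strong measurability in time holds because Fejer means
converge in the norm of \<open>W\<^bsup>1/4,4\<^esup>\<close> and have only finitely many coefficients, each continuous in time.\<close>

section \<open>The circle as a measure space\<close>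

text \<open>The representative of a point of the circle in \<open>[0, 2\<pi>)\<close>.\<close>

definition period_rep :: "real \<Rightarrow> real" where
  "period_rep x = x - 2 * pi * of_int \<lfloor>x / (2*pi)\<rfloor>"

lemma measurable_period_rep [measurable]: "period_rep \<in> borel_measurable borel"
  unfolding period_rep_def by measurable

text \<open>A constant rather than an abbreviation, so that the simplifier does not turn integrals over the
circle into integrals over the line with an indicator function.\<close>

definition circle :: "real measure" where
  "circle = torus_measure"

abbreviation circle2 :: "(real \<times> real) measure" where
  "circle2 \<equiv> circle \<Otimes>\<^sub>M circle"

lemma finite_measure_circle: "finite_measure circle"
  unfolding circle_def by (rule finite_measure_lebesgue_on) simp

interpretation circle: finite_measure circle
  by (rule finite_measure_circle)

interpretation circle2: pair_sigma_finite circle circle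
  by unfold_locales

interpretation circle2: finite_measure circle2
  by (rule finite_measure_pair_measure) (rule finite_measure_circle)+

lemma space_circle: "space circle = {0..2*pi}"
  by (simp add: circle_def)

lemma measure_circle: "measure circle (space circle) = 2 * pi"
  by (simp add: circle_def measure_restrict_space)

lemma emeasure_circle: "emeasure circle (space circle) = ennreal (2 * pi)"
  by (simp add: circle.emeasure_eq_measure measure_circle)

text \<open>Together with the two facts on projections below, this lets the measurability prover treat Borel
functions on the circle and on its square, although \<open>circle\<close> carries the Lebesgue \<open>\<sigma>\<close>-algebra.\<close>

lemma measurable_ident_circle [measurable]: "(\<lambda>x. x) \<in> borel_measurable circle"
  unfolding circle_def using id_borel_measurable_lebesgue_on by (simp add: id_def)

lemma measurable_circle_borel: "f \<in> borel_measurable borel \<Longrightarrow> f \<in> borel_measurable circle"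
  using measurable_compose[OF measurable_ident_circle] by blast

lemma measurable_fst_circle [measurable]: "fst \<in> borel_measurable (circle \<Otimes>\<^sub>M M)"
  using measurable_compose[OF measurable_fst measurable_ident_circle] by simp

lemma measurable_snd_circle [measurable]: "snd \<in> borel_measurable (M \<Otimes>\<^sub>M circle)"
  using measurable_compose[OF measurable_snd measurable_ident_circle] by simp

lemma nn_integral_circle:
  assumes [measurable]: "f \<in> borel_measurable borel"
  shows "(\<integral>\<^sup>+x. f x \<partial>circle) = (\<integral>\<^sup>+x. f x * indicator {0..<2*pi} x \<partial>lborel)"
proof -
  have "(\<integral>\<^sup>+x. f x \<partial>circle) = (\<integral>\<^sup>+x. f x * indicator {0..2*pi} x \<partial>lborel)"
    by (simp add: circle_def nn_integral_restrict_space nn_integral_completion)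
  also have "\<dots> = (\<integral>\<^sup>+x. f x * indicator {0..<2*pi} x \<partial>lborel)"
  proof (rule nn_integral_cong_AE)
    have "AE x in lborel. x \<noteq> 2*pi" by (rule AE_lborel_singleton)
    then show "AE x in lborel. f x * indicator {0..2*pi} x = f x * indicator {0..<2*pi} x"
      by eventually_elim (auto simp: indicator_def)
  qed
  finally show ?thesis .
qed

lemma periodic_int_shift:
  assumes "\<And>x. f (x + 2 * pi) = f x"
  shows "f (x + 2 * pi * of_int n) = f x"
proof -
  have *: "f (x + 2 * pi * of_nat m) = f x" for m x
    by (induction m) (use assms[of "x + 2 * pi * of_nat m" for m] in \<open>auto simp: algebra_simps\<close>)
  show ?thesis
    using *[of x "nat n"] *[of "x + 2 * pi * of_int n" "nat (-n)"] by (cases "n \<ge> 0") auto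
qed

lemma nn_integral_lborel_shift:
  fixes g :: "real \<Rightarrow> ennreal"
  assumes [measurable]: "g \<in> borel_measurable borel"
  shows "(\<integral>\<^sup>+x. g (x + h) \<partial>lborel) = (\<integral>\<^sup>+x. g x \<partial>lborel)"
  using nn_integral_real_affine[of g 1 h] by (simp add: add.commute)

text \<open>After the translation, the part of the integral beyond one period is moved back by periodicity; this
is done for shifts in \<open>[0, 2\<pi>)\<close>, to which every shift reduces.\<close>

lemma nn_integral_circle_shift:
  fixes g :: "real \<Rightarrow> ennreal"
  assumes g [measurable]: "g \<in> borel_measurable borel" and per: "\<And>x. g (x + 2 * pi) = g x"
  shows "(\<integral>\<^sup>+x. g (x + h) \<partial>circle) = (\<integral>\<^sup>+x. g x \<partial>circle)"
proof -
  have main: "(\<integral>\<^sup>+x. g (x + h) \<partial>circle) = (\<integral>\<^sup>+x. g x \<partial>circle)" if h: "0 \<le> h" "h < 2*pi" for h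
  proof -
    have "(\<integral>\<^sup>+x. g (x + h) \<partial>circle) = (\<integral>\<^sup>+x. g (x + h) * indicator {h..<h+2*pi} (x + h) \<partial>lborel)"
      by (subst nn_integral_circle) (auto simp: indicator_def intro!: nn_integral_cong)
    also have "\<dots> = (\<integral>\<^sup>+x. g x * indicator {h..<h+2*pi} x \<partial>lborel)"
      by (rule nn_integral_lborel_shift[of "\<lambda>x. g x * indicator {h..<h+2*pi} x"]) simp
    also have "\<dots> = (\<integral>\<^sup>+x. g x * indicator {h..<2*pi} x + g x * indicator {2*pi..<h+2*pi} x \<partial>lborel)"
      by (intro nn_integral_cong) (use h in \<open>auto simp: indicator_def\<close>)
    also have "\<dots> = (\<integral>\<^sup>+x. g x * indicator {h..<2*pi} x \<partial>lborel) + (\<integral>\<^sup>+x. g x * indicator {2*pi..<h+2*pi} x \<partial>lborel)"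
      by (rule nn_integral_add) auto
    also have "(\<integral>\<^sup>+x. g x * indicator {2*pi..<h+2*pi} x \<partial>lborel)
        = (\<integral>\<^sup>+x. g (x+2*pi) * indicator {2*pi..<h+2*pi} (x+2*pi) \<partial>lborel)"
      by (rule nn_integral_lborel_shift[of "\<lambda>x. g x * indicator {2*pi..<h+2*pi} x", symmetric]) simp
    also have "\<dots> = (\<integral>\<^sup>+x. g x * indicator {0..<h} x \<partial>lborel)"
      by (intro nn_integral_cong) (auto simp: indicator_def per)
    also have "(\<integral>\<^sup>+x. g x * indicator {h..<2*pi} x \<partial>lborel) + (\<integral>\<^sup>+x. g x * indicator {0..<h} x \<partial>lborel)
        = (\<integral>\<^sup>+x. g x * indicator {h..<2*pi} x + g x * indicator {0..<h} x \<partial>lborel)"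
      by (rule nn_integral_add[symmetric]) auto
    also have "\<dots> = (\<integral>\<^sup>+x. g x * indicator {0..<2*pi} x \<partial>lborel)"
      by (intro nn_integral_cong) (use h in \<open>auto simp: indicator_def\<close>)
    also have "\<dots> = (\<integral>\<^sup>+x. g x \<partial>circle)"
      by (simp add: nn_integral_circle)
    finally show ?thesis .
  qed
  define n where "n = \<lfloor>h / (2*pi)\<rfloor>"
  define h' where "h' = h - 2 * pi * of_int n"
  have "of_int n \<le> h/(2*pi)" "h/(2*pi) < of_int n + 1" unfolding n_def by linarith+
  then have "0 \<le> h'" "h' < 2*pi" unfolding h'_def by (auto simp: field_simps)
  moreover have "g (x + h) = g (x + h')" for x
    using periodic_int_shift[of g "x + h'" n, OF per] by (simp add: h'_def)
  ultimately show ?thesis using main[of h'] by simp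
qed

lemma period_rep_range: "0 \<le> period_rep x" "period_rep x < 2*pi"
proof -
  have "of_int \<lfloor>x / (2*pi)\<rfloor> \<le> x/(2*pi)" "x/(2*pi) < of_int \<lfloor>x / (2*pi)\<rfloor> + 1" by linarith+
  moreover have "x = x/(2*pi) * (2*pi)" by simp
  ultimately show "0 \<le> period_rep x" "period_rep x < 2*pi"
    unfolding period_rep_def
    using mult_right_mono[of "of_int \<lfloor>x / (2*pi)\<rfloor>" "x/(2*pi)" "2*pi"]
      mult_strict_right_mono[of "x/(2*pi)" "of_int \<lfloor>x / (2*pi)\<rfloor> + 1" "2*pi"]
    by (auto simp: algebra_simps)
qed

lemma period_rep_plus: "period_rep (x + 2*pi) = period_rep x"
proof -
  have "(x + 2*pi) / (2*pi) = x/(2*pi) + 1" by (simp add: field_simps)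
  then show ?thesis unfolding period_rep_def by (simp add: algebra_simps)
qed

lemma period_rep_id: "0 \<le> x \<Longrightarrow> x < 2*pi \<Longrightarrow> period_rep x = x"
  unfolding period_rep_def by (simp add: floor_eq_iff)

lemma periodic_period_rep:
  assumes "\<And>x. f (x + 2 * pi) = f x"
  shows "f (period_rep x) = f x"
  using periodic_int_shift[of f x "- \<lfloor>x / (2*pi)\<rfloor>", OF assms] by (simp add: period_rep_def)

lemma measurable_period_rep_circle [measurable]:
  "(\<lambda>x. period_rep (x + h)) \<in> borel_measurable circle" "period_rep \<in> borel_measurable circle"
  by (auto intro: measurable_circle_borel)

text \<open>Translation invariance as an identity of measures, which transfers it from nonnegative to complex
integrands.\<close>

lemma distr_circle_shift:
  "distr circle borel (\<lambda>x. period_rep (x + h)) = distr circle borel period_rep"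
proof (rule measure_eqI)
  fix A assume "A \<in> sets (distr circle borel (\<lambda>x. period_rep (x + h)))"
  then have A [measurable]: "A \<in> sets borel" by simp
  have "emeasure (distr circle borel (\<lambda>x. period_rep (x + h))) A
     = (\<integral>\<^sup>+x. indicator A x \<partial>(distr circle borel (\<lambda>x. period_rep (x + h))))"
    by (rule nn_integral_indicator[symmetric]) simp
  also have "\<dots> = (\<integral>\<^sup>+x. indicator A (period_rep (x + h)) \<partial>circle)"
    by (rule nn_integral_distr) simp_all
  also have "\<dots> = (\<integral>\<^sup>+x. indicator A (period_rep x) \<partial>circle)"
    by (rule nn_integral_circle_shift[of "\<lambda>x. indicator A (period_rep x)"])
      (auto simp: period_rep_plus)
  also have "\<dots> = (\<integral>\<^sup>+x. indicator A x \<partial>(distr circle borel period_rep))"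
    by (rule nn_integral_distr[symmetric]) simp_all
  also have "\<dots> = emeasure (distr circle borel period_rep) A"
    by (rule nn_integral_indicator) simp
  finally show "emeasure (distr circle borel (\<lambda>x. period_rep (x + h))) A
     = emeasure (distr circle borel period_rep) A" .
qed simp

text \<open>Borel rather than Lebesgue measurability is needed for Tonelli's theorem: for a Lebesgue measurable
\<open>f\<close> the map \<open>(x, h) \<mapsto> f (x + h)\<close> need not be measurable for the product \<open>\<sigma>\<close>-algebra.\<close>

definition periodic_borel :: "(real \<Rightarrow> complex) \<Rightarrow> bool" where
  "periodic_borel f \<longleftrightarrow> f \<in> borel_measurable borel \<and> periodic_2pi f"

lemma periodic_borel_measurable: "periodic_borel f \<Longrightarrow> f \<in> borel_measurable borel"
  and periodic_borel_periodic: "periodic_borel f \<Longrightarrow> f (x + 2 * pi) = f x"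
  by (auto simp: periodic_borel_def periodic_2pi_def)

lemma periodic_borel_shift: "periodic_borel f \<Longrightarrow> periodic_borel (\<lambda>x. f (x + h))"
  unfolding periodic_borel_def periodic_2pi_def
  by (auto simp: algebra_simps) (metis add.assoc add.commute)

lemma circle_shift:
  fixes f :: "real \<Rightarrow> complex"
  assumes "periodic_borel f"
  shows integrable_circle_shift: "integrable circle (\<lambda>x. f (x + h)) \<longleftrightarrow> integrable circle f"
    and integral_circle_shift: "(LINT x|circle. f (x + h)) = (LINT x|circle. f x)"
proof -
  note [measurable] = periodic_borel_measurable[OF assms]
  have r: "f (period_rep x) = f x" for x
    by (rule periodic_period_rep) (rule periodic_borel_periodic[OF assms])
  have m: "(\<lambda>x. period_rep (x + h)) \<in> circle \<rightarrow>\<^sub>M borel" "period_rep \<in> circle \<rightarrow>\<^sub>M borel"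
    by measurable
  show "integrable circle (\<lambda>x. f (x + h)) \<longleftrightarrow> integrable circle f"
    using integrable_distr_eq[OF m(1), of f] integrable_distr_eq[OF m(2), of f]
    by (simp add: distr_circle_shift r)
  show "(LINT x|circle. f (x + h)) = (LINT x|circle. f x)"
    using integral_distr[OF m(1), of f] integral_distr[OF m(2), of f]
    by (simp add: distr_circle_shift r)
qed

section \<open>Jensen inequality for fourth powers\<close>

text \<open>The tangent line at \<open>c\<close> lies below the graph of the convex function \<open>a\<^sup>4\<close>.\<close>

lemma power4_tangent: "(c::real)^4 + 4 * c^3 * (a - c) \<le> a^4" 
proof -
  have "a^4 - (c^4 + 4 * c^3 * (a - c)) = (a - c)\<^sup>2 * ((a + c)\<^sup>2 + 2 * c\<^sup>2)"
    by (simp add: power2_eq_square power4_eq_xxxx power3_eq_cube algebra_simps)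
  moreover have "\<dots> \<ge> 0" by simp
  ultimately show ?thesis by linarith
qed

lemma le_one_plus_power4: "0 \<le> (a::real) \<Longrightarrow> a \<le> 1 + a^4"
  using power4_tangent[of 1 a] by (cases "a \<le> 1") (auto intro: order_trans)

text \<open>The tangent line inequality is integrated at the point \<open>c = \<integral> k |g|\<close>. If the right-hand side is
finite, then \<open>k |g|\<close> is integrable because \<open>a \<le> 1 + a\<^sup>4\<close>.\<close>

lemma jensen_power4:
  fixes g :: "real \<Rightarrow> complex" and k :: "real \<Rightarrow> real"
  assumes g [measurable]: "g \<in> borel_measurable circle"
    and k: "integrable circle k" "\<And>x. 0 \<le> k x" "(LINT x|circle. k x) = 1"
  shows "ennreal (cmod (LINT x|circle. k x *\<^sub>R g x) ^ 4)
    \<le> (\<integral>\<^sup>+x. ennreal (k x * cmod (g x) ^ 4) \<partial>circle)"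
proof (cases "(\<integral>\<^sup>+x. ennreal (k x * cmod (g x) ^ 4) \<partial>circle) = \<infinity>")
  case False
  have [measurable]: "k \<in> borel_measurable circle" using k(1) by simp
  have i4: "integrable circle (\<lambda>x. k x * cmod (g x) ^ 4)"
    by (rule integrableI_nonneg) (use k(2) False in \<open>auto simp: less_top\<close>)
  have i1: "integrable circle (\<lambda>x. k x * cmod (g x))"
  proof (rule Bochner_Integration.integrable_bound)
    show "integrable circle (\<lambda>x. k x + k x * cmod (g x) ^ 4)" using i4 k(1) by auto
    show "AE x in circle. norm (k x * cmod (g x)) \<le> norm (k x + k x * cmod (g x) ^ 4)"
    proof (rule AE_I2)
      fix x
      have "k x * cmod (g x) \<le> k x * (1 + cmod (g x)^4)"
        by (intro mult_left_mono le_one_plus_power4 k) auto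
      then show "norm (k x * cmod (g x)) \<le> norm (k x + k x * cmod (g x) ^ 4)"
        using k(2)[of x] by (simp add: algebra_simps)
    qed
  qed measurable
  define c where "c = (LINT x|circle. k x * cmod (g x))"
  have "cmod (LINT x|circle. k x *\<^sub>R g x) \<le> (LINT x|circle. norm (k x *\<^sub>R g x))"
    by (rule integral_norm_bound)
  also have "\<dots> = c" using k(2) by (simp add: c_def)
  finally have le: "cmod (LINT x|circle. k x *\<^sub>R g x) \<le> c" .
  have c0: "c \<ge> 0" unfolding c_def by (rule Bochner_Integration.integral_nonneg) (simp add: k)
  have "c^4 = c^4 * (LINT x|circle. k x) + 4 * c^3 * ((LINT x|circle. k x * cmod (g x)) - c * (LINT x|circle. k x))"
    by (simp add: k(3) c_def)
  also have "\<dots> = (LINT x|circle. c^4 * k x + 4 * c^3 * (k x * cmod (g x) - c * k x))"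
    using k(1) i1 by simp
  also have "\<dots> \<le> (LINT x|circle. k x * cmod (g x) ^ 4)"
  proof (rule integral_mono[OF _ i4])
    fix x
    have "k x * (c^4 + 4 * c^3 * (cmod (g x) - c)) \<le> k x * cmod (g x) ^ 4"
      by (intro mult_left_mono power4_tangent k)
    then show "c^4 * k x + 4 * c^3 * (k x * cmod (g x) - c * k x) \<le> k x * cmod (g x) ^ 4"
      by (simp add: algebra_simps)
  qed (use k(1) i1 in auto)
  finally have "c^4 \<le> (LINT x|circle. k x * cmod (g x) ^ 4)" .
  moreover have "cmod (LINT x|circle. k x *\<^sub>R g x) ^ 4 \<le> c^4"
    by (rule power_mono[OF le]) simp
  moreover have "(\<integral>\<^sup>+x. ennreal (k x * cmod (g x) ^ 4) \<partial>circle) = ennreal (LINT x|circle. k x * cmod (g x) ^ 4)"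
    by (rule nn_integral_eq_integral[OF i4]) (simp add: k)
  ultimately show ?thesis by (simp add: ennreal_leI)
qed simp

section \<open>Characters and the Fejer kernel\<close>

lemma norm_cis_diff: "(cmod (cis a - cis b))\<^sup>2 = 2 * (1 - cos (a - b))"
proof -
  have "(cmod (cis a - cis b))\<^sup>2 = (cos a - cos b)\<^sup>2 + (sin a - sin b)\<^sup>2"
    by (simp add: cmod_power2)
  also have "\<dots> = ((cos a)\<^sup>2 + (sin a)\<^sup>2) + ((cos b)\<^sup>2 + (sin b)\<^sup>2) - 2 * (cos a * cos b + sin a * sin b)"
    by (simp add: power2_eq_square algebra_simps)
  finally show ?thesis by (simp add: cos_diff)
qed

lemma norm_cis_nat_minus_1: "cmod (cis (real n * t) - 1) \<le> real n * cmod (cis t - 1)"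
proof -
  have "cis (real n * t) - 1 = (cis t) ^ n - 1 ^ n" by (simp add: Complex.DeMoivre)
  also have "cmod \<dots> \<le> real n * cmod (cis t - 1)"
    by (rule norm_power_diff) auto
  finally show ?thesis .
qed

text \<open>Factor \<open>z\<^sup>k - 1\<close> by \<open>z - 1\<close>; the quotient is a sum of \<open>|k|\<close> unimodular terms.\<close>

lemma norm_cis_int_diff:
  "cmod (cis (of_int k * x) - cis (of_int k * y)) \<le> \<bar>of_int k\<bar> * cmod (cis x - cis y)"
proof -
  have *: "cmod (cis a - cis b) = cmod (cis (a - b) - 1)" for a b
  proof -
    have "cis a - cis b = cis b * (cis (a - b) - 1)" by (simp add: cis_mult right_diff_distrib)
    then show ?thesis by (simp add: norm_mult)
  qed
  have **: "cmod (cis (- t) - 1) = cmod (cis t - 1)" for t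
    using *[of 0 t] *[of t 0] by (simp add: norm_minus_commute)
  have "cmod (cis (of_int k * t) - 1) \<le> \<bar>of_int k\<bar> * cmod (cis t - 1)" for t
  proof (cases "k \<ge> 0")
    case True
    then show ?thesis using norm_cis_nat_minus_1[of "nat k" t] by simp
  next
    case False
    then show ?thesis using norm_cis_nat_minus_1[of "nat (- k)" t] **[of "of_int k * t"] by simp
  qed
  from this[of "x - y"] show ?thesis by (simp add: *[of x y] *[of "of_int k * x"] right_diff_distrib)
qed

lemma periodic_borel_cis [simp]: "periodic_borel (\<lambda>x. cis (of_int k * x))"
proof -
  have "cis (of_int k * (x + 2 * pi)) = cis (of_int k * x)" for x
    using cis_multiple_2pi[of "of_int k"] by (simp add: algebra_simps flip: cis_mult)
  then show ?thesis by (auto simp: periodic_borel_def periodic_2pi_def cis_conv_exp)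
qed

lemma periodic_borel_const [simp]: "periodic_borel (\<lambda>x. c)"
  by (auto simp: periodic_borel_def periodic_2pi_def)
lemma periodic_borel_add: "periodic_borel f \<Longrightarrow> periodic_borel g \<Longrightarrow> periodic_borel (\<lambda>x. f x + g x)"
  and periodic_borel_diff: "periodic_borel f \<Longrightarrow> periodic_borel g \<Longrightarrow> periodic_borel (\<lambda>x. f x - g x)"
  and periodic_borel_mult: "periodic_borel f \<Longrightarrow> periodic_borel g \<Longrightarrow> periodic_borel (\<lambda>x. f x * g x)"
  by (auto simp: periodic_borel_def periodic_2pi_def)
lemma periodic_borel_sum: "(\<And>i. i \<in> A \<Longrightarrow> periodic_borel (f i)) \<Longrightarrow> periodic_borel (\<lambda>x. \<Sum>i\<in>A. f i x)"
  unfolding periodic_borel_def periodic_2pi_def by (intro conjI borel_measurable_sum) auto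

lemma integrable_circle_bounded:
  fixes f :: "real \<Rightarrow> complex"
  assumes "f \<in> borel_measurable borel" "\<And>x. cmod (f x) \<le> B"
  shows "integrable circle f"
  by (rule circle.integrable_const_bound[where B=B]) (use assms in \<open>auto intro: measurable_circle_borel\<close>)

lemma integrable_circle_cis [simp]: "integrable circle (\<lambda>x. cis (of_int k * x))"
  by (rule integrable_circle_bounded[where B=1]) (auto intro: periodic_borel_measurable)

text \<open>Translation by \<open>\<pi> / k\<close> changes the sign of a nontrivial character, so its integral vanishes.\<close>

lemma integral_circle_cis:
  "(LINT x|circle. cis (of_int k * x)) = (if k = 0 then 2 * of_real pi else 0)"
proof (cases "k = 0")
  case True
  then show ?thesis by (simp add: measure_circle scaleR_conv_of_real)
next
  case False
  have "(LINT x|circle. cis (of_int k * x)) = (LINT x|circle. cis (of_int k * (x + pi / of_int k)))"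
    by (rule integral_circle_shift[symmetric]) simp
  also have "\<dots> = (LINT x|circle. - cis (of_int k * x))"
    using False by (intro arg_cong[where f="lebesgue_integral _"]) (auto simp: ring_distribs simp flip: cis_mult)
  finally show ?thesis using False by simp
qed

lemma fourier_coeff_circle:
  "fourier_coeff f k = (1 / (2*pi)) *\<^sub>R (LINT x|circle. f x * cis (- (of_int k * x)))"
  by (simp add: fourier_coeff_def circle_def cis_conv_exp mult.assoc)

definition fejer_kernel :: "nat \<Rightarrow> real \<Rightarrow> real" where
  "fejer_kernel M h = (cmod (\<Sum>j<M. cis (real j * h)))\<^sup>2 / (2 * pi * real M)"

lemma fejer_kernel_nonneg: "0 \<le> fejer_kernel M h"
  by (simp add: fejer_kernel_def)

lemma measurable_fejer_kernel [measurable]: "fejer_kernel M \<in> borel_measurable borel"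
  unfolding fejer_kernel_def cis_conv_exp by measurable

lemma fejer_kernel_le: "fejer_kernel M h \<le> real M / (2 * pi)"
proof -
  have "cmod (\<Sum>j<M. cis (real j * h)) \<le> (\<Sum>j<M. cmod (cis (real j * h)))" by (rule norm_sum)
  also have "\<dots> = real M" by simp
  finally have "(cmod (\<Sum>j<M. cis (real j * h)))\<^sup>2 \<le> (real M)\<^sup>2" by (rule power_mono) simp
  then have "fejer_kernel M h \<le> (real M)\<^sup>2 / (2 * pi * real M)"
    unfolding fejer_kernel_def by (rule divide_right_mono) simp
  then show ?thesis by (cases "M = 0") (auto simp: power2_eq_square fejer_kernel_def)
qed

text \<open>The geometric sum satisfies \<open>S (1 - e\<^sup>i\<^sup>h) = 1 - e\<^sup>i\<^sup>M\<^sup>h\<close> and \<open>|1 - e\<^sup>i\<^sup>h|\<^sup>2 = 2 (1 - cos h)\<close>. The bound is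
the weight of the Slobodeckij energy divided by \<open>\<pi> M\<close>, and this is why Fejer means suit the space
\<open>W\<^bsup>1/4,4\<^esup>\<close>.\<close>

lemma fejer_kernel_decay:
  assumes "M > 0"
  shows "fejer_kernel M h * (1 - cos h) \<le> 1 / (pi * real M)"
proof -
  define S where "S = (\<Sum>j<M. cis (real j * h))"
  have "S * (1 - cis h) = 1 - cis h ^ M"
    unfolding one_diff_power_eq[of "cis h" M] by (simp add: S_def Complex.DeMoivre mult.commute)
  then have "(cmod S)\<^sup>2 * (cmod (1 - cis h))\<^sup>2 = (cmod (1 - cis h ^ M))\<^sup>2"
    by (metis norm_mult power_mult_distrib)
  moreover have "cmod (1 - cis h ^ M) \<le> 1 + 1"
    by (rule order_trans[OF norm_triangle_ineq4]) (simp add: norm_power)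
  then have "(cmod (1 - cis h ^ M))\<^sup>2 \<le> (1 + 1)\<^sup>2" by (rule power_mono) simp
  moreover have "(cmod (1 - cis h))\<^sup>2 = 2 * (1 - cos h)" using norm_cis_diff[of 0 h] by simp
  ultimately have "(cmod S)\<^sup>2 * (1 - cos h) \<le> 2" by (simp add: right_diff_distrib)
  then have "(cmod S)\<^sup>2 * (1 - cos h) / (2 * pi * real M) \<le> 2 / (2 * pi * real M)"
    by (rule divide_right_mono) simp
  then show ?thesis by (simp add: fejer_kernel_def S_def)
qed

text \<open>Induction on \<open>M\<close>: the new row and column contribute every difference between \<open>-M\<close> and \<open>M\<close>
once.\<close>

lemma sum_int_differences:
  fixes g :: "int \<Rightarrow> complex"
  shows "(\<Sum>j<M. \<Sum>l<M. g (int j - int l)) = (\<Sum>k\<in>{-int M<..<int M}. of_int (int M - \<bar>k\<bar>) * g k)"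
proof (induction M)
  case (Suc M)
  have "(\<Sum>j<Suc M. \<Sum>l<Suc M. g (int j - int l))
    = (\<Sum>j<M. \<Sum>l<M. g (int j - int l)) + ((\<Sum>j<M. g (int j - int M)) + g 0 + (\<Sum>l<M. g (int M - int l)))"
    by (simp add: sum.distrib)
  also have "(\<Sum>j<M. g (int j - int M)) = (\<Sum>k\<in>{-int M..<0}. g k)"
    by (rule sum.reindex_bij_witness[where i="\<lambda>k. nat (k + int M)" and j="\<lambda>j. int j - int M"]) auto
  also have "(\<Sum>l<M. g (int M - int l)) = (\<Sum>k\<in>{0<..int M}. g k)"
    by (rule sum.reindex_bij_witness[where i="\<lambda>k. nat (int M - k)" and j="\<lambda>j. int M - int j"]) auto
  also have "(\<Sum>k\<in>{-int M..<0}. g k) + g 0 + (\<Sum>k\<in>{0<..int M}. g k) = (\<Sum>k\<in>{-int M..int M}. g k)"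
  proof -
    have "{-int M..int M} = insert 0 {-int M..<0} \<union> {0<..int M}" by auto
    moreover have "sum g ({-int M..<0} \<union> {0<..int M}) = sum g {-int M..<0} + sum g {0<..int M}"
      by (rule sum.union_disjoint) auto
    ultimately show ?thesis by simp
  qed
  also have "(\<Sum>j<M. \<Sum>l<M. g (int j - int l)) = (\<Sum>k\<in>{-int M..int M}. of_int (int M - \<bar>k\<bar>) * g k)"
    unfolding Suc by (rule sum.mono_neutral_left) auto
  also have "\<dots> + (\<Sum>k\<in>{-int M..int M}. g k) = (\<Sum>k\<in>{-int (Suc M)<..<int (Suc M)}. of_int (int (Suc M) - \<bar>k\<bar>) * g k)"
    unfolding sum.distrib[symmetric] by (rule sum.cong) (auto simp: algebra_simps)
  finally show ?case .
qed simp

lemma fejer_kernel_expansion: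
  "complex_of_real (fejer_kernel M h)
    = (\<Sum>k\<in>{-int M<..<int M}. of_int (int M - \<bar>k\<bar>) * cis (of_int k * h)) / of_real (2 * pi * real M)"
proof -
  have "complex_of_real ((cmod (\<Sum>j<M. cis (real j * h)))\<^sup>2)
    = (\<Sum>j<M. cis (real j * h)) * cnj (\<Sum>l<M. cis (real l * h))"
    by (rule complex_norm_square)
  also have "\<dots> = (\<Sum>j<M. \<Sum>l<M. cis (of_int (int j - int l) * h))"
    by (simp add: sum_product cis_cnj cis_mult left_diff_distrib)
  also have "\<dots> = (\<Sum>k\<in>{-int M<..<int M}. of_int (int M - \<bar>k\<bar>) * cis (of_int k * h))"
    by (rule sum_int_differences)
  finally show ?thesis by (simp add: fejer_kernel_def)
qed

text \<open>The kernel is even, so this is the convolution with the kernel; with \<open>x + h\<close> no reflection of the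
circle is needed.\<close>

definition fejer_mean :: "nat \<Rightarrow> (real \<Rightarrow> complex) \<Rightarrow> real \<Rightarrow> complex" where
  "fejer_mean M f x = (LINT h|circle. fejer_kernel M h *\<^sub>R f (x + h))"

definition trig :: "int set \<Rightarrow> (int \<Rightarrow> complex) \<Rightarrow> real \<Rightarrow> complex" where
  "trig A a x = (\<Sum>k\<in>A. a k * cis (of_int k * x))"

text \<open>Only positive frequencies occur, as all functions to which it is applied have positive spectrum.\<close>

definition fejer_sum :: "nat \<Rightarrow> (int \<Rightarrow> complex) \<Rightarrow> real \<Rightarrow> complex" where
  "fejer_sum M a = trig {1..<int M} (\<lambda>k. of_real (1 - of_int k / real M) * a k)"

lemma periodic_borel_trig [simp]: "periodic_borel (trig A a)"
  unfolding trig_def by (intro periodic_borel_sum periodic_borel_mult) auto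

lemma periodic_borel_fejer_sum [simp]: "periodic_borel (fejer_sum M a)"
  by (simp add: fejer_sum_def)

lemma integrable_circle_mult_bounded:
  fixes f g :: "real \<Rightarrow> complex"
  assumes f: "integrable circle f" and g: "g \<in> borel_measurable borel" "\<And>x. cmod (g x) \<le> B"
  shows "integrable circle (\<lambda>x. f x * g x)" "integrable circle (\<lambda>x. g x * f x)"
proof -
  have [measurable]: "g \<in> borel_measurable circle" "f \<in> borel_measurable circle"
    using f g(1) by (auto intro: measurable_circle_borel)
  have "cmod (f x) * cmod (g x) \<le> cmod (f x) * B" for x by (intro mult_left_mono g) auto
  moreover have "B \<ge> 0" using g(2)[of 0] norm_ge_zero order_trans by blast
  ultimately show "integrable circle (\<lambda>x. f x * g x)"
    by (intro Bochner_Integration.integrable_bound[OF integrable_mult_left[OF f, of "of_real B"]])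
       (auto simp: norm_mult intro!: AE_I2)
  then show "integrable circle (\<lambda>x. g x * f x)" by (simp add: mult.commute)
qed

text \<open>Expand the kernel into characters; translation turns the integral of \<open>e\<^sup>i\<^sup>k\<^sup>h f (x + h)\<close> into the Fourier
coefficient of index \<open>-k\<close> times \<open>e\<^sup>-\<^sup>i\<^sup>k\<^sup>x\<close>.\<close>

lemma fejer_mean_expansion:
  assumes f: "periodic_borel f" "integrable circle f"
  shows "fejer_mean M f x
    = (\<Sum>k\<in>{-int M<..<int M}. of_real (1 - of_int \<bar>k\<bar> / real M) * fourier_coeff f k * cis (of_int k * x))"
proof (cases "M = 0")
  case True
  then show ?thesis by (simp add: fejer_mean_def fejer_kernel_def)
next
  case False
  have fx: "integrable circle (\<lambda>h. f (x + h))"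
    using integrable_circle_shift[OF f(1), of x] f(2) by (simp add: add.commute)
  have int: "(LINT h|circle. cis (of_int k * h) * f (x + h))
      = of_real (2 * pi) * fourier_coeff f (-k) * cis (of_int (-k) * x)" for k
  proof -
    have "cis (of_int k * h) * f (x + h) = cis (- (of_int k * x)) * (f (h + x) * cis (of_int k * (h + x)))" for h
      by (simp add: ring_distribs add.commute mult.commute flip: cis_mult) (simp add: cis_mult flip: mult.assoc)
    then have "(LINT h|circle. cis (of_int k * h) * f (x + h))
        = cis (- (of_int k * x)) * (LINT h|circle. f (h + x) * cis (of_int k * (h + x)))"
      by simp
    also have "(LINT h|circle. f (h + x) * cis (of_int k * (h + x))) = (LINT h|circle. f h * cis (of_int k * h))"
      by (rule integral_circle_shift[of "\<lambda>y. f y * cis (of_int k * y)"]) (intro periodic_borel_mult f periodic_borel_cis)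
    finally show ?thesis by (simp add: fourier_coeff_circle scaleR_conv_of_real)
  qed
  have "fejer_mean M f x = (LINT h|circle. (\<Sum>k\<in>{-int M<..<int M}.
      (of_int (int M - \<bar>k\<bar>) / of_real (2 * pi * real M)) * (cis (of_int k * h) * f (x + h))))"
    unfolding fejer_mean_def scaleR_conv_of_real fejer_kernel_expansion
    by (simp add: sum_distrib_right sum_divide_distrib mult.assoc)
  also have "\<dots> = (\<Sum>k\<in>{-int M<..<int M}.
      (of_int (int M - \<bar>k\<bar>) / of_real (2 * pi * real M)) * (LINT h|circle. cis (of_int k * h) * f (x + h)))"
    by (subst Bochner_Integration.integral_sum)
       (auto intro!: integrable_mult_right integrable_circle_mult_bounded[OF fx, where B=1] periodic_borel_measurable
         simp del: times_divide_eq_left)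
  also have "\<dots> = (\<Sum>k\<in>{-int M<..<int M}. of_real (1 - of_int \<bar>k\<bar> / real M) * fourier_coeff f (-k) * cis (of_int (-k) * x))"
    unfolding int by (rule sum.cong) (use False in \<open>auto simp: field_simps simp del: of_int_abs\<close>)
  also have "\<dots> = (\<Sum>k\<in>{-int M<..<int M}. of_real (1 - of_int \<bar>k\<bar> / real M) * fourier_coeff f k * cis (of_int k * x))"
    by (rule sum.reindex_bij_witness[where i=uminus and j=uminus]) auto
  finally show ?thesis .
qed

lemma fejer_mean_eq_fejer_sum:
  assumes f: "periodic_borel f" "integrable circle f" and pos: "\<And>k. k < 1 \<Longrightarrow> fourier_coeff f k = 0"
  shows "fejer_mean M f = fejer_sum M (fourier_coeff f)"
proof
  fix x
  show "fejer_mean M f x = fejer_sum M (fourier_coeff f) x"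
    unfolding fejer_mean_expansion[OF f] fejer_sum_def trig_def
    by (rule sum.mono_neutral_cong_right) (auto simp: pos)
qed

lemma fejer_kernel_integrable: "integrable circle (fejer_kernel M)"
  by (rule circle.integrable_const_bound[where B="real M / (2*pi)"])
    (auto simp: fejer_kernel_nonneg fejer_kernel_le)

lemma fejer_kernel_integral:
  assumes "M > 0"
  shows "(LINT h|circle. fejer_kernel M h) = 1"
proof -
  have fc: "fourier_coeff (\<lambda>x. 1) k = (if k = 0 then 1 else 0)" for k
    using integral_circle_cis[of "-k"] by (simp add: fourier_coeff_circle scaleR_conv_of_real)
  have "complex_of_real (LINT h|circle. fejer_kernel M h) = fejer_mean M (\<lambda>x. 1) 0"
    by (simp add: fejer_mean_def scaleR_conv_of_real del: of_real_eq_1_iff)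
  also have "\<dots> = 1"
    using assms by (subst fejer_mean_expansion) (auto simp: fc if_distrib[of "\<lambda>z. _ * z"] if_distrib[of "\<lambda>z. z * _"] sum.delta' cong: if_cong)
  finally show ?thesis by simp
qed

section \<open>The Slobodeckij energy and Fejer means\<close>

text \<open>The fourth power of the norm. It is a nonnegative integral, so that estimates need no
integrability hypotheses.\<close>

definition L4 :: "(real \<Rightarrow> complex) \<Rightarrow> ennreal" where
  "L4 f = (\<integral>\<^sup>+x. ennreal (cmod (f x) ^ 4) \<partial>circle)"

definition energy_density :: "(real \<Rightarrow> complex) \<Rightarrow> real \<times> real \<Rightarrow> real" where
  "energy_density f p = cmod (f (fst p) - f (snd p)) ^ 4 / (1 - cos (fst p - snd p))"

text \<open>The fourth power of the Slobodeckij seminorm, as an integral over the square of the circle.\<close>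

definition W_energy :: "(real \<Rightarrow> complex) \<Rightarrow> ennreal" where
  "W_energy f = (\<integral>\<^sup>+p. ennreal (energy_density f p) \<partial>circle2)"

lemma energy_density_nonneg [simp]: "0 \<le> energy_density f p"
  by (simp add: energy_density_def)

lemma measurable_chord [measurable]: "(\<lambda>p. 1 - cos (fst p - snd p)) \<in> borel_measurable circle2"
  by measurable

lemma measurable_energy_density: "f \<in> borel_measurable borel \<Longrightarrow> energy_density f \<in> borel_measurable circle2"
proof -
  assume [measurable]: "f \<in> borel_measurable borel"
  show ?thesis unfolding energy_density_def[abs_def] by measurable
qed

lemma W_energy_snd:
  assumes "periodic_borel f"
  shows "W_energy f = (\<integral>\<^sup>+y. \<integral>\<^sup>+x. ennreal (energy_density f (x, y)) \<partial>circle \<partial>circle)"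
  unfolding W_energy_def
  by (subst circle2.nn_integral_snd[symmetric]) (auto intro!: measurable_compose[OF measurable_energy_density] periodic_borel_measurable assms)

lemma W_norm_pow4_eq: "periodic_borel f \<Longrightarrow> W_norm_pow4 f = L4 f + W_energy f"
  by (simp add: W_norm_pow4_def L4_def W_energy_snd energy_density_def circle_def)

lemma L4_shift: "periodic_borel f \<Longrightarrow> L4 (\<lambda>x. f (x + h)) = L4 f"
  unfolding L4_def
  by (rule nn_integral_circle_shift[of "\<lambda>x. ennreal (cmod (f x) ^ 4)"]) (auto simp: periodic_borel_def periodic_2pi_def)

lemma nn_integral_circle2_shift:
  fixes G :: "real \<times> real \<Rightarrow> ennreal"
  assumes G [measurable]: "G \<in> borel_measurable (borel \<Otimes>\<^sub>M borel)"
    and per: "\<And>x y. G (x + 2 * pi, y) = G (x, y)" "\<And>x y. G (x, y + 2 * pi) = G (x, y)"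
  shows "(\<integral>\<^sup>+p. G (fst p + h, snd p + h) \<partial>circle2) = (\<integral>\<^sup>+p. G p \<partial>circle2)"
proof -
  have [measurable]: "(\<lambda>p. (fst p + h, snd p + h)) \<in> circle2 \<rightarrow>\<^sub>M borel \<Otimes>\<^sub>M borel" for h
    by measurable
  have m: "(\<lambda>p. G (fst p + h, snd p + h)) \<in> borel_measurable circle2" for h
    by measurable
  have m0: "G \<in> borel_measurable circle2" using m[of 0] by simp
  have "(\<integral>\<^sup>+p. G (fst p + h, snd p + h) \<partial>circle2) = (\<integral>\<^sup>+x. \<integral>\<^sup>+y. G (x + h, y + h) \<partial>circle \<partial>circle)"
    using circle.nn_integral_fst[OF m[of h]] by simp
  also have "\<dots> = (\<integral>\<^sup>+x. \<integral>\<^sup>+y. G (x + h, y) \<partial>circle \<partial>circle)"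
    by (intro nn_integral_cong nn_integral_circle_shift per) measurable
  also have "\<dots> = (\<integral>\<^sup>+x. \<integral>\<^sup>+y. G (x, y) \<partial>circle \<partial>circle)"
  proof (rule nn_integral_circle_shift[of "\<lambda>x. \<integral>\<^sup>+y. G (x, y) \<partial>circle"])
    have "(\<lambda>q. (fst q, snd q)) \<in> borel \<Otimes>\<^sub>M circle \<rightarrow>\<^sub>M borel \<Otimes>\<^sub>M borel" by measurable
    then have "G \<in> borel_measurable (borel \<Otimes>\<^sub>M circle)" by (auto dest: measurable_compose[OF _ G])
    then show "(\<lambda>x. \<integral>\<^sup>+ y. G (x, y) \<partial>circle) \<in> borel_measurable borel"
      by (rule circle.borel_measurable_nn_integral_fst)
  qed (simp add: per)
  also have "\<dots> = (\<integral>\<^sup>+p. G p \<partial>circle2)"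
    by (rule circle.nn_integral_fst[OF m0])
  finally show ?thesis .
qed

lemma W_energy_shift:
  assumes "periodic_borel f"
  shows "W_energy (\<lambda>x. f (x + h)) = W_energy f"
proof -
  note [measurable] = periodic_borel_measurable[OF assms]
  have p: "f (x + 2*pi) = f x" for x using periodic_borel_periodic[OF assms] .
  have c: "cos (x + 2*pi - y) = cos (x - y)" "cos (x - (y + 2*pi)) = cos (x - y)" for x y :: real
    using cos_periodic[of "x - y"] cos_periodic[of "x - (y + 2*pi)"] by (simp_all add: algebra_simps)
  have "(\<integral>\<^sup>+p. ennreal (energy_density f (fst p + h, snd p + h)) \<partial>circle2) = (\<integral>\<^sup>+p. ennreal (energy_density f p) \<partial>circle2)"
    by (rule nn_integral_circle2_shift[of "\<lambda>p. ennreal (energy_density f p)"]) (auto simp: energy_density_def p c)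
  then show ?thesis by (simp add: W_energy_def energy_density_def)
qed

lemma periodic_borel_fejer_mean:
  assumes "periodic_borel f" "integrable circle f"
  shows "periodic_borel (fejer_mean M f)"
proof -
  have "fejer_mean M f = (\<lambda>x. \<Sum>k\<in>{-int M<..<int M}. of_real (1 - of_int \<bar>k\<bar> / real M) * fourier_coeff f k * cis (of_int k * x))"
    using fejer_mean_expansion[OF assms] by blast
  then show ?thesis by (simp only:) (intro periodic_borel_sum periodic_borel_mult periodic_borel_const periodic_borel_cis)
qed

lemma fejer_mean_integrable:
  assumes "periodic_borel f" "integrable circle f"
  shows "integrable circle (\<lambda>h. fejer_kernel M h *\<^sub>R f (x + h))"
  unfolding scaleR_conv_of_real
  by (rule integrable_circle_mult_bounded[where B="real M / (2*pi)"])
     (use integrable_circle_shift[OF assms(1), of x] assms(2) fejer_kernel_le fejer_kernel_nonneg in \<open>auto simp: add.commute\<close>)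

lemma fejer_mean_diff:
  assumes "periodic_borel f" "integrable circle f"
  shows "fejer_mean M f x - fejer_mean M f y = (LINT h|circle. fejer_kernel M h *\<^sub>R (f (x + h) - f (y + h)))"
  unfolding fejer_mean_def scaleR_diff_right
  by (rule Bochner_Integration.integral_diff[symmetric]) (intro fejer_mean_integrable assms)+

lemma fejer_mean_minus:
  assumes "periodic_borel f" "integrable circle f" "M > 0"
  shows "fejer_mean M f x - f x = (LINT h|circle. fejer_kernel M h *\<^sub>R (f (x + h) - f x))"
  unfolding fejer_mean_def scaleR_diff_right
  by (subst Bochner_Integration.integral_diff)
     (use fejer_mean_integrable[OF assms(1,2)] fejer_kernel_integral[OF assms(3)] fejer_kernel_integrable in auto)

text \<open>By Jensen's inequality, the fourth power of the error at \<open>x\<close> is at most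
\<open>\<integral> K\<^sub>M(h) |f (x + h) - f x|\<^sup>4 dh\<close>, and the decay of the kernel replaces \<open>K\<^sub>M(h)\<close> by
\<open>1 / (\<pi> M (1 - cos h))\<close>. Integration over \<open>x\<close> gives the energy: no regularity beyond finite energy is
used, and the rate is uniform on bounded sets of the space.\<close>

lemma fejer_mean_L4_error:
  assumes f: "periodic_borel f" "integrable circle f" and M: "M > 0"
  shows "L4 (\<lambda>x. fejer_mean M f x - f x) \<le> ennreal (1 / (pi * real M)) * W_energy f"
proof -
  note [measurable] = periodic_borel_measurable[OF f(1)]
  have fp: "f (x + 2*pi) = f x" for x using periodic_borel_periodic[OF f(1)] .
  have c: "cos (x + 2*pi - y) = cos (x - y)" for x y :: real
    using cos_periodic[of "x - y"] by (simp add: algebra_simps)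
  have pt: "ennreal (cmod (fejer_mean M f x - f x) ^ 4)
      \<le> ennreal (1 / (pi * real M)) * (\<integral>\<^sup>+y. ennreal (energy_density f (y, x)) \<partial>circle)" for x
  proof -
    have "ennreal (cmod (fejer_mean M f x - f x) ^ 4)
      \<le> (\<integral>\<^sup>+h. ennreal (fejer_kernel M h * cmod (f (x + h) - f x) ^ 4) \<partial>circle)"
      unfolding fejer_mean_minus[OF f M]
      by (rule jensen_power4) (auto simp: fejer_kernel_nonneg fejer_kernel_integrable fejer_kernel_integral M intro!: measurable_circle_borel)
    also have "\<dots> \<le> (\<integral>\<^sup>+h. ennreal (1 / (pi * real M)) * ennreal (energy_density f (h + x, x)) \<partial>circle)"
    proof (rule nn_integral_mono)
      fix h
      have "fejer_kernel M h * cmod (f (x + h) - f x) ^ 4 \<le> (1 / (pi * real M)) * energy_density f (h + x, x)"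
      proof (cases "cos h = 1")
        case True
        then obtain n :: int where "h = of_int n * (2 * pi)" using cos_one_2pi_int[of h] by auto
        then have "f (x + h) = f x"
          using periodic_int_shift[of f x n, OF fp] by (simp add: mult.commute)
        then show ?thesis by (simp add: energy_density_def)
      next
        case False
        then have "1 - cos h > 0" using cos_le_one[of h] by linarith
        have "fejer_kernel M h * (1 - cos h) * (cmod (f (x + h) - f x) ^ 4 / (1 - cos h))
          \<le> 1 / (pi * real M) * (cmod (f (x + h) - f x) ^ 4 / (1 - cos h))"
          by (rule mult_right_mono[OF fejer_kernel_decay[OF M]]) (use \<open>1 - cos h > 0\<close> in simp)
        then show ?thesis using \<open>1 - cos h > 0\<close> by (simp add: energy_density_def add.commute)
      qed
      then show "ennreal (fejer_kernel M h * cmod (f (x + h) - f x) ^ 4)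
        \<le> ennreal (1 / (pi * real M)) * ennreal (energy_density f (h + x, x))"
        by (subst ennreal_mult[symmetric]) (auto intro: ennreal_leI)
    qed
    also have "\<dots> = ennreal (1 / (pi * real M)) * (\<integral>\<^sup>+h. ennreal (energy_density f (h + x, x)) \<partial>circle)"
      by (rule nn_integral_cmult) (auto simp: energy_density_def intro!: measurable_circle_borel)
    also have "(\<integral>\<^sup>+h. ennreal (energy_density f (h + x, x)) \<partial>circle) = (\<integral>\<^sup>+y. ennreal (energy_density f (y, x)) \<partial>circle)"
      by (rule nn_integral_circle_shift[of "\<lambda>y. ennreal (energy_density f (y, x))"]) (auto simp: energy_density_def fp c)
    finally show ?thesis .
  qed
  have "L4 (\<lambda>x. fejer_mean M f x - f x)
    \<le> (\<integral>\<^sup>+x. ennreal (1 / (pi * real M)) * (\<integral>\<^sup>+y. ennreal (energy_density f (y, x)) \<partial>circle) \<partial>circle)"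
    unfolding L4_def by (rule nn_integral_mono) (rule pt)
  also have "\<dots> = ennreal (1 / (pi * real M)) * W_energy f"
    unfolding W_energy_snd[OF f(1)]
  proof (rule nn_integral_cmult)
    have "(\<lambda>(x, y). ennreal (energy_density f (y, x))) \<in> borel_measurable circle2"
      by (simp add: energy_density_def split_beta')
    then show "(\<lambda>x. \<integral>\<^sup>+ y. ennreal (energy_density f (y, x)) \<partial>circle) \<in> borel_measurable circle"
      by (rule circle.borel_measurable_nn_integral)
  qed
  finally show ?thesis .
qed

interpretation circle3: pair_sigma_finite circle2 circle
  by unfold_locales

text \<open>The energy is convex and translation invariant, and a Fejer mean is an average of translates.\<close>

lemma fejer_mean_W_energy:
  assumes f: "periodic_borel f" "integrable circle f" and M: "M > 0"
  shows "W_energy (fejer_mean M f) \<le> W_energy f"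
proof -
  note [measurable] = periodic_borel_measurable[OF f(1)]
  have pt: "ennreal (energy_density (fejer_mean M f) p)
     \<le> (\<integral>\<^sup>+h. ennreal (fejer_kernel M h) * ennreal (energy_density (\<lambda>x. f (x + h)) p) \<partial>circle)" for p
  proof -
    obtain x y where p: "p = (x, y)" by force
    define w where "w = inverse (1 - cos (x - y))"
    have w: "w \<ge> 0" by (simp add: w_def)
    have "ennreal (energy_density (fejer_mean M f) p) = ennreal w * ennreal (cmod (fejer_mean M f x - fejer_mean M f y) ^ 4)"
      by (subst ennreal_mult[symmetric]) (auto simp: energy_density_def p w w_def divide_inverse mult.commute)
    also have "\<dots> \<le> ennreal w * (\<integral>\<^sup>+h. ennreal (fejer_kernel M h * cmod (f (x + h) - f (y + h)) ^ 4) \<partial>circle)"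
      unfolding fejer_mean_diff[OF f]
      by (intro mult_left_mono jensen_power4) (auto simp: fejer_kernel_nonneg fejer_kernel_integrable fejer_kernel_integral M intro!: measurable_circle_borel)
    also have "\<dots> = (\<integral>\<^sup>+h. ennreal w * ennreal (fejer_kernel M h * cmod (f (x + h) - f (y + h)) ^ 4) \<partial>circle)"
      by (rule nn_integral_cmult[symmetric]) (auto intro!: measurable_circle_borel)
    also have "\<dots> = (\<integral>\<^sup>+h. ennreal (fejer_kernel M h) * ennreal (energy_density (\<lambda>x. f (x + h)) p) \<partial>circle)"
      by (intro nn_integral_cong)
        (auto simp: ennreal_mult[symmetric] fejer_kernel_nonneg w energy_density_def p w_def divide_inverse algebra_simps)
    finally show ?thesis .
  qed
  have "W_energy (fejer_mean M f) \<le> (\<integral>\<^sup>+p. \<integral>\<^sup>+h. ennreal (fejer_kernel M h) * ennreal (energy_density (\<lambda>x. f (x + h)) p) \<partial>circle \<partial>circle2)"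
    unfolding W_energy_def by (rule nn_integral_mono) (rule pt)
  also have "\<dots> = (\<integral>\<^sup>+h. \<integral>\<^sup>+p. ennreal (fejer_kernel M h) * ennreal (energy_density (\<lambda>x. f (x + h)) p) \<partial>circle2 \<partial>circle)"
  proof -
    have m1: "(\<lambda>z. fst (fst z)) \<in> borel_measurable (circle2 \<Otimes>\<^sub>M circle)"
       "(\<lambda>z. snd (fst z)) \<in> borel_measurable (circle2 \<Otimes>\<^sub>M circle)"
       "(\<lambda>z. snd z) \<in> borel_measurable (circle2 \<Otimes>\<^sub>M circle)"
      using measurable_compose[OF measurable_fst measurable_fst_circle, of circle2 circle]
        measurable_compose[OF measurable_fst measurable_snd_circle, of circle2 circle]
      by (auto simp: comp_def)
    note [measurable] = m1
    show ?thesis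
      by (rule circle3.Fubini'[symmetric]) (simp add: split_beta' energy_density_def)
  qed
  also have "\<dots> = (\<integral>\<^sup>+h. ennreal (fejer_kernel M h) * W_energy (\<lambda>x. f (x + h)) \<partial>circle)"
    unfolding W_energy_def by (intro nn_integral_cong nn_integral_cmult measurable_compose[OF measurable_energy_density]) auto
  also have "\<dots> = (\<integral>\<^sup>+h. ennreal (fejer_kernel M h) * W_energy f \<partial>circle)"
    by (simp add: W_energy_shift f)
  also have "\<dots> = (\<integral>\<^sup>+h. ennreal (fejer_kernel M h) \<partial>circle) * W_energy f"
    by (rule nn_integral_multc) (auto intro!: measurable_circle_borel)
  also have "(\<integral>\<^sup>+h. ennreal (fejer_kernel M h) \<partial>circle) = 1"
    by (subst nn_integral_eq_integral) (auto simp: fejer_kernel_integrable fejer_kernel_nonneg fejer_kernel_integral M)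
  finally show ?thesis by simp
qed

section \<open>Semicontinuity and lower-order norms\<close>

lemma nn_integral_fatou_le:
  fixes F :: "nat \<Rightarrow> 'a \<Rightarrow> ennreal"
  assumes m: "\<And>n. F n \<in> borel_measurable M" and lim: "AE x in M. (\<lambda>n. F n x) \<longlonglongrightarrow> G x"
    and le: "eventually (\<lambda>n. (\<integral>\<^sup>+x. F n x \<partial>M) \<le> C) sequentially"
  shows "(\<integral>\<^sup>+x. G x \<partial>M) \<le> C"
proof -
  have "(\<integral>\<^sup>+x. G x \<partial>M) = (\<integral>\<^sup>+x. liminf (\<lambda>n. F n x) \<partial>M)"
    by (rule nn_integral_cong_AE) (use lim in \<open>eventually_elim, simp add: lim_imp_Liminf\<close>)
  also have "\<dots> \<le> liminf (\<lambda>n. \<integral>\<^sup>+x. F n x \<partial>M)"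
    by (rule nn_integral_liminf) (rule m)
  also have "\<dots> \<le> liminf (\<lambda>n. C)"
    by (rule Liminf_mono) (rule le)
  also have "\<dots> = C" by (simp add: Liminf_const)
  finally show ?thesis .
qed

lemma AE_circle2:
  assumes "AE x in circle. P x"
  shows "AE p in circle2. P (fst p) \<and> P (snd p)"
proof -
  obtain N where N: "{x \<in> space circle. \<not> P x} \<subseteq> N" "emeasure circle N = 0" "N \<in> sets circle"
    using AE_E[OF assms] by blast
  note [measurable] = N(3)
  have ae: "AE x in circle. x \<notin> N"
    by (rule AE_not_in) (use N in auto)
  have "AE p in circle2. fst p \<notin> N"
    by (rule circle2.AE_pair_measure) (use ae in auto)
  moreover have "AE p in circle2. snd p \<notin> N"
    by (rule circle2.AE_pair_measure) (use ae in auto)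
  ultimately show ?thesis
    using AE_space by eventually_elim (use N in \<open>auto simp: space_pair_measure\<close>)
qed

lemma energy_density_tendsto:
  assumes "(\<lambda>n. f n (fst p)) \<longlonglongrightarrow> g (fst p)" "(\<lambda>n. f n (snd p)) \<longlonglongrightarrow> g (snd p)"
  shows "(\<lambda>n. energy_density (f n) p) \<longlonglongrightarrow> energy_density g p"
  unfolding energy_density_def divide_inverse by (intro tendsto_intros assms)

text \<open>Lower semicontinuity of the energy under convergence almost everywhere.\<close>

lemma W_energy_fatou:
  assumes "\<And>n. periodic_borel (f n)" "AE x in circle. (\<lambda>n. f n x) \<longlonglongrightarrow> g x"
    "eventually (\<lambda>n. W_energy (f n) \<le> C) sequentially"
  shows "W_energy g \<le> C"
  unfolding W_energy_def
proof (rule nn_integral_fatou_le[OF _ _ assms(3)[unfolded W_energy_def]])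
  show "(\<lambda>p. ennreal (energy_density (f n) p)) \<in> borel_measurable circle2" for n
    using measurable_energy_density[OF periodic_borel_measurable[OF assms(1)[of n]]] by simp
  show "AE p in circle2. (\<lambda>n. ennreal (energy_density (f n) p)) \<longlonglongrightarrow> ennreal (energy_density g p)"
    using AE_circle2[OF assms(2)] by eventually_elim (auto intro!: tendsto_ennrealI energy_density_tendsto)
qed

lemma L4_fatou:
  assumes "\<And>n. periodic_borel (f n)" "AE x in circle. (\<lambda>n. f n x) \<longlonglongrightarrow> g x"
    "eventually (\<lambda>n. L4 (f n) \<le> C) sequentially"
  shows "L4 g \<le> C"
  unfolding L4_def
proof (rule nn_integral_fatou_le[OF _ _ assms(3)[unfolded L4_def]])
  show "(\<lambda>x. ennreal (cmod (f n x) ^ 4)) \<in> borel_measurable circle" for n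
    using periodic_borel_measurable[OF assms(1)[of n]] by (intro measurable_circle_borel) simp
  show "AE x in circle. (\<lambda>n. ennreal (cmod (f n x) ^ 4)) \<longlonglongrightarrow> ennreal (cmod (g x) ^ 4)"
    using assms(2) by eventually_elim (intro tendsto_ennrealI tendsto_intros)
qed

lemma power4_add_le: "0 \<le> a \<Longrightarrow> 0 \<le> b \<Longrightarrow> (a + b)^4 \<le> 8 * (a^4 + b^4)" for a b :: real
  using power4_tangent[of "(a+b)/2" a] power4_tangent[of "(a+b)/2" b]
  by (simp add: power4_eq_xxxx power3_eq_cube field_simps)

lemma norm_power4_add_le: "cmod (z + w) ^ 4 \<le> 8 * (cmod z ^ 4 + cmod w ^ 4)"
  by (rule order_trans[OF power_mono[OF norm_triangle_ineq] power4_add_le]) auto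

lemma L4_add:
  assumes "periodic_borel f" "periodic_borel g"
  shows "L4 (\<lambda>x. f x + g x) \<le> ennreal 8 * (L4 f + L4 g)"
proof -
  have [measurable]: "f \<in> borel_measurable circle" "g \<in> borel_measurable circle"
    using assms by (auto intro: measurable_circle_borel periodic_borel_measurable)
  have "L4 (\<lambda>x. f x + g x) \<le> (\<integral>\<^sup>+x. ennreal 8 * (ennreal (cmod (f x) ^ 4) + ennreal (cmod (g x) ^ 4)) \<partial>circle)"
    unfolding L4_def
  proof (rule nn_integral_mono)
    fix x
    show "ennreal (cmod (f x + g x) ^ 4) \<le> ennreal 8 * (ennreal (cmod (f x) ^ 4) + ennreal (cmod (g x) ^ 4))"
      using ennreal_leI[OF norm_power4_add_le[of "f x" "g x"]] by (subst (asm) ennreal_mult) auto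
  qed
  also have "\<dots> = ennreal 8 * (L4 f + L4 g)"
    unfolding L4_def by (simp add: nn_integral_cmult nn_integral_add)
  finally show ?thesis .
qed

lemma L4_diff:
  assumes "periodic_borel f" "periodic_borel g" "periodic_borel h" "L4 (\<lambda>x. f x - g x) \<le> ennreal A" "L4 (\<lambda>x. g x - h x) \<le> ennreal B"
    "0 \<le> A" "0 \<le> B"
  shows "L4 (\<lambda>x. f x - h x) \<le> ennreal (8 * (A + B))"
proof -
  have "L4 (\<lambda>x. f x - h x) = L4 (\<lambda>x. (f x - g x) + (g x - h x))" by simp
  also have "\<dots> \<le> ennreal 8 * (L4 (\<lambda>x. f x - g x) + L4 (\<lambda>x. g x - h x))"
    by (intro L4_add periodic_borel_diff assms)
  also have "\<dots> \<le> ennreal 8 * (ennreal A + ennreal B)"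
    by (intro mult_left_mono add_mono assms) auto
  also have "\<dots> = ennreal (8 * (A + B))" using assms by (simp add: ennreal_mult)
  finally show ?thesis .
qed

lemma L4_minus_commute: "L4 (\<lambda>x. f x - g x) = L4 (\<lambda>x. g x - f x)"
  by (simp add: L4_def norm_minus_commute)

lemma W_energy_add:
  assumes "periodic_borel f" "periodic_borel g"
  shows "W_energy (\<lambda>x. f x + g x) \<le> ennreal 8 * (W_energy f + W_energy g)"
proof -
  have [measurable]: "energy_density f \<in> borel_measurable circle2" "energy_density g \<in> borel_measurable circle2"
    using assms by (auto intro: measurable_energy_density periodic_borel_measurable)
  have "W_energy (\<lambda>x. f x + g x) \<le> (\<integral>\<^sup>+p. ennreal 8 * (ennreal (energy_density f p) + ennreal (energy_density g p)) \<partial>circle2)"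
    unfolding W_energy_def
  proof (rule nn_integral_mono)
    fix p
    have "cmod ((f (fst p) - f (snd p)) + (g (fst p) - g (snd p))) ^ 4 / (1 - cos (fst p - snd p))
      \<le> 8 * (cmod (f (fst p) - f (snd p)) ^ 4 + cmod (g (fst p) - g (snd p)) ^ 4) / (1 - cos (fst p - snd p))"
      by (rule divide_right_mono[OF norm_power4_add_le]) simp
    then have "energy_density (\<lambda>x. f x + g x) p \<le> 8 * (energy_density f p + energy_density g p)"
      by (simp add: energy_density_def add_diff_add add_divide_distrib)
    then show "ennreal (energy_density (\<lambda>x. f x + g x) p) \<le> ennreal 8 * (ennreal (energy_density f p) + ennreal (energy_density g p))"
      using ennreal_leI[of "energy_density (\<lambda>x. f x + g x) p" "8 * (energy_density f p + energy_density g p)"]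
      by (subst (asm) ennreal_mult) auto
  qed
  also have "\<dots> = ennreal 8 * (W_energy f + W_energy g)"
    unfolding W_energy_def by (simp add: nn_integral_cmult nn_integral_add)
  finally show ?thesis .
qed

lemma power4_young_L1: "0 \<le> (a::real) \<Longrightarrow> r > 0 \<Longrightarrow> a \<le> r + a^4 / r^3"
proof -
  assume "0 \<le> a" "r > 0"
  then have "r * (a / r) \<le> r * (1 + (a/r)^4)" by (intro mult_left_mono le_one_plus_power4) auto
  moreover have "r * (1 + (a/r)^4) = r + a^4 / r^3"
    using \<open>r > 0\<close> by (simp add: power_divide distrib_left power4_eq_xxxx power3_eq_cube)
  ultimately show ?thesis using \<open>r > 0\<close> by simp
qed

lemma power4_young_L2: "r > 0 \<Longrightarrow> (a::real)\<^sup>2 \<le> r + a^4 / r"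
proof -
  assume "r > 0"
  have "0 \<le> (a\<^sup>2 - r)\<^sup>2" by simp
  then have "2 * r * a\<^sup>2 \<le> r * r + a^4" by (simp add: power2_eq_square power4_eq_xxxx algebra_simps)
  moreover have "r * a\<^sup>2 \<le> 2 * r * a\<^sup>2" using \<open>r > 0\<close> by simp
  ultimately have "r * a\<^sup>2 \<le> r * r + a^4" by linarith
  then show ?thesis using \<open>r > 0\<close> by (simp add: field_simps)
qed

lemma L4_integrable:
  assumes f: "periodic_borel f" and L: "L4 f \<le> ennreal B" "0 \<le> B"
  shows "integrable circle (\<lambda>x. cmod (f x) ^ 4)" "(LINT x|circle. cmod (f x) ^ 4) \<le> B"
proof -
  have [measurable]: "f \<in> borel_measurable circle"
    using f by (auto intro: measurable_circle_borel periodic_borel_measurable)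
  show i: "integrable circle (\<lambda>x. cmod (f x) ^ 4)"
    by (rule integrableI_nonneg) (use L in \<open>auto simp: L4_def less_top[symmetric] top_unique\<close>)
  show "(LINT x|circle. cmod (f x) ^ 4) \<le> B"
    using L nn_integral_eq_integral[OF i] by (simp add: L4_def)
qed

lemma L4_imp_L1:
  assumes f: "periodic_borel f" and L: "L4 f \<le> ennreal B" "0 \<le> B"
  shows "integrable circle f" "r > 0 \<Longrightarrow> (LINT x|circle. cmod (f x)) \<le> 2 * pi * r + B / r^3"
proof -
  have [measurable]: "f \<in> borel_measurable circle"
    using f by (auto intro: measurable_circle_borel periodic_borel_measurable)
  have i: "integrable circle (\<lambda>x. r + cmod (f x) ^ 4 / r^3)" for r
    using L4_integrable[OF assms] by simp
  have *: "cmod (f x) \<le> 1 + cmod (f x) ^ 4" for x by (rule le_one_plus_power4) simp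
  show int: "integrable circle f"
    by (rule Bochner_Integration.integrable_bound[OF i[of 1]]) (use * in \<open>auto intro!: AE_I2 order_trans[OF *]\<close>)
  show "(LINT x|circle. cmod (f x)) \<le> 2 * pi * r + B / r^3" if "r > 0"
  proof -
    have "(LINT x|circle. cmod (f x)) \<le> (LINT x|circle. r + cmod (f x) ^ 4 / r^3)"
      by (intro integral_mono i) (use int that power4_young_L1 in auto)
    also have "\<dots> = 2 * pi * r + (LINT x|circle. cmod (f x) ^ 4) / r^3"
      using L4_integrable[OF assms] by (simp add: measure_circle)
    also have "\<dots> \<le> 2 * pi * r + B / r^3"
      using L4_integrable(2)[OF assms] that by (intro add_left_mono divide_right_mono) auto
    finally show ?thesis .
  qed
qed

lemma L4_imp_L2:
  assumes f: "periodic_borel f" and L: "L4 f \<le> ennreal B" "0 \<le> B"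
  shows "integrable circle (\<lambda>x. (cmod (f x))\<^sup>2)" "r > 0 \<Longrightarrow> (LINT x|circle. (cmod (f x))\<^sup>2) \<le> 2 * pi * r + B / r"
proof -
  have [measurable]: "f \<in> borel_measurable circle"
    using f by (auto intro: measurable_circle_borel periodic_borel_measurable)
  have i: "integrable circle (\<lambda>x. r + cmod (f x) ^ 4 / r)" for r
    using L4_integrable[OF assms] by simp
  have *: "(cmod (f x))\<^sup>2 \<le> 1 + cmod (f x) ^ 4" for x using power4_young_L2[of 1 "cmod (f x)"] by simp
  show int: "integrable circle (\<lambda>x. (cmod (f x))\<^sup>2)"
    by (rule Bochner_Integration.integrable_bound[OF i[of 1]]) (use * in \<open>auto intro!: AE_I2 order_trans[OF *]\<close>)
  show "(LINT x|circle. (cmod (f x))\<^sup>2) \<le> 2 * pi * r + B / r" if "r > 0"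
  proof -
    have "(LINT x|circle. (cmod (f x))\<^sup>2) \<le> (LINT x|circle. r + cmod (f x) ^ 4 / r)"
      by (intro integral_mono i) (use int that power4_young_L2 in auto)
    also have "\<dots> = 2 * pi * r + (LINT x|circle. cmod (f x) ^ 4) / r"
      using L4_integrable[OF assms] by (simp add: measure_circle)
    also have "\<dots> \<le> 2 * pi * r + B / r"
      using L4_integrable(2)[OF assms] that by (intro add_left_mono divide_right_mono) auto
    finally show ?thesis .
  qed
qed

section \<open>Functions from their Fourier coefficients\<close>

lemma integrable_trig [simp]: "integrable circle (trig A a)"
  unfolding trig_def by auto

lemma fourier_coeff_trig:
  assumes "finite A" "\<And>k. k \<notin> A \<Longrightarrow> a k = 0"
  shows "fourier_coeff (trig A a) k = a k"
proof -
  have "(LINT x|circle. trig A a x * cis (- (of_int k * x))) = (LINT x|circle. (\<Sum>j\<in>A. a j * cis (of_int (j - k) * x)))"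
    unfolding trig_def sum_distrib_right mult.assoc cis_mult by (simp add: algebra_simps)
  also have "\<dots> = (\<Sum>j\<in>A. a j * (LINT x|circle. cis (of_int (j - k) * x)))"
    by (subst Bochner_Integration.integral_sum) (auto simp del: of_int_diff)
  also have "\<dots> = of_real (2 * pi) * a k"
    unfolding integral_circle_cis using assms by (auto simp: if_distrib[of "\<lambda>z. _ * z"] sum.delta cong: if_cong)
  finally show ?thesis by (simp add: fourier_coeff_circle scaleR_conv_of_real)
qed

lemma trig_cong: "(\<And>k. k \<in> A \<Longrightarrow> a k = b k) \<Longrightarrow> trig A a = trig A b"
  unfolding trig_def by (intro ext sum.cong) auto

lemma fourier_coeff_fejer_sum:
  "fourier_coeff (fejer_sum M a) k = (if 1 \<le> k \<and> k < int M then of_real (1 - of_int k / real M) * a k else 0)"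
proof -
  have "fejer_sum M a = trig {1..<int M} (\<lambda>k. if 1 \<le> k \<and> k < int M then of_real (1 - of_int k / real M) * a k else 0)"
    unfolding fejer_sum_def by (rule trig_cong) auto
  then show ?thesis by (simp only:) (rule fourier_coeff_trig, auto)
qed

lemma integrable_fejer_sum [simp]: "integrable circle (fejer_sum M a)"
  by (simp add: fejer_sum_def)

lemma fejer_mean_fejer_sum:
  "fejer_mean M (fejer_sum N a) = trig {1..<min (int M) (int N)} (\<lambda>k. of_real (1 - of_int k / real M) * of_real (1 - of_int k / real N) * a k)"
proof -
  have "fejer_mean M (fejer_sum N a) = fejer_sum M (fourier_coeff (fejer_sum N a))"
    by (rule fejer_mean_eq_fejer_sum) (auto simp: fourier_coeff_fejer_sum)
  also have "\<dots> = trig {1..<min (int M) (int N)} (\<lambda>k. of_real (1 - of_int k / real M) * of_real (1 - of_int k / real N) * a k)"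
    unfolding fejer_sum_def[of M] trig_def
    by (intro ext sum.mono_neutral_cong_right) (auto simp: fourier_coeff_fejer_sum)
  finally show "fejer_mean M (fejer_sum N a) = trig {1..<min (int M) (int N)} (\<lambda>k. of_real (1 - of_int k / real M) * of_real (1 - of_int k / real N) * a k)" .
qed

text \<open>Fejer means are Fourier multipliers.\<close>

lemma fejer_mean_fejer_sum_commute: "fejer_mean M (fejer_sum N a) = fejer_mean N (fejer_sum M a)"
  unfolding fejer_mean_fejer_sum by (rule arg_cong2[where f=trig]) (auto simp: min.commute mult_ac)

lemma fourier_coeff_L1:
  assumes "integrable circle f" "integrable circle g"
  shows "cmod (fourier_coeff f k - fourier_coeff g k) \<le> (LINT x|circle. cmod (f x - g x))"
proof -
  have m: "(\<lambda>x. cis (- (of_int k * x))) \<in> borel_measurable borel"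
    using periodic_borel_measurable[OF periodic_borel_cis[of "-k"]] by simp
  have i: "integrable circle (\<lambda>x. f x * cis (- (of_int k * x)))" "integrable circle (\<lambda>x. g x * cis (- (of_int k * x)))"
    by (auto intro!: integrable_circle_mult_bounded(1)[where B=1] assms m)
  have "fourier_coeff f k - fourier_coeff g k = (1/(2*pi)) *\<^sub>R (LINT x|circle. (f x - g x) * cis (- (of_int k * x)))"
    unfolding fourier_coeff_circle left_diff_distrib using i by (simp add: scaleR_diff_right)
  also have "cmod \<dots> = (1/(2*pi)) * cmod (LINT x|circle. (f x - g x) * cis (- (of_int k * x)))"
    by simp
  also have "\<dots> \<le> 1 * (LINT x|circle. cmod ((f x - g x) * cis (- (of_int k * x))))"
    using pi_gt3 by (intro mult_mono integral_norm_bound) auto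
  finally show ?thesis by (simp add: norm_mult)
qed

text \<open>Young's inequality \<open>a \<le> r + a\<^sup>4 / r\<^sup>3\<close> replaces Hoelder's inequality: the first term is small for small
\<open>r\<close>, the second one then for large \<open>n\<close>.\<close>

lemma L4_tendsto_fourier_coeff:
  assumes f: "\<And>n. periodic_borel (f n)" and g: "periodic_borel g" "integrable circle g"
    and lim: "\<And>n. L4 (\<lambda>x. f n x - g x) \<le> ennreal (B n)" "\<And>n. 0 \<le> B n" "B \<longlonglongrightarrow> 0"
  shows "(\<lambda>n. LINT x|circle. cmod (f n x - g x)) \<longlonglongrightarrow> 0"
    "(\<lambda>n. fourier_coeff (f n) k) \<longlonglongrightarrow> fourier_coeff g k"
proof -
  have d: "periodic_borel (\<lambda>x. f n x - g x)" for n by (intro periodic_borel_diff f g)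
  have if': "integrable circle (f n)" for n
    using Bochner_Integration.integrable_add[OF L4_imp_L1(1)[OF d lim(1,2)] g(2)] by simp
  show *: "(\<lambda>n. LINT x|circle. cmod (f n x - g x)) \<longlonglongrightarrow> 0"
  proof (rule LIMSEQ_I)
    fix e :: real assume "e > 0"
    define r where "r = e / (8 * pi)"
    have r: "r > 0" using \<open>e > 0\<close> by (simp add: r_def)
    have "(\<lambda>n. B n / r^3) \<longlonglongrightarrow> 0 / r^3" by (intro tendsto_intros lim) (use r in auto)
    then have "eventually (\<lambda>n. B n / r^3 < e / 2) sequentially"
      using \<open>e > 0\<close> by (intro order_tendstoD(2)[of _ "0 / r^3"]) auto
    then obtain N where N: "\<And>n. n \<ge> N \<Longrightarrow> B n / r^3 < e / 2" by (auto simp: eventually_sequentially)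
    have "norm ((LINT x|circle. cmod (f n x - g x)) - 0) < e" if "n \<ge> N" for n
    proof -
      have "(LINT x|circle. cmod (f n x - g x)) \<le> 2 * pi * r + B n / r^3"
        by (rule L4_imp_L1(2)[OF d lim(1,2) r])
      also have "\<dots> < e" using N[OF that] by (simp add: r_def) (use \<open>e > 0\<close> in linarith)
      finally show ?thesis by simp
    qed
    then show "\<exists>no. \<forall>n\<ge>no. norm ((LINT x|circle. cmod (f n x - g x)) - 0) < e" by blast
  qed
  have "(\<lambda>n. fourier_coeff (f n) k - fourier_coeff g k) \<longlonglongrightarrow> 0"
    by (rule Lim_null_comparison[OF _ *]) (auto intro!: always_eventually fourier_coeff_L1 if' g)
  then show "(\<lambda>n. fourier_coeff (f n) k) \<longlonglongrightarrow> fourier_coeff g k"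
    by (rule LIM_zero_cancel)
qed

lemma fejer_weight_tendsto: "(\<lambda>M. complex_of_real (1 - of_int k / real M)) \<longlonglongrightarrow> 1"
proof -
  have "(\<lambda>M. 1 - of_int k / real M) \<longlonglongrightarrow> 1 - 0"
    by (intro tendsto_intros real_tendsto_divide_at_top[OF tendsto_const] filterlim_real_sequentially)
  then have "(\<lambda>M. complex_of_real (1 - of_int k / real M)) \<longlonglongrightarrow> complex_of_real 1"
    using tendsto_of_real by fastforce
  then show ?thesis by simp
qed

lemma sixteen_power_tendsto: "filterlim (\<lambda>n. 16 ^ n :: nat) at_top sequentially"
  by (rule filterlim_subseq) (auto simp: strict_mono_def)

lemma fourier_coeff_fejer_sum_tendsto:
  assumes "\<And>k. k < 1 \<Longrightarrow> a k = 0"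
  shows "(\<lambda>M. fourier_coeff (fejer_sum M a) k) \<longlonglongrightarrow> a k"
proof (cases "k \<ge> 1")
  case True
  have "(\<lambda>M. complex_of_real (1 - of_int k / real M) * a k) \<longlonglongrightarrow> 1 * a k"
    by (intro tendsto_intros fejer_weight_tendsto)
  moreover have "eventually (\<lambda>M. complex_of_real (1 - of_int k / real M) * a k = fourier_coeff (fejer_sum M a) k) sequentially"
    using eventually_gt_at_top[of "nat k"] by eventually_elim (use True in \<open>auto simp: fourier_coeff_fejer_sum\<close>)
  ultimately show ?thesis by (simp add: tendsto_cong)
next
  case False
  then show ?thesis by (simp add: fourier_coeff_fejer_sum assms)
qed

text \<open>The function with Fourier coefficients \<open>a\<close>. The sequence \<open>16\<^sup>n\<close> grows fast enough for convergence almost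
everywhere under an energy bound. Where the limit does not exist the value is irrelevant.\<close>

definition fejer_limit :: "(int \<Rightarrow> complex) \<Rightarrow> real \<Rightarrow> complex" where
  "fejer_limit a x = lim (\<lambda>n. fejer_sum (16 ^ n) a x)"

lemma periodic_borel_fejer_limit: "periodic_borel (fejer_limit a)"
proof -
  have p: "fejer_sum M a (x + 2*pi) = fejer_sum M a x" for M x
    by (rule periodic_borel_periodic[OF periodic_borel_fejer_sum])
  have m [measurable]: "fejer_sum M a \<in> borel_measurable borel" for M
    by (rule periodic_borel_measurable[OF periodic_borel_fejer_sum])
  show ?thesis unfolding periodic_borel_def periodic_2pi_def fejer_limit_def[abs_def] by (auto simp: p)
qed

text \<open>Sequences of Fourier coefficients of functions in the space with positive spectrum, characterised
without reference to a function.\<close>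

locale bounded_spectrum =
  fixes a :: "int \<Rightarrow> complex" and C :: real
  assumes pos: "\<And>k. k < 1 \<Longrightarrow> a k = 0"
    and bd: "\<And>M. M > 0 \<Longrightarrow> W_energy (fejer_sum M a) \<le> ennreal C"
    and C0: "0 \<le> C"
begin

text \<open>With \<open>S\<^sub>M\<close> for the Fejer mean, compare both Fejer sums with \<open>S\<^sub>N S\<^sub>M a = S\<^sub>M S\<^sub>N a\<close>, which is a Fejer mean of either of them.\<close>

lemma fejer_sum_L4_cauchy:
  assumes "M > 0" "N > 0"
  shows "L4 (\<lambda>x. fejer_sum M a x - fejer_sum N a x) \<le> ennreal (8 * (C / (pi * real N) + C / (pi * real M)))"
proof (rule L4_diff[where g="fejer_mean N (fejer_sum M a)"])
  have *: "L4 (\<lambda>x. fejer_mean N (fejer_sum M a) x - fejer_sum M a x) \<le> ennreal (C / (pi * real N))"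
    if "M > 0" "N > 0" for M N
  proof -
    have "L4 (\<lambda>x. fejer_mean N (fejer_sum M a) x - fejer_sum M a x) \<le> ennreal (1 / (pi * real N)) * W_energy (fejer_sum M a)"
      by (rule fejer_mean_L4_error) (use that in auto)
    also have "\<dots> \<le> ennreal (1 / (pi * real N)) * ennreal C"
      by (intro mult_left_mono bd that) auto
    finally show ?thesis using C0 by (simp add: ennreal_mult[symmetric])
  qed
  show "L4 (\<lambda>x. fejer_sum M a x - fejer_mean N (fejer_sum M a) x) \<le> ennreal (C / (pi * real N))"
    by (subst L4_minus_commute) (rule *[OF assms])
  show "L4 (\<lambda>x. fejer_mean N (fejer_sum M a) x - fejer_sum N a x) \<le> ennreal (C / (pi * real M))"
    by (subst fejer_mean_fejer_sum_commute) (rule *[OF assms(2,1)])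
qed (use C0 in \<open>auto intro!: periodic_borel_fejer_mean\<close>)

text \<open>The differences of consecutive terms are summable in \<open>L\<^sup>1\<close>, hence their sum converges absolutely
almost everywhere.\<close>

lemma AE_fejer_limit: "AE x in circle. (\<lambda>n. fejer_sum (16 ^ n) a x) \<longlonglongrightarrow> fejer_limit a x"
proof -
  define d where "d n x = fejer_sum (16 ^ Suc n) a x - fejer_sum (16 ^ n) a x" for n x
  have pd: "periodic_borel (d n)" for n unfolding d_def by (intro periodic_borel_diff) auto
  have Ld: "L4 (d n) \<le> ennreal (6 * C / 16 ^ n)" for n
  proof -
    have "L4 (d n) \<le> ennreal (8 * (C / (pi * real (16 ^ n)) + C / (pi * real (16 ^ Suc n))))"
      unfolding d_def by (rule fejer_sum_L4_cauchy) auto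
    also have "8 * (C / (pi * real (16 ^ n)) + C / (pi * real (16 ^ Suc n))) = (17/2) * C / (pi * 16 ^ n)"
      by (simp add: field_simps)
    also have "\<dots> \<le> 6 * C / 16 ^ n"
    proof -
      have "(17/2) * C \<le> (6 * C) * pi" using C0 pi_gt3 mult_left_mono[of 3 pi "6 * C"] by linarith
      then show ?thesis by (simp add: field_simps)
    qed
    finally show ?thesis by (simp add: ennreal_leI)
  qed
  have AEs: "AE x in circle. summable (\<lambda>n. cmod (cmod (d n x)))"
  proof -
    have s: "summable (\<lambda>n. LINT x|circle. norm (cmod (d n x)))"
    proof (rule summable_comparison_test')
      show "summable (\<lambda>n. (2 * pi + 6 * C) * (1/2::real) ^ n)" by (intro summable_mult summable_geometric) auto
      \<comment> \<open>The bound of order \<open>16\<^sup>-\<^sup>n\<close> for the fourth power and the choice \<open>r = 2\<^sup>-\<^sup>n\<close> balance the two terms of Young's inequality.\<close>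
      show "norm (LINT x|circle. norm (cmod (d n x))) \<le> (2 * pi + 6 * C) * (1/2) ^ n" if "n \<ge> 0" for n
      proof -
        have "(LINT x|circle. cmod (d n x)) \<le> 2 * pi * (1/2)^n + (6 * C / 16 ^ n) / ((1/2)^n)^3"
          by (rule L4_imp_L1(2)[OF pd Ld]) (use C0 in auto)
        also have "(6 * C / 16 ^ n) / ((1/2)^n)^3 = 6 * C * (1/2) ^ n"
        proof -
          have "(16::real)^n = 2^n * 8^n" by (simp flip: power_mult_distrib)
          moreover have "((1/2)^n)^3 = (1/8::real)^n" by (simp add: power_mult[symmetric] mult.commute[of n]) (simp add: power_mult power_divide)
          ultimately show ?thesis by (simp add: power_divide field_simps)
        qed
        finally show ?thesis by (simp add: algebra_simps)
      qed
    qed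
    show "AE x in circle. summable (\<lambda>n. cmod (cmod (d n x)))"
    proof -
      have i: "integrable circle (\<lambda>x. cmod (d n x))" for n
        using L4_imp_L1(1)[OF pd Ld] C0 by auto
      have [measurable]: "(\<lambda>x. cmod (d n x)) \<in> borel_measurable circle" for n using i by blast
      have "(\<integral>\<^sup>+x. (\<Sum>n. ennreal (cmod (d n x))) \<partial>circle) = (\<Sum>n. \<integral>\<^sup>+x. ennreal (cmod (d n x)) \<partial>circle)"
        by (rule nn_integral_suminf) auto
      also have "\<dots> = (\<Sum>n. ennreal (LINT x|circle. cmod (d n x)))"
        by (simp add: nn_integral_eq_integral[OF i])
      also have "\<dots> = ennreal (\<Sum>n. LINT x|circle. cmod (d n x))"
        using s by (intro suminf_ennreal2) auto
      finally have "(\<integral>\<^sup>+x. (\<Sum>n. ennreal (cmod (d n x))) \<partial>circle) \<noteq> \<infinity>" by simp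
      then have "AE x in circle. (\<Sum>n. ennreal (cmod (d n x))) \<noteq> \<infinity>"
        by (intro nn_integral_PInf_AE) auto
      then show ?thesis by eventually_elim (auto intro: summable_suminf_not_top)
    qed
  qed
  from AEs show ?thesis
  proof eventually_elim
    case (elim x)
    then have "summable (\<lambda>n. d n x)" by (intro summable_norm_cancel[of "\<lambda>n. d n x"]) simp
    then have "convergent (\<lambda>n. \<Sum>i<n. d i x)" by (simp add: summable_iff_convergent)
    moreover have "(\<Sum>i<n. d i x) = fejer_sum (16 ^ n) a x" for n
    proof -
      have "(\<Sum>i<n. d i x) = fejer_sum (16 ^ n) a x - fejer_sum (16 ^ 0) a x"
        unfolding d_def by (rule sum_lessThan_telescope)
      then show ?thesis by (simp add: fejer_sum_def trig_def)
    qed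
    ultimately show ?case unfolding fejer_limit_def by (simp add: convergent_LIMSEQ_iff)
  qed
qed

lemma W_energy_fejer_limit: "W_energy (fejer_limit a) \<le> ennreal C"
  by (rule W_energy_fatou[OF _ AE_fejer_limit]) (auto intro!: bd always_eventually)

text \<open>Let one index of \<open>fejer_sum_L4_cauchy\<close> tend to infinity. The constant is improved in
\<open>L4_fejer_limit_error\<close> once the Fourier coefficients of the limit are known.\<close>

lemma L4_fejer_limit_error_crude:
  assumes "M > 0"
  shows "L4 (\<lambda>x. fejer_sum M a x - fejer_limit a x) \<le> ennreal (16 * C / (pi * real M))"
proof (rule L4_fatou)
  show "periodic_borel (\<lambda>x. fejer_sum M a x - fejer_sum (16 ^ n) a x)" for n by (intro periodic_borel_diff) auto
  show "AE x in circle. (\<lambda>n. fejer_sum M a x - fejer_sum (16 ^ n) a x) \<longlonglongrightarrow> fejer_sum M a x - fejer_limit a x"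
    using AE_fejer_limit by eventually_elim (intro tendsto_intros)
  have "eventually (\<lambda>n. M \<le> 16 ^ n) sequentially"
    using sixteen_power_tendsto by (simp add: filterlim_at_top)
  then show "eventually (\<lambda>n. L4 (\<lambda>x. fejer_sum M a x - fejer_sum (16 ^ n) a x) \<le> ennreal (16 * C / (pi * real M))) sequentially"
  proof eventually_elim
    case (elim n)
    have "L4 (\<lambda>x. fejer_sum M a x - fejer_sum (16 ^ n) a x) \<le> ennreal (8 * (C / (pi * real (16 ^ n)) + C / (pi * real M)))"
      by (rule fejer_sum_L4_cauchy) (use assms in auto)
    also have "\<dots> \<le> ennreal (8 * (C / (pi * real M) + C / (pi * real M)))"
      by (intro ennreal_leI mult_left_mono add_right_mono divide_left_mono) (use elim assms C0 in \<open>auto simp flip: of_nat_power\<close>)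
    finally show ?case by simp
  qed
qed

lemma integrable_fejer_limit: "integrable circle (fejer_limit a)"
proof -
  have "L4 (fejer_limit a) \<le> ennreal (16 * C / pi)"
    using L4_fejer_limit_error_crude[of 1] by (simp add: fejer_sum_def trig_def L4_def)
  then show ?thesis by (rule L4_imp_L1(1)[OF periodic_borel_fejer_limit]) (use C0 in auto)
qed

lemma fourier_coeff_fejer_limit: "fourier_coeff (fejer_limit a) k = a k"
proof -
  have "(\<lambda>n. fourier_coeff (fejer_sum (Suc n) a) k) \<longlonglongrightarrow> fourier_coeff (fejer_limit a) k"
  proof (rule L4_tendsto_fourier_coeff(2))
    show "L4 (\<lambda>x. fejer_sum (Suc n) a x - fejer_limit a x) \<le> ennreal (16 * C / pi * inverse (real (Suc n)))" for n
      using L4_fejer_limit_error_crude[of "Suc n"] by (simp add: field_simps)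
    show "(\<lambda>n. 16 * C / pi * inverse (real (Suc n))) \<longlonglongrightarrow> 0"
      using tendsto_mult_right_zero[OF LIMSEQ_inverse_real_of_nat] by blast
  qed (use C0 in \<open>auto intro!: periodic_borel_fejer_limit integrable_fejer_limit\<close>)
  moreover have "(\<lambda>n. fourier_coeff (fejer_sum (Suc n) a) k) \<longlonglongrightarrow> a k"
    using fourier_coeff_fejer_sum_tendsto[OF pos] by (rule LIMSEQ_Suc)
  ultimately show ?thesis by (rule LIMSEQ_unique)
qed

lemma fejer_mean_fejer_limit: "fejer_mean M (fejer_limit a) = fejer_sum M a"
proof -
  have "fourier_coeff (fejer_limit a) = a" by (rule ext) (rule fourier_coeff_fejer_limit)
  then show ?thesis
    using fejer_mean_eq_fejer_sum[OF periodic_borel_fejer_limit integrable_fejer_limit, of M] pos by simp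
qed

lemma L4_fejer_limit_error:
  assumes "M > 0"
  shows "L4 (\<lambda>x. fejer_sum M a x - fejer_limit a x) \<le> ennreal (C / (pi * real M))"
proof -
  have "L4 (\<lambda>x. fejer_sum M a x - fejer_limit a x) \<le> ennreal (1 / (pi * real M)) * W_energy (fejer_limit a)"
    using fejer_mean_L4_error[OF periodic_borel_fejer_limit integrable_fejer_limit assms] by (simp add: fejer_mean_fejer_limit)
  also have "\<dots> \<le> ennreal (1 / (pi * real M)) * ennreal C"
    by (intro mult_left_mono W_energy_fejer_limit) auto
  finally show ?thesis using C0 by (simp add: ennreal_mult[symmetric])
qed

lemma L4_fejer_limit: "L4 (fejer_limit a) \<le> ennreal C"
proof -
  have "L4 (fejer_limit a) \<le> ennreal (C / pi)"
    using L4_fejer_limit_error[of 1] by (simp add: fejer_sum_def trig_def L4_def)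
  also have "C / pi \<le> C" using C0 pi_gt3 by (simp add: divide_le_eq mult_le_cancel_left1)
  finally show ?thesis by (simp add: ennreal_leI)
qed

end

section \<open>The nonlinear form\<close>

lemma measurable_cnj [measurable]: "cnj \<in> borel_measurable borel"
  by (intro borel_measurable_continuous_onI continuous_intros)

text \<open>Lipschitz continuity for the chordal distance, which is a multiple of the square root of
\<open>1 - cos (x - y)\<close>. One constant serves for the function and for its increments, since the nonlinear
form needs both bounds.\<close>

definition chord_lip :: "real \<Rightarrow> (real \<Rightarrow> complex) \<Rightarrow> bool" where
  "chord_lip L g \<longleftrightarrow> periodic_borel g \<and> 0 \<le> L \<and> (\<forall>x. cmod (g x) \<le> L) \<and>
     (\<forall>x y. (cmod (g x - g y))\<^sup>2 \<le> L\<^sup>2 * (1 - cos (x - y)))"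

definition nonlocal_density :: "(real \<Rightarrow> complex) \<Rightarrow> (real \<Rightarrow> complex) \<Rightarrow> real \<times> real \<Rightarrow> complex" where
  "nonlocal_density f g p = of_real ((cmod (f (fst p) - f (snd p)))\<^sup>2) * (f (fst p) - f (snd p)) * cnj (g (fst p) - g (snd p))
     / of_real (1 - cos (fst p - snd p))"

definition local_density :: "(real \<Rightarrow> complex) \<Rightarrow> (real \<Rightarrow> complex) \<Rightarrow> real \<Rightarrow> complex" where
  "local_density f g x = of_real ((cmod (f x))\<^sup>2) * f x * cnj (g x)"

text \<open>The real part of four times this form is the derivative of \<open>hamiltonian\<close> at \<open>f\<close> in the direction
\<open>g\<close>; see \<open>hamiltonian_expand\<close>.\<close>

definition nonlin_form :: "real \<Rightarrow> (real \<Rightarrow> complex) \<Rightarrow> (real \<Rightarrow> complex) \<Rightarrow> complex" where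
  "nonlin_form \<sigma> f g = 1 / (8 * of_real pi) * (LINT p|circle2. nonlocal_density f g p) - of_real \<sigma> * (LINT x|circle. local_density f g x)"

lemma measurable_nonlocal_density: "periodic_borel f \<Longrightarrow> periodic_borel g \<Longrightarrow> nonlocal_density f g \<in> borel_measurable circle2"
proof -
  assume "periodic_borel f" "periodic_borel g"
  then have [measurable]: "f \<in> borel_measurable borel" "g \<in> borel_measurable borel" by (auto intro: periodic_borel_measurable)
  show ?thesis unfolding nonlocal_density_def[abs_def] by measurable
qed

lemma measurable_local_density: "periodic_borel f \<Longrightarrow> periodic_borel g \<Longrightarrow> local_density f g \<in> borel_measurable circle"
proof -
  assume "periodic_borel f" "periodic_borel g"
  then have [measurable]: "f \<in> borel_measurable borel" "g \<in> borel_measurable borel" by (auto intro: periodic_borel_measurable)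
  show ?thesis unfolding local_density_def[abs_def] by (intro measurable_circle_borel) measurable
qed

text \<open>The regularity of \<open>g\<close> absorbs the square root of the singular weight.\<close>

lemma chord_factor:
  assumes g: "chord_lip L g" and A: "0 \<le> A"
  shows "A * cmod (g x - g y) / (1 - cos (x - y)) \<le> L * (A / sqrt (1 - cos (x - y)))"
proof (cases "cos (x - y) = 1")
  case False
  define s where "s = sqrt (1 - cos (x - y))"
  have q: "1 - cos (x - y) > 0" using False cos_le_one[of "x - y"] by linarith
  then have s: "s > 0" "1 - cos (x - y) = s * s" by (auto simp: s_def)
  have "(cmod (g x - g y))\<^sup>2 \<le> (L * s)\<^sup>2"
    using g s(2) by (metis chord_lip_def power_mult_distrib power2_eq_square)
  then have "cmod (g x - g y) \<le> L * s"
    by (rule power2_le_imp_le) (use g s in \<open>auto simp: chord_lip_def\<close>)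
  then have "A * cmod (g x - g y) / (s * s) \<le> A * (L * s) / (s * s)"
    using A s by (intro divide_right_mono mult_left_mono) auto
  then show ?thesis using s by (simp add: s_def[symmetric] mult_ac)
qed simp

lemma one_minus_cos_bounds: "0 \<le> 1 - cos t" "1 - cos t \<le> 2" for t :: real
  using cos_le_one[of t] cos_ge_minus_one[of t] by linarith+

lemma cube_young:
  fixes a q :: real
  assumes "0 \<le> a" "0 \<le> q" "q \<le> 2"
  shows "a^3 / sqrt q \<le> 1 + a^4 / q"
proof (cases "q = 0")
  case False
  define s where "s = sqrt q"
  have s: "s > 0" "q = s * s" using assms False by (auto simp: s_def)
  define c where "c = a\<^sup>2 / s"
  have "0 \<le> (a - c)\<^sup>2" "0 \<le> (c - s)\<^sup>2" by auto
  then have 1: "2 * (a * c) \<le> a\<^sup>2 + c\<^sup>2" and 2: "2 * (c * s) \<le> c\<^sup>2 + s\<^sup>2"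
    by (simp_all add: power2_eq_square algebra_simps)
  have "c * s = a\<^sup>2" "s\<^sup>2 = q" "a * c = a^3 / s" "c\<^sup>2 = a^4 / q"
    using s by (auto simp: c_def power2_eq_square power3_eq_cube power4_eq_xxxx)
  with 1 2 assms(3) have "a^3 / s \<le> 1 + a^4 / q"
    using zero_le_power2[of c] by linarith
  then show ?thesis by (simp add: s_def)
qed simp

lemma norm_nonlocal_density_le:
  assumes g: "chord_lip L g"
  shows "cmod (nonlocal_density f g p) \<le> L * (1 + energy_density f p)"
proof -
  obtain x y where p: "p = (x, y)" by force
  have L: "0 \<le> L" using g by (simp add: chord_lip_def)
  have "cmod (nonlocal_density f g p) = cmod (f x - f y) ^ 3 * cmod (g x - g y) / (1 - cos (x - y))"
    unfolding nonlocal_density_def p fst_conv snd_conv norm_mult norm_divide complex_mod_cnj norm_of_real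
    using one_minus_cos_bounds(1)[of "x - y"] by (simp add: power2_eq_square power3_eq_cube)
  also have "\<dots> \<le> L * (cmod (f x - f y) ^ 3 / sqrt (1 - cos (x - y)))"
    by (rule chord_factor[OF g]) simp
  also have "\<dots> \<le> L * (1 + energy_density f p)"
    unfolding energy_density_def p fst_conv snd_conv using one_minus_cos_bounds[of "x - y"]
    by (intro mult_left_mono cube_young L) auto
  finally show ?thesis .
qed

lemma norm_local_density_le:
  assumes g: "chord_lip L g"
  shows "cmod (local_density f g x) \<le> L * (1 + cmod (f x) ^ 4)"
proof -
  have L: "0 \<le> L" and gb: "cmod (g x) \<le> L" using g by (auto simp: chord_lip_def)
  have "cmod (local_density f g x) = cmod (f x) ^ 3 * cmod (g x)"
    by (simp add: local_density_def norm_mult power2_eq_square power3_eq_cube)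
  also have "\<dots> \<le> (1 + cmod (f x) ^ 4) * L"
    using cube_young[of "cmod (f x)" 1] gb L by (intro mult_mono) auto
  finally show ?thesis by (simp add: mult.commute)
qed

lemma cube_diff: "cmod (of_real ((cmod z)\<^sup>2) * z - of_real ((cmod w)\<^sup>2) * w) \<le> 2 * cmod (z - w) * ((cmod z)\<^sup>2 + (cmod w)\<^sup>2)"
proof -
  have eq: "of_real ((cmod z)\<^sup>2) * z - of_real ((cmod w)\<^sup>2) * w
     = of_real ((cmod z)\<^sup>2) * (z - w) + of_real ((cmod z)\<^sup>2 - (cmod w)\<^sup>2) * w"
    by (simp add: algebra_simps)
  have "cmod (of_real ((cmod z)\<^sup>2) * z - of_real ((cmod w)\<^sup>2) * w) \<le> (cmod z)\<^sup>2 * cmod (z - w) + \<bar>(cmod z)\<^sup>2 - (cmod w)\<^sup>2\<bar> * cmod w"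
    unfolding eq by (rule order_trans[OF norm_triangle_ineq]) (simp add: norm_mult flip: of_real_diff of_real_power)
  also have "\<bar>(cmod z)\<^sup>2 - (cmod w)\<^sup>2\<bar> = \<bar>cmod z - cmod w\<bar> * (cmod z + cmod w)"
    by (simp add: power2_eq_square square_diff_square_factored abs_mult mult.commute)
  also have "(cmod z)\<^sup>2 * cmod (z - w) + \<dots> * cmod w \<le> (cmod z)\<^sup>2 * cmod (z - w) + cmod (z - w) * (cmod z + cmod w) * cmod w"
    by (intro add_left_mono mult_right_mono norm_triangle_ineq3) auto
  also have "\<dots> = cmod (z - w) * ((cmod z)\<^sup>2 + cmod z * cmod w + (cmod w)\<^sup>2)"
    by (simp add: power2_eq_square algebra_simps)
  also have "\<dots> \<le> cmod (z - w) * (2 * ((cmod z)\<^sup>2 + (cmod w)\<^sup>2))"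
  proof (rule mult_left_mono)
    have "0 \<le> (cmod z - cmod w)\<^sup>2" by simp
    then have "2 * (cmod z * cmod w) \<le> (cmod z)\<^sup>2 + (cmod w)\<^sup>2" by (simp add: power2_eq_square algebra_simps)
    then show "(cmod z)\<^sup>2 + cmod z * cmod w + (cmod w)\<^sup>2 \<le> 2 * ((cmod z)\<^sup>2 + (cmod w)\<^sup>2)"
      using zero_le_power2[of "cmod z"] zero_le_power2[of "cmod w"] unfolding distrib_left by linarith
  qed simp
  finally show ?thesis by (simp only: mult_ac)
qed

text \<open>The weight goes entirely to the terms \<open>A\<^sup>4\<close> and \<open>B\<^sup>4\<close>, for which an energy bound is available, and not to
the difference \<open>k\<close>, which is only known to be small in \<open>L\<^sup>2\<close>.\<close>

lemma weighted_young:
  fixes k A B q r :: real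
  assumes "r > 0" "0 \<le> q"
  shows "2 * k * (A\<^sup>2 + B\<^sup>2) / sqrt q \<le> k\<^sup>2 / r + 2 * r * (A^4 / q + B^4 / q)"
proof (cases "q = 0")
  case True
  then show ?thesis using assms by simp
next
  case False
  define s where "s = sqrt q"
  have s: "s > 0" "q = s\<^sup>2" using assms False by (auto simp: s_def)
  define E where "E = (A\<^sup>2 + B\<^sup>2) / s"
  have "0 \<le> (k - r * E)\<^sup>2" by simp
  then have "2 * k * E * r \<le> k\<^sup>2 + r\<^sup>2 * E\<^sup>2" by (simp add: power2_eq_square algebra_simps)
  then have "2 * k * E \<le> (k\<^sup>2 + r\<^sup>2 * E\<^sup>2) / r" using assms(1) by (simp add: pos_le_divide_eq)
  also have "\<dots> = k\<^sup>2 / r + r * E\<^sup>2" using assms(1) by (simp add: add_divide_distrib power2_eq_square)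
  also have "r * E\<^sup>2 \<le> r * (2 * (A^4 / q + B^4 / q))"
  proof (rule mult_left_mono)
    have "0 \<le> (A\<^sup>2 - B\<^sup>2)\<^sup>2" by simp
    then have "(A\<^sup>2 + B\<^sup>2)\<^sup>2 \<le> 2 * (A^4 + B^4)" by (simp add: power2_eq_square power4_eq_xxxx algebra_simps)
    then have "(A\<^sup>2 + B\<^sup>2)\<^sup>2 / q \<le> 2 * (A^4 + B^4) / q" using s by (intro divide_right_mono) auto
    then show "E\<^sup>2 \<le> 2 * (A^4 / q + B^4 / q)" by (simp only: E_def power_divide s(2) add_divide_distrib[symmetric] times_divide_eq_right)
  qed (use assms in simp)
  finally show ?thesis by (simp add: E_def s_def algebra_simps)
qed

lemma nonlocal_density_diff:
  assumes g: "chord_lip L g" and r: "r > 0"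
  shows "cmod (nonlocal_density f g p - nonlocal_density h g p)
    \<le> L * ((cmod ((f (fst p) - h (fst p)) - (f (snd p) - h (snd p))))\<^sup>2 / r + 2 * r * (energy_density f p + energy_density h p))"
proof -
  obtain x y where p: "p = (x, y)" by force
  have L: "0 \<le> L" using g by (simp add: chord_lip_def)
  define z w where "z = f x - f y" and "w = h x - h y"
  have zw: "z - w = (f x - h x) - (f y - h y)" by (simp add: z_def w_def)
  have "nonlocal_density f g p - nonlocal_density h g p = (of_real ((cmod z)\<^sup>2) * z - of_real ((cmod w)\<^sup>2) * w) * cnj (g x - g y) / of_real (1 - cos (x - y))"
    by (simp add: nonlocal_density_def p z_def w_def diff_divide_distrib left_diff_distrib)
  then have "cmod (nonlocal_density f g p - nonlocal_density h g p) = cmod (of_real ((cmod z)\<^sup>2) * z - of_real ((cmod w)\<^sup>2) * w) * cmod (g x - g y) / (1 - cos (x - y))"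
    using one_minus_cos_bounds(1)[of "x - y"] by (simp only: norm_mult norm_divide complex_mod_cnj norm_of_real abs_of_nonneg)
  also have "\<dots> \<le> L * (cmod (of_real ((cmod z)\<^sup>2) * z - of_real ((cmod w)\<^sup>2) * w) / sqrt (1 - cos (x - y)))"
    by (rule chord_factor[OF g]) simp
  also have "\<dots> \<le> L * ((2 * cmod (z - w) * ((cmod z)\<^sup>2 + (cmod w)\<^sup>2)) / sqrt (1 - cos (x - y)))"
    using one_minus_cos_bounds(1)[of "x - y"] by (intro mult_left_mono divide_right_mono cube_diff L) auto
  also have "\<dots> \<le> L * ((cmod (z - w))\<^sup>2 / r + 2 * r * (energy_density f p + energy_density h p))"
    unfolding energy_density_def p fst_conv snd_conv z_def[symmetric] w_def[symmetric]
    by (intro mult_left_mono weighted_young L r one_minus_cos_bounds)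
  finally show ?thesis by (simp add: zw p)
qed

lemma local_density_diff:
  assumes g: "chord_lip L g" and r: "r > 0"
  shows "cmod (local_density f g x - local_density h g x)
    \<le> L * ((cmod (f x - h x))\<^sup>2 / r + 2 * r * (cmod (f x) ^ 4 + cmod (h x) ^ 4))"
proof -
  have L: "0 \<le> L" and gb: "cmod (g x) \<le> L" using g by (auto simp: chord_lip_def)
  have "cmod (local_density f g x - local_density h g x) = cmod (of_real ((cmod (f x))\<^sup>2) * f x - of_real ((cmod (h x))\<^sup>2) * h x) * cmod (g x)"
    by (simp add: local_density_def flip: norm_mult left_diff_distrib) (simp add: norm_mult)
  also have "\<dots> \<le> (2 * cmod (f x - h x) * ((cmod (f x))\<^sup>2 + (cmod (h x))\<^sup>2)) * L"
    by (intro mult_mono cube_diff gb) auto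
  also have "\<dots> \<le> ((cmod (f x - h x))\<^sup>2 / r + 2 * r * (cmod (f x) ^ 4 + cmod (h x) ^ 4)) * L"
    using weighted_young[OF r, of 1 "cmod (f x - h x)" "cmod (f x)" "cmod (h x)"] L
    by (intro mult_right_mono) auto
  finally show ?thesis by (simp add: mult.commute)
qed

lemma W_energy_integrable:
  assumes f: "periodic_borel f" and E: "W_energy f \<le> ennreal C" "0 \<le> C"
  shows "integrable circle2 (energy_density f)" "(LINT p|circle2. energy_density f p) \<le> C"
proof -
  have [measurable]: "energy_density f \<in> borel_measurable circle2"
    using f by (intro measurable_energy_density periodic_borel_measurable)
  show i: "integrable circle2 (energy_density f)"
    by (rule integrableI_nonneg) (use E in \<open>auto simp: W_energy_def less_top[symmetric] top_unique\<close>)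
  show "(LINT p|circle2. energy_density f p) \<le> C"
    using E nn_integral_eq_integral[OF i] by (simp add: W_energy_def)
qed

lemma measure_circle2: "measure circle2 (space circle2) = 4 * pi\<^sup>2"
proof -
  have "emeasure circle2 (space circle \<times> space circle) = emeasure circle (space circle) * emeasure circle (space circle)"
    by (rule circle.emeasure_pair_measure_Times) auto
  then have "emeasure circle2 (space circle2) = ennreal (4 * pi\<^sup>2)"
    by (simp add: space_pair_measure emeasure_circle ennreal_mult[symmetric] power2_eq_square)
  then show ?thesis by (simp add: measure_def)
qed

lemma integrable_nonlocal_density:
  assumes f: "periodic_borel f" "W_energy f \<le> ennreal C" "0 \<le> C" and g: "chord_lip L g"
  shows "integrable circle2 (nonlocal_density f g)" "cmod (LINT p|circle2. nonlocal_density f g p) \<le> L * (4 * pi\<^sup>2 + C)"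
proof -
  have L: "0 \<le> L" using g by (simp add: chord_lip_def)
  have i: "integrable circle2 (\<lambda>p. L * (1 + energy_density f p))" using W_energy_integrable[OF f] by auto
  show int: "integrable circle2 (nonlocal_density f g)"
    by (rule Bochner_Integration.integrable_bound[OF i])
       (use norm_nonlocal_density_le[OF g] g f L in \<open>auto intro!: AE_I2 measurable_nonlocal_density simp: chord_lip_def\<close>)
  have "cmod (LINT p|circle2. nonlocal_density f g p) \<le> (LINT p|circle2. L * (1 + energy_density f p))"
    using norm_nonlocal_density_le[OF g] by (intro Bochner_Integration.integral_norm_bound_integral[OF int i]) auto
  also have "\<dots> = L * (4 * pi\<^sup>2 + (LINT p|circle2. energy_density f p))"
    using W_energy_integrable[OF f] by (simp add: measure_circle2)
  also have "\<dots> \<le> L * (4 * pi\<^sup>2 + C)"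
    using W_energy_integrable[OF f] L by (intro mult_left_mono) auto
  finally show "cmod (LINT p|circle2. nonlocal_density f g p) \<le> L * (4 * pi\<^sup>2 + C)" .
qed

lemma integrable_local_density:
  assumes f: "periodic_borel f" "L4 f \<le> ennreal C" "0 \<le> C" and g: "chord_lip L g"
  shows "integrable circle (local_density f g)" "cmod (LINT x|circle. local_density f g x) \<le> L * (2 * pi + C)"
proof -
  have L: "0 \<le> L" using g by (simp add: chord_lip_def)
  have i: "integrable circle (\<lambda>x. L * (1 + cmod (f x) ^ 4))" using L4_integrable[OF f] by auto
  show int: "integrable circle (local_density f g)"
    by (rule Bochner_Integration.integrable_bound[OF i])
       (use norm_local_density_le[OF g] g f L in \<open>auto intro!: AE_I2 measurable_local_density simp: chord_lip_def\<close>)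
  have "cmod (LINT x|circle. local_density f g x) \<le> (LINT x|circle. L * (1 + cmod (f x) ^ 4))"
    using norm_local_density_le[OF g] by (intro Bochner_Integration.integral_norm_bound_integral[OF int i]) auto
  also have "\<dots> = L * (2 * pi + (LINT x|circle. cmod (f x) ^ 4))"
    using L4_integrable[OF f] by (simp add: measure_circle)
  also have "\<dots> \<le> L * (2 * pi + C)"
    using L4_integrable[OF f] L by (intro mult_left_mono) auto
  finally show "cmod (LINT x|circle. local_density f g x) \<le> L * (2 * pi + C)" .
qed

lemma norm_nonlin_form_le:
  assumes f: "periodic_borel f" "W_energy f \<le> ennreal C" "L4 f \<le> ennreal C" "0 \<le> C" and g: "chord_lip L g" and s: "\<bar>\<sigma>\<bar> \<le> 1"
  shows "cmod (nonlin_form \<sigma> f g) \<le> L * (50 + 2 * C)"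
proof -
  have L: "0 \<le> L" using g by (simp add: chord_lip_def)
  have pi: "3 < pi" "pi < 3.2" using pi_gt3 pi_less_4 pi_approx by auto
  have pp: "pi\<^sup>2 \<le> 3.2\<^sup>2" using pi by (intro power_mono) auto
  have "cmod (nonlin_form \<sigma> f g) \<le> cmod (1 / (8 * of_real pi) * (LINT p|circle2. nonlocal_density f g p)) + cmod (of_real \<sigma> * (LINT x|circle. local_density f g x))"
    unfolding nonlin_form_def by (rule norm_triangle_ineq4)
  also have "\<dots> = (1 / (8 * pi)) * cmod (LINT p|circle2. nonlocal_density f g p) + \<bar>\<sigma>\<bar> * cmod (LINT x|circle. local_density f g x)"
    by (simp add: norm_mult norm_divide)
  also have "\<dots> \<le> 1 * (L * (4 * pi\<^sup>2 + C)) + 1 * (L * (2 * pi + C))"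
    using pi s f g by (intro add_mono mult_mono integrable_nonlocal_density integrable_local_density) auto
  also have "\<dots> = L * (4 * pi\<^sup>2 + 2 * pi + 2 * C)" by (simp add: algebra_simps)
  also have "\<dots> \<le> L * (50 + 2 * C)"
    using pi pp L by (intro mult_left_mono) (auto simp: power2_eq_square)
  finally show ?thesis .
qed

lemma integral_circle2_fst_snd:
  fixes G :: "real \<Rightarrow> real"
  assumes G: "integrable circle G"
  shows "integrable circle2 (\<lambda>p. G (fst p))" "integrable circle2 (\<lambda>p. G (snd p))"
    "(LINT p|circle2. G (fst p)) = 2 * pi * (LINT x|circle. G x)"
    "(LINT p|circle2. G (snd p)) = 2 * pi * (LINT x|circle. G x)"
proof -
  have [measurable]: "G \<in> borel_measurable circle" using G by blast
  show i: "integrable circle2 (\<lambda>p. G (fst p))"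
    by (rule circle2.Fubini_integrable) (use G in auto)
  show "(LINT p|circle2. G (fst p)) = 2 * pi * (LINT x|circle. G x)"
    using circle2.integral_fst'[OF i] by (simp add: measure_circle)
  have j: "integrable circle2 (\<lambda>(x, y). G (snd (x, y)))"
    by (subst circle2.integrable_product_swap_iff[symmetric]) (use i in \<open>simp add: split_beta'\<close>)
  then show "integrable circle2 (\<lambda>p. G (snd p))" by (simp add: split_beta')
  show "(LINT p|circle2. G (snd p)) = 2 * pi * (LINT x|circle. G x)"
    using circle2.integral_snd[OF j] by (simp add: measure_circle split_beta')
qed

text \<open>Absorption: choose \<open>r\<close> so that the bounded part \<open>P\<close> contributes little, then \<open>n\<close> so that the vanishing
part \<open>K\<close> does.\<close>

lemma young_tendsto:
  fixes F :: "nat \<Rightarrow> 'a::euclidean_space \<Rightarrow> complex"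
  assumes F: "\<And>n. integrable M (F n)" "integrable M G" and K: "\<And>n. integrable M (K n)"
    and P: "\<And>n. integrable M (P n)" "\<And>n. (LINT x|M. P n x) \<le> C" and L: "0 \<le> L" and C: "0 \<le> C"
    and le: "\<And>n x r. r > 0 \<Longrightarrow> cmod (F n x - G x) \<le> L * (K n x / r + r * P n x)"
    and lim: "(\<lambda>n. LINT x|M. K n x) \<longlonglongrightarrow> 0"
  shows "(\<lambda>n. LINT x|M. F n x) \<longlonglongrightarrow> (LINT x|M. G x)"
proof (rule LIMSEQ_I)
  fix e :: real assume e: "e > 0"
  define D where "D = L * C + 1"
  define r where "r = e / (2 * D)"
  have LC: "D > 0" using L C by (simp add: D_def add_nonneg_pos)
  have r: "r > 0" using e LC by (simp add: r_def)
  have "(\<lambda>n. L * ((LINT x|M. K n x) / r)) \<longlonglongrightarrow> L * (0 / r)" using r by (intro tendsto_intros lim) auto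
  then have "eventually (\<lambda>n. L * ((LINT x|M. K n x) / r) < e / 2) sequentially"
    using e by (intro order_tendstoD(2)[of _ "L * (0 / r)"]) auto
  then obtain N where N: "\<And>n. n \<ge> N \<Longrightarrow> L * ((LINT x|M. K n x) / r) < e / 2" by (auto simp: eventually_sequentially)
  have "norm ((LINT x|M. F n x) - (LINT x|M. G x)) < e" if "n \<ge> N" for n
  proof -
    have "(LINT x|M. F n x) - (LINT x|M. G x) = (LINT x|M. F n x - G x)" using F by simp
    also have "cmod \<dots> \<le> (LINT x|M. L * (K n x / r + r * P n x))"
      by (rule Bochner_Integration.integral_norm_bound_integral) (use F K P le[OF r] in auto)
    also have "\<dots> = L * ((LINT x|M. K n x) / r) + L * r * (LINT x|M. P n x)"
      using K P by (simp add: algebra_simps)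
    also have "L * r * (LINT x|M. P n x) \<le> L * r * C" using L r P by (intro mult_left_mono) auto
    also have "L * r * C \<le> e / 2"
    proof -
      have "r * (L * C) \<le> r * D" using r by (simp add: D_def)
      also have "\<dots> = e / 2" using LC by (simp add: r_def)
      finally show ?thesis by (simp add: mult_ac)
    qed
    finally show ?thesis using N[OF that] by linarith
  qed
  then show "\<exists>no. \<forall>n\<ge>no. norm ((LINT x|M. F n x) - (LINT x|M. G x)) < e" by blast
qed

lemma L4_tendsto_L2:
  assumes f: "\<And>n. periodic_borel (f n)" and g: "periodic_borel g"
    and lim: "\<And>n. L4 (\<lambda>x. f n x - g x) \<le> ennreal (B n)" "\<And>n. 0 \<le> B n" "B \<longlonglongrightarrow> 0"
  shows "(\<lambda>n. LINT x|circle. (cmod (f n x - g x))\<^sup>2) \<longlonglongrightarrow> 0"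
proof (rule LIMSEQ_I)
  have d: "periodic_borel (\<lambda>x. f n x - g x)" for n by (intro periodic_borel_diff f g)
  fix e :: real assume "e > 0"
  define r where "r = e / (8 * pi)"
  have r: "r > 0" using \<open>e > 0\<close> by (simp add: r_def)
  have "(\<lambda>n. B n / r) \<longlonglongrightarrow> 0 / r" by (intro tendsto_intros lim) (use r in auto)
  then have "eventually (\<lambda>n. B n / r < e / 2) sequentially"
    using \<open>e > 0\<close> by (intro order_tendstoD(2)[of _ "0 / r"]) auto
  then obtain N where N: "\<And>n. n \<ge> N \<Longrightarrow> B n / r < e / 2" by (auto simp: eventually_sequentially)
  have "norm ((LINT x|circle. (cmod (f n x - g x))\<^sup>2) - 0) < e" if "n \<ge> N" for n
  proof -
    have "(LINT x|circle. (cmod (f n x - g x))\<^sup>2) \<le> 2 * pi * r + B n / r"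
      by (rule L4_imp_L2(2)[OF d lim(1,2) r])
    also have "\<dots> < e" using N[OF that] by (simp add: r_def) (use \<open>e > 0\<close> in linarith)
    finally show ?thesis by simp
  qed
  then show "\<exists>no. \<forall>n\<ge>no. norm ((LINT x|circle. (cmod (f n x - g x))\<^sup>2) - 0) < e" by blast
qed

text \<open>The nonlinearity is continuous on energy-bounded sets for strong convergence, although its weight is
not integrable: \<open>nonlocal_density_diff\<close> and \<open>local_density_diff\<close> bound the differences of the densities in the form
required by \<open>young_tendsto\<close>.\<close>

lemma nonlin_form_tendsto:
  assumes f: "\<And>n. periodic_borel (f n)" "\<And>n. W_energy (f n) \<le> ennreal C" "\<And>n. L4 (f n) \<le> ennreal C"
    and h: "periodic_borel h" "W_energy h \<le> ennreal C" "L4 h \<le> ennreal C" and C: "0 \<le> C"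
    and lim: "\<And>n. L4 (\<lambda>x. f n x - h x) \<le> ennreal (B n)" "\<And>n. 0 \<le> B n" "B \<longlonglongrightarrow> 0"
    and g: "chord_lip L g"
  shows "(\<lambda>n. nonlin_form \<sigma> (f n) g) \<longlonglongrightarrow> nonlin_form \<sigma> h g"
proof -
  have L: "0 \<le> L" using g by (simp add: chord_lip_def)
  have d: "periodic_borel (\<lambda>x. f n x - h x)" for n by (intro periodic_borel_diff f h)
  have l2: "(\<lambda>n. LINT x|circle. (cmod (f n x - h x))\<^sup>2) \<longlonglongrightarrow> 0"
    by (rule L4_tendsto_L2[OF f(1) h(1) lim])
  have i2: "integrable circle (\<lambda>x. (cmod (f n x - h x))\<^sup>2)" for n
    by (rule L4_imp_L2(1)[OF d lim(1,2)])
  define K where "K n p = 2 * ((cmod (f n (fst p) - h (fst p)))\<^sup>2 + (cmod (f n (snd p) - h (snd p)))\<^sup>2)" for n and p :: "real \<times> real"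
  have Ki: "integrable circle2 (K n)" for n
    unfolding K_def by (intro integrable_mult_right Bochner_Integration.integrable_add integral_circle2_fst_snd[OF i2])
  have Kl: "(LINT p|circle2. K n p) = 8 * pi * (LINT x|circle. (cmod (f n x - h x))\<^sup>2)" for n
    unfolding K_def using integral_circle2_fst_snd[OF i2[of n]] by simp
  have gi: "integrable circle2 (\<lambda>p. 2 * (energy_density (f n) p + energy_density h p))" for n
    using W_energy_integrable[OF f(1,2) C] W_energy_integrable[OF h(1,2) C] by auto
  have "(\<lambda>n. LINT p|circle2. nonlocal_density (f n) g p) \<longlonglongrightarrow> (LINT p|circle2. nonlocal_density h g p)"
  proof (rule young_tendsto[OF integrable_nonlocal_density(1)[OF f(1,2) C g] integrable_nonlocal_density(1)[OF h(1,2) C g] Ki gi _ L])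
    show "(LINT p|circle2. 2 * (energy_density (f n) p + energy_density h p)) \<le> 4 * C" for n
      using W_energy_integrable[OF f(1,2) C, of n] W_energy_integrable[OF h(1,2) C] by simp
    show "(\<lambda>n. LINT p|circle2. K n p) \<longlonglongrightarrow> 0"
      unfolding Kl using tendsto_mult[OF tendsto_const l2, of "8 * pi"] by simp
    fix n p and r :: real assume r: "r > 0"
    have "(cmod (z - w))\<^sup>2 \<le> 2 * ((cmod z)\<^sup>2 + (cmod w)\<^sup>2)" for z w
    proof -
      have "(cmod (z - w))\<^sup>2 \<le> (cmod z + cmod w)\<^sup>2" by (intro power_mono norm_triangle_ineq4) auto
      moreover have "0 \<le> (cmod z - cmod w)\<^sup>2" by simp
      ultimately show ?thesis by (simp add: power2_eq_square algebra_simps)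
    qed
    then have "(cmod ((f n (fst p) - h (fst p)) - (f n (snd p) - h (snd p))))\<^sup>2 / r \<le> K n p / r"
      using r unfolding K_def by (intro divide_right_mono) auto
    then have "L * ((cmod ((f n (fst p) - h (fst p)) - (f n (snd p) - h (snd p))))\<^sup>2 / r + 2 * r * (energy_density (f n) p + energy_density h p))
       \<le> L * (K n p / r + r * (2 * (energy_density (f n) p + energy_density h p)))"
      using L by (intro mult_left_mono add_mono) (auto simp: algebra_simps)
    then show "cmod (nonlocal_density (f n) g p - nonlocal_density h g p) \<le> L * (K n p / r + r * (2 * (energy_density (f n) p + energy_density h p)))"
      using nonlocal_density_diff[OF g r, of "f n" p h] by linarith
  qed (use C in auto)
  moreover have qi: "integrable circle (\<lambda>x. 2 * (cmod (f n x) ^ 4 + cmod (h x) ^ 4))" for n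
    using L4_integrable[OF f(1,3) C] L4_integrable[OF h(1,3) C] by auto
  have "(\<lambda>n. LINT x|circle. local_density (f n) g x) \<longlonglongrightarrow> (LINT x|circle. local_density h g x)"
  proof (rule young_tendsto[OF integrable_local_density(1)[OF f(1,3) C g] integrable_local_density(1)[OF h(1,3) C g] i2 qi _ L _ _ l2])
    show "(LINT x|circle. 2 * (cmod (f n x) ^ 4 + cmod (h x) ^ 4)) \<le> 4 * C" for n
      using L4_integrable[OF f(1,3) C, of n] L4_integrable[OF h(1,3) C] by simp
    show "cmod (local_density (f n) g x - local_density h g x) \<le> L * ((cmod (f n x - h x))\<^sup>2 / r + r * (2 * (cmod (f n x) ^ 4 + cmod (h x) ^ 4)))"
      if "r > 0" for n x r
      using local_density_diff[OF g that, of "f n" x h] by (simp add: mult_ac)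
  qed (use C in auto)
  ultimately show ?thesis unfolding nonlin_form_def by (intro tendsto_intros)
qed

lemma nonlin_form_tendsto_right:
  assumes f: "periodic_borel f" "W_energy f \<le> ennreal C" "L4 f \<le> ennreal C" "0 \<le> C"
    and g: "\<And>n. chord_lip L (g n)" "chord_lip L h" and lim: "\<And>x. (\<lambda>n. g n x) \<longlonglongrightarrow> h x"
  shows "(\<lambda>n. nonlin_form \<sigma> f (g n)) \<longlonglongrightarrow> nonlin_form \<sigma> f h"
proof -
  have pg: "periodic_borel (g n)" "periodic_borel h" for n using g by (auto simp: chord_lip_def)
  have "(\<lambda>n. LINT p|circle2. nonlocal_density f (g n) p) \<longlonglongrightarrow> (LINT p|circle2. nonlocal_density f h p)"
  proof (rule integral_dominated_convergence)
    show "integrable circle2 (\<lambda>p. L * (1 + energy_density f p))" using W_energy_integrable[OF f(1,2,4)] by auto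
    show "AE p in circle2. (\<lambda>n. nonlocal_density f (g n) p) \<longlonglongrightarrow> nonlocal_density f h p"
      unfolding nonlocal_density_def divide_inverse by (intro AE_I2 tendsto_intros lim)
    show "AE p in circle2. cmod (nonlocal_density f (g n) p) \<le> L * (1 + energy_density f p)" for n
      by (intro AE_I2 norm_nonlocal_density_le g)
  qed (auto intro!: measurable_nonlocal_density f pg)
  moreover have "(\<lambda>n. LINT x|circle. local_density f (g n) x) \<longlonglongrightarrow> (LINT x|circle. local_density f h x)"
  proof (rule integral_dominated_convergence)
    show "integrable circle (\<lambda>x. L * (1 + cmod (f x) ^ 4))" using L4_integrable[OF f(1,3,4)] by auto
    show "AE x in circle. (\<lambda>n. local_density f (g n) x) \<longlonglongrightarrow> local_density f h x"
      unfolding local_density_def by (intro AE_I2 tendsto_intros lim)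
    show "AE x in circle. cmod (local_density f (g n) x) \<le> L * (1 + cmod (f x) ^ 4)" for n
      by (intro AE_I2 norm_local_density_le g)
  qed (auto intro!: measurable_local_density f pg)
  ultimately show ?thesis unfolding nonlin_form_def by (intro tendsto_intros)
qed

section \<open>Lipschitz functions for the chordal distance\<close>

lemma lipgI:
  assumes "periodic_borel g" "0 \<le> L" "\<And>x. cmod (g x) \<le> L" "\<And>x y. cmod (g x - g y) \<le> L * sqrt (1 - cos (x - y))"
  shows "chord_lip L g"
proof -
  have "(cmod (g x - g y))\<^sup>2 \<le> L\<^sup>2 * (1 - cos (x - y))" for x y
  proof -
    have "(cmod (g x - g y))\<^sup>2 \<le> (L * sqrt (1 - cos (x - y)))\<^sup>2"
      by (rule power_mono) (use assms in auto)
    then show ?thesis using one_minus_cos_bounds[of "x - y"] by (simp add: power_mult_distrib)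
  qed
  with assms show ?thesis by (simp add: chord_lip_def)
qed

lemma lipgD:
  assumes "chord_lip L g"
  shows "periodic_borel g" "0 \<le> L" "cmod (g x) \<le> L" "cmod (g x - g y) \<le> L * sqrt (1 - cos (x - y))"
proof -
  show 1: "periodic_borel g" "0 \<le> L" "cmod (g x) \<le> L" using assms by (auto simp: chord_lip_def)
  have "(cmod (g x - g y))\<^sup>2 \<le> (L * sqrt (1 - cos (x - y)))\<^sup>2"
    using assms one_minus_cos_bounds[of "x - y"] by (simp add: chord_lip_def power_mult_distrib)
  then show "cmod (g x - g y) \<le> L * sqrt (1 - cos (x - y))"
    by (rule power2_le_imp_le) (use 1 one_minus_cos_bounds[of "x - y"] in auto)
qed

lemma chord_lip_mono: "chord_lip L g \<Longrightarrow> L \<le> L' \<Longrightarrow> chord_lip L' g"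
proof -
  assume g: "chord_lip L g" and le: "L \<le> L'"
  have "cmod (g x - g y) \<le> L' * sqrt (1 - cos (x - y))" for x y
    by (rule order_trans[OF lipgD(4)[OF g] mult_right_mono[OF le]]) (use one_minus_cos_bounds[of "x - y"] in auto)
  moreover have "cmod (g x) \<le> L'" for x using lipgD(3)[OF g, of x] le by simp
  ultimately show ?thesis using lipgD(1,2)[OF g] le by (intro lipgI) auto
qed

lemma chord_lip_add:
  assumes f: "chord_lip L f" and g: "chord_lip L' g"
  shows "chord_lip (L + L') (\<lambda>x. f x + g x)"
proof (rule lipgI)
  fix x y
  have "cmod ((f x + g x) - (f y + g y)) = cmod ((f x - f y) + (g x - g y))" by (simp add: algebra_simps)
  also have "\<dots> \<le> cmod (f x - f y) + cmod (g x - g y)" by (rule norm_triangle_ineq)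
  also have "\<dots> \<le> (L + L') * sqrt (1 - cos (x - y))"
    using lipgD(4)[OF f, of x y] lipgD(4)[OF g, of x y] by (simp add: distrib_right)
  finally show "cmod ((f x + g x) - (f y + g y)) \<le> (L + L') * sqrt (1 - cos (x - y))" .
  show "cmod (f x + g x) \<le> L + L'"
    using norm_triangle_ineq[of "f x" "g x"] lipgD(3)[OF f, of x] lipgD(3)[OF g, of x] by linarith
qed (use lipgD(1,2)[OF f] lipgD(1,2)[OF g] in \<open>auto intro: periodic_borel_add\<close>)

lemma chord_lip_cmult: "chord_lip L f \<Longrightarrow> chord_lip (cmod c * L) (\<lambda>x. c * f x)"
proof (rule lipgI)
  assume f: "chord_lip L f"
  show "periodic_borel (\<lambda>x. c * f x)" using lipgD(1)[OF f] by (auto intro!: periodic_borel_mult)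
  show "0 \<le> cmod c * L" using lipgD(2)[OF f] by simp
  show "cmod (c * f x) \<le> cmod c * L" for x
    unfolding norm_mult by (intro mult_left_mono lipgD(3)[OF f]) auto
  show "cmod (c * f x - c * f y) \<le> cmod c * L * sqrt (1 - cos (x - y))" for x y
    unfolding right_diff_distrib[symmetric] norm_mult mult.assoc by (intro mult_left_mono lipgD(4)[OF f]) auto
qed

lemma chord_lip_cis: "chord_lip (2 * (\<bar>of_int k\<bar> + 1)) (\<lambda>x. cis (of_int k * x))"
proof (rule lipgI)
  fix x y
  have "cmod (cis x - cis y) = sqrt (2 * (1 - cos (x - y)))"
    using norm_cis_diff[of x y] by (metis norm_ge_zero real_sqrt_abs abs_of_nonneg)
  also have "\<dots> = sqrt 2 * sqrt (1 - cos (x - y))" by (rule real_sqrt_mult)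
  also have "\<dots> \<le> 2 * sqrt (1 - cos (x - y))"
    using one_minus_cos_bounds[of "x - y"] sqrt2_less_2 by (intro mult_right_mono) auto
  finally have "\<bar>of_int k\<bar> * cmod (cis x - cis y) \<le> \<bar>of_int k\<bar> * (2 * sqrt (1 - cos (x - y)))"
    by (rule mult_left_mono) simp
  also have "\<dots> \<le> (\<bar>of_int k\<bar> + 1) * (2 * sqrt (1 - cos (x - y)))"
    using one_minus_cos_bounds[of "x - y"] by (intro mult_right_mono) auto
  also have "\<dots> = 2 * (\<bar>of_int k\<bar> + 1) * sqrt (1 - cos (x - y))" by simp
  finally have "\<bar>real_of_int k\<bar> * cmod (cis x - cis y) \<le> 2 * (\<bar>of_int k\<bar> + 1) * sqrt (1 - cos (x - y))" .
  then show "cmod (cis (of_int k * x) - cis (of_int k * y)) \<le> 2 * (\<bar>of_int k\<bar> + 1) * sqrt (1 - cos (x - y))"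
    using norm_cis_int_diff[of k x y] by linarith
qed auto

definition trig_lip :: "int set \<Rightarrow> (int \<Rightarrow> complex) \<Rightarrow> real" where
  "trig_lip A a = (\<Sum>k\<in>A. cmod (a k) * (2 * (\<bar>of_int k\<bar> + 1)))"

lemma chord_lip_zero: "chord_lip 0 (\<lambda>x. 0)" by (intro lipgI) auto

lemma chord_lip_trig: "finite A \<Longrightarrow> chord_lip (trig_lip A a) (trig A a)"
  unfolding trig_lip_def trig_def
proof (induction A rule: finite_induct)
  case empty
  then show ?case by (simp add: chord_lip_zero)
next
  case (insert k A)
  then show ?case
    using chord_lip_add[OF chord_lip_cmult[OF chord_lip_cis[of k], of "a k"] insert.IH] by simp
qed

text \<open>For such functions the integrand of the energy is bounded.\<close>

lemma chord_lip_W_energy: "chord_lip L g \<Longrightarrow> W_energy g \<le> ennreal (128 * L^4)"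
proof -
  assume g: "chord_lip L g"
  have L: "0 \<le> L" using lipgD(2)[OF g] .
  have pt: "energy_density g p \<le> 2 * L^4" for p
  proof -
    define q where "q = 1 - cos (fst p - snd p)"
    have q: "0 \<le> q" "q \<le> 2" unfolding q_def by (rule one_minus_cos_bounds)+
    have "((cmod (g (fst p) - g (snd p)))\<^sup>2)\<^sup>2 \<le> (L\<^sup>2 * q)\<^sup>2"
      using g by (intro power_mono) (auto simp: chord_lip_def q_def)
    then have "cmod (g (fst p) - g (snd p)) ^ 4 \<le> L^4 * q\<^sup>2"
      by (simp add: power_mult_distrib power2_eq_square power4_eq_xxxx mult_ac)
    then have "energy_density g p \<le> L^4 * q\<^sup>2 / q" unfolding energy_density_def q_def[symmetric] using q by (intro divide_right_mono) auto
    also have "\<dots> \<le> L^4 * q" using q by (simp add: power2_eq_square)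
    also have "\<dots> \<le> L^4 * 2" using q L by (intro mult_left_mono) auto
    finally show ?thesis by simp
  qed
  have "W_energy g \<le> (\<integral>\<^sup>+p. ennreal (2 * L^4) \<partial>circle2)"
    unfolding W_energy_def by (intro nn_integral_mono ennreal_leI pt)
  also have "\<dots> = ennreal (2 * L^4) * ennreal (4 * pi\<^sup>2)"
    using measure_circle2 by (simp add: circle2.emeasure_eq_measure)
  also have "\<dots> = ennreal (8 * pi\<^sup>2 * L^4)" using L by (simp add: ennreal_mult[symmetric] mult_ac)
  also have "\<dots> \<le> ennreal (128 * L^4)"
  proof -
    have "pi\<^sup>2 \<le> 4\<^sup>2" using pi_less_4 pi_gt_zero by (intro power_mono) auto
    then show ?thesis by (intro ennreal_leI mult_right_mono) (auto simp: L)
  qed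
  finally show ?thesis .
qed

lemma L4_bounded:
  assumes "\<And>x. cmod (g x) \<le> B"
  shows "L4 g \<le> ennreal (8 * B^4)"
proof -
  have B: "0 \<le> B" using assms[of 0] norm_ge_zero order_trans by blast
  have "L4 g \<le> (\<integral>\<^sup>+p. ennreal (B^4) \<partial>circle)"
    unfolding L4_def by (intro nn_integral_mono ennreal_leI power_mono assms) auto
  also have "\<dots> = ennreal (2 * pi * B^4)" using B
    by (simp add: emeasure_circle ennreal_mult[symmetric] mult_ac)
  also have "\<dots> \<le> ennreal (8 * B^4)" using pi_less_4 B by (intro ennreal_leI mult_right_mono) auto
  finally show ?thesis .
qed

lemma chord_lip_L4: "chord_lip L g \<Longrightarrow> L4 g \<le> ennreal (128 * L^4)"
proof -
  assume g: "chord_lip L g"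
  have "L4 g \<le> ennreal (8 * L^4)" by (rule L4_bounded) (rule lipgD(3)[OF g])
  also have "\<dots> \<le> ennreal (128 * L^4)" by (intro ennreal_leI mult_right_mono) auto
  finally show ?thesis .
qed

text \<open>The form is conjugate linear in its second argument.\<close>

lemma nonlin_form_trig:
  assumes f: "periodic_borel f" "W_energy f \<le> ennreal C" "L4 f \<le> ennreal C" "0 \<le> C" and A: "finite A"
  shows "nonlin_form \<sigma> f (trig A b) = (\<Sum>k\<in>A. cnj (b k) * nonlin_form \<sigma> f (\<lambda>x. cis (of_int k * x)))"
proof -
  have B: "nonlocal_density f (trig A b) = (\<lambda>p. \<Sum>k\<in>A. cnj (b k) * nonlocal_density f (\<lambda>x. cis (of_int k * x)) p)"
    apply (rule ext)
    unfolding nonlocal_density_def trig_def sum_subtractf[symmetric] cnj_sum sum_distrib_left sum_divide_distrib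
    by (intro sum.cong) (auto simp: algebra_simps diff_divide_distrib)
  have Q: "local_density f (trig A b) = (\<lambda>x. \<Sum>k\<in>A. cnj (b k) * local_density f (\<lambda>x. cis (of_int k * x)) x)"
    apply (rule ext)
    unfolding local_density_def trig_def cnj_sum sum_distrib_left
    by (intro sum.cong) (auto simp: algebra_simps)
  have iB: "(LINT p|circle2. nonlocal_density f (trig A b) p) = (\<Sum>k\<in>A. cnj (b k) * (LINT p|circle2. nonlocal_density f (\<lambda>x. cis (of_int k * x)) p))"
    unfolding B using integrable_nonlocal_density(1)[OF f(1,2,4) chord_lip_cis] by (simp add: Bochner_Integration.integral_sum)
  have iQ: "(LINT x|circle. local_density f (trig A b) x) = (\<Sum>k\<in>A. cnj (b k) * (LINT x|circle. local_density f (\<lambda>x. cis (of_int k * x)) x))"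
    unfolding Q using integrable_local_density(1)[OF f(1,3,4) chord_lip_cis] by (simp add: Bochner_Integration.integral_sum)
  show ?thesis unfolding nonlin_form_def iB iQ sum_distrib_left sum_subtractf[symmetric]
    by (intro sum.cong) (auto simp: algebra_simps)
qed

section \<open>The Hamiltonian and its invariances\<close>

definition hamiltonian :: "real \<Rightarrow> (real \<Rightarrow> complex) \<Rightarrow> real" where
  "hamiltonian \<sigma> f = 1 / (8 * pi) * (LINT p|circle2. energy_density f p) - \<sigma> * (LINT x|circle. cmod (f x) ^ 4)"

text \<open>With \<open>|z + h w|\<^sup>2 = |z|\<^sup>2 + 2 h s + h\<^sup>2 |w|\<^sup>2\<close> and \<open>s = Re (z w\<^sup>*)\<close>, squaring leaves only terms with a factor
\<open>h\<^sup>2\<close> after the linear one is removed.\<close>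

lemma power4_expand:
  fixes z w :: complex and h :: real
  assumes "0 \<le> h" "h \<le> 1"
  shows "\<bar>cmod (z + of_real h * w) ^ 4 - cmod z ^ 4 - 4 * h * Re (of_real ((cmod z)\<^sup>2) * z * cnj w)\<bar>
    \<le> 11 * h\<^sup>2 * (cmod z ^ 4 + cmod w ^ 4)"
proof -
  define A B s where "A = (cmod z)\<^sup>2" and "B = (cmod w)\<^sup>2" and "s = Re (z * cnj w)"
  have AB: "A \<ge> 0" "B \<ge> 0" by (auto simp: A_def B_def)
  have e: "(cmod (z + of_real h * w))\<^sup>2 = A + 2 * h * s + h\<^sup>2 * B"
    unfolding A_def B_def s_def cmod_power2 by (simp add: power2_eq_square algebra_simps)
  have "\<bar>s\<bar> \<le> cmod (z * cnj w)" unfolding s_def by (rule abs_Re_le_cmod)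
  then have "s\<^sup>2 \<le> (cmod (z * cnj w))\<^sup>2" by (metis abs_le_square_iff abs_norm_cancel)
  then have s2: "s\<^sup>2 \<le> A * B" by (simp add: A_def B_def norm_mult power_mult_distrib)
  have "s\<^sup>2 \<le> ((A + B)/2)\<^sup>2"
    using s2 zero_le_power2[of "A - B"] by (simp add: power2_eq_square field_simps)
  then have s1: "\<bar>s\<bar> \<le> (A + B)/2" using AB by (metis abs_le_square_iff abs_of_nonneg add_nonneg_nonneg zero_le_divide_iff zero_le_numeral)
  have Re: "Re (of_real ((cmod z)\<^sup>2) * z * cnj w) = A * s" by (simp add: A_def s_def algebra_simps)
  have p4: "x^4 = (x\<^sup>2)\<^sup>2" for x :: real by simp
  have "cmod (z + of_real h * w) ^ 4 - cmod z ^ 4 - 4 * h * Re (of_real ((cmod z)\<^sup>2) * z * cnj w)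
     = (A + 2 * h * s + h\<^sup>2 * B)\<^sup>2 - A\<^sup>2 - 4 * h * (A * s)"
    unfolding Re p4 e by (simp add: A_def)
  also have "\<dots> = h\<^sup>2 * (4 * s\<^sup>2 + h\<^sup>2 * B\<^sup>2 + 2 * (A * B) + 4 * h * (s * B))"
    by (simp add: power2_eq_square algebra_simps)
  finally have eq: "cmod (z + of_real h * w) ^ 4 - cmod z ^ 4 - 4 * h * Re (of_real ((cmod z)\<^sup>2) * z * cnj w)
     = h\<^sup>2 * (4 * s\<^sup>2 + h\<^sup>2 * B\<^sup>2 + 2 * (A * B) + 4 * h * (s * B))" .
  have "\<bar>4 * s\<^sup>2 + h\<^sup>2 * B\<^sup>2 + 2 * (A * B) + 4 * h * (s * B)\<bar> \<le> 11 * (A\<^sup>2 + B\<^sup>2)"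
  proof -
    have 1: "\<bar>s * B\<bar> \<le> (A + B)/2 * B" unfolding abs_mult using s1 AB by (intro mult_mono) auto
    have "\<bar>h * (s * B)\<bar> \<le> 1 * ((A + B)/2 * B)" unfolding abs_mult[of h] using 1 assms by (intro mult_mono) auto
    moreover have "h\<^sup>2 * B\<^sup>2 \<le> 1 * B\<^sup>2" using assms by (intro mult_right_mono) (auto simp: power_le_one)
    moreover have "0 \<le> h\<^sup>2 * B\<^sup>2" "0 \<le> s\<^sup>2" "0 \<le> A * B" using AB by auto
    moreover have "2 * (A * B) \<le> A\<^sup>2 + B\<^sup>2" using zero_le_power2[of "A - B"] by (simp add: power2_eq_square algebra_simps)
    moreover have "(A + B)/2 * B = A * B / 2 + B\<^sup>2 / 2" by (simp add: power2_eq_square field_simps)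
    moreover have "0 \<le> A\<^sup>2" "0 \<le> B\<^sup>2" by auto
    ultimately show ?thesis using s2 unfolding distrib_left by linarith
  qed
  then have "h\<^sup>2 * \<bar>4 * s\<^sup>2 + h\<^sup>2 * B\<^sup>2 + 2 * (A * B) + 4 * h * (s * B)\<bar> \<le> h\<^sup>2 * (11 * (A\<^sup>2 + B\<^sup>2))"
    by (rule mult_left_mono) simp
  then have "\<bar>h\<^sup>2 * (4 * s\<^sup>2 + h\<^sup>2 * B\<^sup>2 + 2 * (A * B) + 4 * h * (s * B))\<bar> \<le> 11 * h\<^sup>2 * (A\<^sup>2 + B\<^sup>2)"
    by (simp only: abs_mult abs_power2 mult.left_commute[of "h\<^sup>2" 11] mult.assoc)
  moreover have "A\<^sup>2 = cmod z ^ 4" "B\<^sup>2 = cmod w ^ 4" by (simp_all add: A_def B_def)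
  ultimately show ?thesis unfolding eq by (simp only:)
qed

lemma chord_lip_integrals:
  assumes "chord_lip L f"
  shows "integrable circle2 (energy_density f)" "(LINT p|circle2. energy_density f p) \<le> 128 * L^4"
    "integrable circle (\<lambda>x. cmod (f x) ^ 4)" "(LINT x|circle. cmod (f x) ^ 4) \<le> 128 * L^4"
  using W_energy_integrable[OF lipgD(1)[OF assms] chord_lip_W_energy[OF assms]] L4_integrable[OF lipgD(1)[OF assms] chord_lip_L4[OF assms]]
  by auto

text \<open>Both \<open>z \<mapsto> |z|\<^sup>4\<close> integrals are expanded pointwise. A quadratic remainder suffices twice: it
identifies the derivative in \<open>momentum_identity\<close>, and it bounds the error of an Euler step.\<close>

lemma hamiltonian_expand:
  assumes f: "chord_lip L f" and g: "chord_lip L' g" and h: "0 \<le> h" "h \<le> 1" and s: "\<bar>\<sigma>\<bar> \<le> 1"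
  shows "\<bar>hamiltonian \<sigma> (\<lambda>x. f x + of_real h * g x) - hamiltonian \<sigma> f - 4 * h * Re (nonlin_form \<sigma> f g)\<bar>
    \<le> 2816 * h\<^sup>2 * (L^4 + L'^4)"
proof -
  define F where "F x = f x + of_real h * g x" for x
  have F: "chord_lip (L + cmod (of_real h) * L') F" unfolding F_def by (intro chord_lip_add f chord_lip_cmult g)
  have nn: "0 \<le> 128 * L^4" for L :: real by simp
  note EI = chord_lip_integrals(1,2) and half_line = chord_lip_integrals(3,4)
  note B = integrable_nonlocal_density(1)[OF lipgD(1)[OF f] chord_lip_W_energy[OF f] nn g]
  note Q = integrable_local_density(1)[OF lipgD(1)[OF f] chord_lip_L4[OF f] nn g]
  have B': "integrable circle2 (\<lambda>p. Re (nonlocal_density f g p))" and Q': "integrable circle (\<lambda>x. Re (local_density f g x))"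
    using B Q by auto
  have b1: "\<bar>(LINT p|circle2. energy_density F p) - (LINT p|circle2. energy_density f p) - 4 * h * (LINT p|circle2. Re (nonlocal_density f g p))\<bar>
     \<le> 11 * h\<^sup>2 * (128 * L^4 + 128 * L'^4)"
  proof -
    have "(LINT p|circle2. energy_density F p) - (LINT p|circle2. energy_density f p) - 4 * h * (LINT p|circle2. Re (nonlocal_density f g p))
      = (LINT p|circle2. energy_density F p - energy_density f p - 4 * h * Re (nonlocal_density f g p))"
      using EI[OF F] EI[OF f] B' by simp
    also have "norm \<dots> \<le> (LINT p|circle2. 11 * h\<^sup>2 * (energy_density f p + energy_density g p))"
    proof (rule Bochner_Integration.integral_norm_bound_integral)
      show "integrable circle2 (\<lambda>p. energy_density F p - energy_density f p - 4 * h * Re (nonlocal_density f g p))"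
        using EI[OF F] EI[OF f] B' by simp
      show "integrable circle2 (\<lambda>p. 11 * h\<^sup>2 * (energy_density f p + energy_density g p))"
        using EI[OF f] EI[OF g] by simp
      fix p
      define z w q where "z = f (fst p) - f (snd p)" and "w = g (fst p) - g (snd p)" and "q = 1 - cos (fst p - snd p)"
      have q: "0 \<le> q" unfolding q_def by (rule one_minus_cos_bounds)
      have Fd: "F (fst p) - F (snd p) = z + of_real h * w" by (simp add: F_def z_def w_def algebra_simps)
      have Re: "Re (nonlocal_density f g p) = Re (of_real ((cmod z)\<^sup>2) * z * cnj w) / q"
        unfolding nonlocal_density_def z_def[symmetric] w_def[symmetric] q_def[symmetric] by (rule Re_divide_of_real)
      have "energy_density F p - energy_density f p - 4 * h * Re (nonlocal_density f g p) = (cmod (z + of_real h * w) ^ 4 - cmod z ^ 4 - 4 * h * Re (of_real ((cmod z)\<^sup>2) * z * cnj w)) / q"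
        unfolding Re energy_density_def Fd z_def[symmetric] q_def[symmetric] by (simp add: diff_divide_distrib)
      also have "norm \<dots> \<le> 11 * h\<^sup>2 * (cmod z ^ 4 + cmod w ^ 4) / q"
        unfolding real_norm_def abs_divide abs_of_nonneg[OF q] by (intro divide_right_mono power4_expand h q)
      also have "\<dots> = 11 * h\<^sup>2 * (energy_density f p + energy_density g p)"
        unfolding energy_density_def z_def w_def q_def by (metis add_divide_distrib times_divide_eq_right)
      finally show "norm (energy_density F p - energy_density f p - 4 * h * Re (nonlocal_density f g p)) \<le> 11 * h\<^sup>2 * (energy_density f p + energy_density g p)" .
    qed
    also have "\<dots> = 11 * h\<^sup>2 * ((LINT p|circle2. energy_density f p) + (LINT p|circle2. energy_density g p))"
      using EI[OF f] EI[OF g] by simp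
    also have "\<dots> \<le> 11 * h\<^sup>2 * (128 * L^4 + 128 * L'^4)"
      by (intro mult_left_mono add_mono EI f g) auto
    finally show ?thesis by simp
  qed
  have b2: "\<bar>(LINT x|circle. cmod (F x) ^ 4) - (LINT x|circle. cmod (f x) ^ 4) - 4 * h * (LINT x|circle. Re (local_density f g x))\<bar>
     \<le> 11 * h\<^sup>2 * (128 * L^4 + 128 * L'^4)"
  proof -
    have "(LINT x|circle. cmod (F x) ^ 4) - (LINT x|circle. cmod (f x) ^ 4) - 4 * h * (LINT x|circle. Re (local_density f g x))
      = (LINT x|circle. cmod (F x) ^ 4 - cmod (f x) ^ 4 - 4 * h * Re (local_density f g x))"
      using half_line[OF F] half_line[OF f] Q' by simp
    also have "norm \<dots> \<le> (LINT x|circle. 11 * h\<^sup>2 * (cmod (f x) ^ 4 + cmod (g x) ^ 4))"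
    proof (rule Bochner_Integration.integral_norm_bound_integral)
      show "integrable circle (\<lambda>x. cmod (F x) ^ 4 - cmod (f x) ^ 4 - 4 * h * Re (local_density f g x))"
        using half_line[OF F] half_line[OF f] Q' by simp
      show "integrable circle (\<lambda>x. 11 * h\<^sup>2 * (cmod (f x) ^ 4 + cmod (g x) ^ 4))"
        using half_line[OF f] half_line[OF g] by simp
      show "norm (cmod (F x) ^ 4 - cmod (f x) ^ 4 - 4 * h * Re (local_density f g x)) \<le> 11 * h\<^sup>2 * (cmod (f x) ^ 4 + cmod (g x) ^ 4)" for x
        unfolding real_norm_def F_def local_density_def by (rule power4_expand[OF h])
    qed
    also have "\<dots> = 11 * h\<^sup>2 * ((LINT x|circle. cmod (f x) ^ 4) + (LINT x|circle. cmod (g x) ^ 4))"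
      using half_line[OF f] half_line[OF g] by simp
    also have "\<dots> \<le> 11 * h\<^sup>2 * (128 * L^4 + 128 * L'^4)"
      by (intro mult_left_mono add_mono half_line f g) auto
    finally show ?thesis by simp
  qed
  define X where "X = (LINT p|circle2. energy_density F p) - (LINT p|circle2. energy_density f p) - 4 * h * (LINT p|circle2. Re (nonlocal_density f g p))"
  define Y where "Y = (LINT x|circle. cmod (F x) ^ 4) - (LINT x|circle. cmod (f x) ^ 4) - 4 * h * (LINT x|circle. Re (local_density f g x))"
  have "Re (nonlin_form \<sigma> f g) = 1 / (8 * pi) * (LINT p|circle2. Re (nonlocal_density f g p)) - \<sigma> * (LINT x|circle. Re (local_density f g x))"
  proof -
    have "nonlin_form \<sigma> f g = of_real (1 / (8 * pi)) * (LINT p|circle2. nonlocal_density f g p) - of_real \<sigma> * (LINT x|circle. local_density f g x)"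
      by (simp add: nonlin_form_def)
    then show ?thesis using B Q by simp
  qed
  then have "hamiltonian \<sigma> F - hamiltonian \<sigma> f - 4 * h * Re (nonlin_form \<sigma> f g) = 1 / (8 * pi) * X - \<sigma> * Y"
    unfolding hamiltonian_def X_def Y_def by (simp only:) (simp add: algebra_simps diff_divide_distrib add_divide_distrib)
  also have "\<bar>\<dots>\<bar> \<le> \<bar>1 / (8 * pi)\<bar> * \<bar>X\<bar> + \<bar>\<sigma>\<bar> * \<bar>Y\<bar>"
    unfolding abs_mult[symmetric] by (rule abs_triangle_ineq4)
  also have "\<dots> \<le> 1 * (11 * h\<^sup>2 * (128 * L^4 + 128 * L'^4)) + 1 * (11 * h\<^sup>2 * (128 * L^4 + 128 * L'^4))"
    using pi_gt3 b1 b2 s unfolding X_def[symmetric] Y_def[symmetric] by (intro add_mono mult_mono) auto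
  finally show ?thesis unfolding F_def[abs_def] by (simp add: algebra_simps)
qed

lemma hamiltonian_shift:
  assumes f: "periodic_borel f" "W_energy f \<le> ennreal C" "L4 f \<le> ennreal C" "0 \<le> C"
  shows "hamiltonian \<sigma> (\<lambda>x. f (x + h)) = hamiltonian \<sigma> f"
proof -
  have "(LINT p|circle2. energy_density (\<lambda>x. f (x + h)) p) = enn2real (W_energy (\<lambda>x. f (x + h)))"
    unfolding W_energy_def by (rule integral_eq_nn_integral) (auto intro!: measurable_energy_density periodic_borel_measurable periodic_borel_shift f)
  moreover have "(LINT p|circle2. energy_density f p) = enn2real (W_energy f)"
    unfolding W_energy_def by (rule integral_eq_nn_integral) (auto intro!: measurable_energy_density periodic_borel_measurable periodic_borel_shift f)
  moreover have "(LINT x|circle. cmod (f (x + h)) ^ 4) = enn2real (L4 (\<lambda>x. f (x + h)))"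
    unfolding L4_def by (rule integral_eq_nn_integral) (use periodic_borel_measurable[OF periodic_borel_shift[OF f(1)]] in \<open>auto intro!: measurable_circle_borel\<close>)
  moreover have "(LINT x|circle. cmod (f x) ^ 4) = enn2real (L4 f)"
    unfolding L4_def by (rule integral_eq_nn_integral) (use periodic_borel_measurable[OF f(1)] in \<open>auto intro!: measurable_circle_borel\<close>)
  ultimately show ?thesis by (simp add: hamiltonian_def L4_shift[OF f(1)] W_energy_shift[OF f(1)])
qed

text \<open>The derivative of the Hamiltonian in the direction \<open>\<partial>\<^sub>x f\<close> vanishes, because the Hamiltonian is invariant
under translations. The difference quotients \<open>g n\<close> of \<open>f\<close> are again trigonometric polynomials, and
\<open>hamiltonian_expand\<close> with \<open>f (x + h) = f x + h g\<^sub>n x\<close> bounds the derivative in their direction by \<open>O(h)\<close>.\<close>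

lemma momentum_identity:
  assumes A: "finite A" and s: "\<bar>\<sigma>\<bar> \<le> 1"
  shows "Re (\<Sum>k\<in>A. cnj (\<i> * of_int k * a k) * nonlin_form \<sigma> (trig A a) (\<lambda>x. cis (of_int k * x))) = 0"
proof -
  define f where "f = trig A a"
  define D where "D k = nonlin_form \<sigma> f (\<lambda>x. cis (of_int k * x))" for k
  have f: "chord_lip (trig_lip A a) f" unfolding f_def by (rule chord_lip_trig[OF A])
  note fb = lipgD(1)[OF f] chord_lip_W_energy[OF f] chord_lip_L4[OF f]
  define h where "h n = inverse (real (Suc n))" for n
  have h: "0 < h n" "h n \<le> 1" for n by (auto simp: h_def inverse_le_1_iff)
  have h0: "h \<longlonglongrightarrow> 0" unfolding h_def by (rule LIMSEQ_inverse_real_of_nat)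
  define b where "b n k = (cis (of_int k * h n) - 1) / of_real (h n) * a k" for n and k :: int
  have b: "(\<lambda>n. b n k) \<longlonglongrightarrow> \<i> * of_int k * a k" for k
  proof -
    have "((\<lambda>z. exp (\<i> * of_int k * z)) has_field_derivative (\<i> * of_int k)) (at 0)"
      by (auto intro!: derivative_eq_intros)
    then have "((\<lambda>z. (exp (\<i> * of_int k * z) - 1) / z) \<longlongrightarrow> \<i> * of_int k) (at 0)"
      by (simp add: has_field_derivative_iff)
    moreover have "filterlim (\<lambda>n. complex_of_real (h n)) (at 0) sequentially"
      using h tendsto_of_real[OF h0, where 'a=complex] by (auto simp: filterlim_at intro!: always_eventually) (metis less_irrefl)
    ultimately have "(\<lambda>n. (exp (\<i> * of_int k * of_real (h n)) - 1) / of_real (h n)) \<longlonglongrightarrow> \<i> * of_int k"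
      by (rule filterlim_compose)
    then show ?thesis unfolding b_def cis_conv_exp by (intro tendsto_mult tendsto_const) (simp add: mult_ac)
  qed
  define g where "g n = trig A (b n)" for n
  have g: "chord_lip (trig_lip A (b n)) (g n)" for n unfolding g_def by (rule chord_lip_trig[OF A])
  have shift: "f (x + h n) = f x + of_real (h n) * g n x" for n x
    using h[of n] unfolding f_def g_def trig_def sum_distrib_left sum.distrib[symmetric] b_def
    by (intro sum.cong) (auto simp: distrib_left field_simps simp flip: cis_mult)
  have bound: "\<bar>Re (nonlin_form \<sigma> f (g n))\<bar> \<le> 704 * h n * (trig_lip A a ^ 4 + trig_lip A (b n) ^ 4)" for n
  proof -
    have "hamiltonian \<sigma> (\<lambda>x. f x + of_real (h n) * g n x) = hamiltonian \<sigma> f"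
      unfolding shift[symmetric] by (rule hamiltonian_shift[OF fb]) simp
    then have "4 * h n * \<bar>Re (nonlin_form \<sigma> f (g n))\<bar> \<le> 2816 * (h n)\<^sup>2 * (trig_lip A a ^ 4 + trig_lip A (b n) ^ 4)"
      using hamiltonian_expand[OF f g[of n] _ _ s, of "h n"] h[of n] by (simp add: abs_mult)
    also have "\<dots> = 4 * h n * (704 * h n * (trig_lip A a ^ 4 + trig_lip A (b n) ^ 4))"
      by (simp add: power2_eq_square)
    finally show ?thesis using h[of n] by simp
  qed
  have "(\<lambda>n. 704 * h n * (trig_lip A a ^ 4 + trig_lip A (b n) ^ 4)) \<longlonglongrightarrow> 704 * 0 * (trig_lip A a ^ 4 + trig_lip A (\<lambda>k. \<i> * of_int k * a k) ^ 4)"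
    unfolding trig_lip_def by (intro tendsto_intros h0 b)
  then have lim0: "(\<lambda>n. 704 * h n * (trig_lip A a ^ 4 + trig_lip A (b n) ^ 4)) \<longlonglongrightarrow> 0" by (simp only: mult_zero_right mult_zero_left)
  have "(\<lambda>n. Re (nonlin_form \<sigma> f (g n))) \<longlonglongrightarrow> 0"
    by (rule Lim_null_comparison[OF always_eventually lim0]) (simp only: real_norm_def bound simp_thms)
  moreover have "(\<lambda>n. Re (nonlin_form \<sigma> f (g n))) \<longlonglongrightarrow> Re (\<Sum>k\<in>A. cnj (\<i> * of_int k * a k) * D k)"
  proof -
    have "nonlin_form \<sigma> f (g n) = (\<Sum>k\<in>A. cnj (b n k) * D k)" for n
      unfolding g_def D_def by (rule nonlin_form_trig[OF fb _ A]) simp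
    then show ?thesis by (simp only:) (intro tendsto_intros b)
  qed
  ultimately show ?thesis unfolding D_def f_def by (rule LIMSEQ_unique[symmetric])
qed

section \<open>The Galerkin system and its Euler scheme\<close>

text \<open>The Fourier coefficients of \<open>\<partial>\<^sub>x\<close> of the projected nonlinearity; the factor \<open>1 / (2\<pi>)\<close> turns the
pairing with a character into a Fourier coefficient.\<close>

definition galerkin_field :: "real \<Rightarrow> nat \<Rightarrow> (int \<Rightarrow> complex) \<Rightarrow> int \<Rightarrow> complex" where
  "galerkin_field \<sigma> N a k = (if 1 \<le> k \<and> k \<le> int N
     then \<i> * of_int k / (2 * of_real pi) * nonlin_form \<sigma> (trig {1..int N} a) (\<lambda>x. cis (of_int k * x)) else 0)"

definition mass :: "nat \<Rightarrow> (int \<Rightarrow> complex) \<Rightarrow> real" where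
  "mass N a = (\<Sum>k\<in>{1..int N}. (cmod (a k))\<^sup>2)"

lemma mass_nonneg: "0 \<le> mass N a" by (simp add: mass_def sum_nonneg)

lemma norm_le_mass: "k \<in> {1..int N} \<Longrightarrow> cmod (a k) \<le> sqrt (mass N a)"
  by (rule real_le_rsqrt) (unfold mass_def, rule member_le_sum[of k _ "\<lambda>k. (cmod (a k))\<^sup>2"], auto)

text \<open>The rate of change of the \<open>L\<^sup>2\<close> norm: moving \<open>\<partial>\<^sub>x\<close> to the other factor gives the momentum identity.\<close>

lemma mass_identity:
  assumes "\<bar>\<sigma>\<bar> \<le> 1"
  shows "Re (\<Sum>k\<in>{1..int N}. a k * cnj (galerkin_field \<sigma> N a k)) = 0"
proof -
  define D where "D k = nonlin_form \<sigma> (trig {1..int N} a) (\<lambda>x. cis (of_int k * x))" for k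
  have "(\<Sum>k\<in>{1..int N}. a k * cnj (galerkin_field \<sigma> N a k)) = of_real (- 1 / (2 * pi)) * cnj (\<Sum>k\<in>{1..int N}. cnj (\<i> * of_int k * a k) * D k)"
    unfolding sum_distrib_left cnj_sum
    by (intro sum.cong) (auto simp: galerkin_field_def D_def mult_ac)
  moreover have "Re (\<Sum>k\<in>{1..int N}. cnj (\<i> * of_int k * a k) * D k) = 0"
    unfolding D_def by (rule momentum_identity) (use assms in auto)
  ultimately show ?thesis by (simp only: Re_complex_of_real times_complex.sel cnj.sel Im_complex_of_real)
qed

text \<open>The operator \<open>\<partial>\<^sub>x\<close> is skew, so the Hamiltonian is stationary along its own flow.\<close>

lemma energy_identity:
  "Re (nonlin_form \<sigma> (trig {1..int N} a) (trig {1..int N} (galerkin_field \<sigma> N a))) = 0"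
proof -
  define D where "D k = nonlin_form \<sigma> (trig {1..int N} a) (\<lambda>x. cis (of_int k * x))" for k
  have f: "chord_lip (trig_lip {1..int N} a) (trig {1..int N} a)" by (rule chord_lip_trig) simp
  have "nonlin_form \<sigma> (trig {1..int N} a) (trig {1..int N} (galerkin_field \<sigma> N a)) = (\<Sum>k\<in>{1..int N}. cnj (galerkin_field \<sigma> N a k) * D k)"
    unfolding D_def by (rule nonlin_form_trig[OF lipgD(1)[OF f] chord_lip_W_energy[OF f] chord_lip_L4[OF f]]) auto
  also have "\<dots> = (\<Sum>k\<in>{1..int N}. - \<i> * of_real (of_int k / (2 * pi) * (cmod (D k))\<^sup>2))"
  proof (intro sum.cong refl)
    fix k assume "k \<in> {1..int N}"
    then have v: "galerkin_field \<sigma> N a k = \<i> * of_real (of_int k / (2 * pi)) * D k" by (simp add: galerkin_field_def D_def)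
    have "cnj (galerkin_field \<sigma> N a k) * D k = - \<i> * of_real (of_int k / (2 * pi)) * (D k * cnj (D k))"
      unfolding v by simp
    then show "cnj (galerkin_field \<sigma> N a k) * D k = - \<i> * of_real (of_int k / (2 * pi) * (cmod (D k))\<^sup>2)"
      unfolding complex_norm_square[symmetric] by (simp only: of_real_mult mult.assoc)
  qed
  finally show ?thesis by (simp add: Re_sum)
qed

text \<open>The linear term vanishes by \<open>mass_identity\<close>, so that the change is exactly quadratic in \<open>h\<close>.\<close>

lemma mass_step:
  assumes "\<bar>\<sigma>\<bar> \<le> 1"
  shows "mass N (\<lambda>k. a k + of_real h * galerkin_field \<sigma> N a k) = mass N a + h\<^sup>2 * mass N (galerkin_field \<sigma> N a)"
proof -
  have e: "(cmod (z + of_real h * w))\<^sup>2 = (cmod z)\<^sup>2 + 2 * h * Re (z * cnj w) + h\<^sup>2 * (cmod w)\<^sup>2" for z w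
    unfolding cmod_power2 by (simp add: power2_eq_square algebra_simps)
  have "mass N (\<lambda>k. a k + of_real h * galerkin_field \<sigma> N a k)
    = mass N a + 2 * h * Re (\<Sum>k\<in>{1..int N}. a k * cnj (galerkin_field \<sigma> N a k)) + h\<^sup>2 * mass N (galerkin_field \<sigma> N a)"
    unfolding mass_def e sum.distrib Re_sum sum_distrib_left ..
  then show ?thesis unfolding mass_identity[OF assms] by simp
qed

lemma trig_lip_le:
  assumes "\<And>k. k \<in> {1..int N} \<Longrightarrow> cmod (a k) \<le> R" "0 \<le> R"
  shows "trig_lip {1..int N} a \<le> real N * (R * (2 * (real N + 1)))"
proof -
  have "trig_lip {1..int N} a \<le> of_nat (card {1..int N}) * (R * (2 * (real N + 1)))"
    unfolding trig_lip_def by (rule sum_bounded_above) (use assms in \<open>auto intro!: mult_mono simp flip: of_int_abs\<close>)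
  then show ?thesis by simp
qed

text \<open>On a bounded set of coefficients all constants depend on the dimension \<open>N\<close>, which is harmless because the
time step is chosen afterwards.\<close>

lemma euler_step:
  assumes s: "\<bar>\<sigma>\<bar> \<le> 1" and m: "0 \<le> m"
  shows "\<exists>K\<ge>0. \<forall>a h. mass N a \<le> m \<longrightarrow> 0 \<le> h \<longrightarrow> h \<le> 1 \<longrightarrow>
    mass N (\<lambda>k. a k + of_real h * galerkin_field \<sigma> N a k) \<le> mass N a + K * h\<^sup>2 \<and>
    hamiltonian \<sigma> (trig {1..int N} (\<lambda>k. a k + of_real h * galerkin_field \<sigma> N a k)) \<le> hamiltonian \<sigma> (trig {1..int N} a) + K * h\<^sup>2"
proof -
  define L where "L = real N * (sqrt m * (2 * (real N + 1)))"
  define V where "V = real N * ((2 * (real N + 1)) * (50 + 2 * (128 * L^4)))"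
  define L' where "L' = real N * (V * (2 * (real N + 1)))"
  define K where "K = real N * V\<^sup>2 + 2816 * (L^4 + L'^4)"
  have L0: "0 \<le> L" and V0: "0 \<le> V" using m by (auto simp: L_def V_def)
  have "0 \<le> L'" using V0 by (simp add: L'_def)
  have K0: "0 \<le> K" by (simp add: K_def)
  have "mass N (\<lambda>k. a k + of_real h * galerkin_field \<sigma> N a k) \<le> mass N a + K * h\<^sup>2 \<and>
    hamiltonian \<sigma> (trig {1..int N} (\<lambda>k. a k + of_real h * galerkin_field \<sigma> N a k)) \<le> hamiltonian \<sigma> (trig {1..int N} a) + K * h\<^sup>2"
    if a: "mass N a \<le> m" and h: "0 \<le> h" "h \<le> 1" for a and h :: real
  proof -
    have "cmod (a k) \<le> sqrt m" if "k \<in> {1..int N}" for k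
      using norm_le_mass[OF that, of a] a by (meson order_trans real_sqrt_le_mono)
    then have "trig_lip {1..int N} a \<le> L" unfolding L_def by (rule trig_lip_le) (use m in auto)
    then have f: "chord_lip L (trig {1..int N} a)" by (rule chord_lip_mono[OF chord_lip_trig, rotated]) simp
    have v: "cmod (galerkin_field \<sigma> N a k) \<le> V" for k
    proof (cases "1 \<le> k \<and> k \<le> int N")
      case True
      have "cmod (galerkin_field \<sigma> N a k) = real_of_int k / (2 * pi) * cmod (nonlin_form \<sigma> (trig {1..int N} a) (\<lambda>x. cis (of_int k * x)))"
        using True by (simp add: galerkin_field_def norm_mult norm_divide)
      also have "\<dots> \<le> real N * ((2 * (\<bar>of_int k\<bar> + 1)) * (50 + 2 * (128 * L^4)))"
      proof (rule mult_mono)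
        show "real_of_int k / (2 * pi) \<le> real N"
        proof -
          have "real_of_int k / (2 * pi) \<le> real_of_int k / 1" using True pi_gt3 by (intro divide_left_mono) auto
          also have "\<dots> \<le> real N" using True by simp
          finally show ?thesis .
        qed
        show "cmod (nonlin_form \<sigma> (trig {1..int N} a) (\<lambda>x. cis (of_int k * x))) \<le> (2 * (\<bar>of_int k\<bar> + 1)) * (50 + 2 * (128 * L^4))"
          by (rule norm_nonlin_form_le[OF lipgD(1)[OF f] chord_lip_W_energy[OF f] chord_lip_L4[OF f] _ chord_lip_cis s]) simp
      qed auto
      also have "\<dots> \<le> V" unfolding V_def using True
        by (intro mult_left_mono mult_right_mono) auto
      finally show ?thesis .
    qed (use V0 in \<open>auto simp: galerkin_field_def\<close>)
    then have "trig_lip {1..int N} (galerkin_field \<sigma> N a) \<le> L'" unfolding L'_def by (intro trig_lip_le V0)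
    then have g: "chord_lip L' (trig {1..int N} (galerkin_field \<sigma> N a))" by (rule chord_lip_mono[OF chord_lip_trig, rotated]) simp
    have "mass N (galerkin_field \<sigma> N a) \<le> of_nat (card {1..int N}) * V\<^sup>2"
      unfolding mass_def by (rule sum_bounded_above) (use v in \<open>auto intro: power_mono\<close>)
    then have mv: "mass N (galerkin_field \<sigma> N a) \<le> real N * V\<^sup>2" by simp
    have "h\<^sup>2 * mass N (galerkin_field \<sigma> N a) \<le> h\<^sup>2 * K"
      by (intro mult_left_mono order_trans[OF mv]) (auto simp: K_def)
    then have 1: "mass N (\<lambda>k. a k + of_real h * galerkin_field \<sigma> N a k) \<le> mass N a + K * h\<^sup>2"
      unfolding mass_step[OF s] by (simp add: mult.commute)
    have eq: "trig {1..int N} (\<lambda>k. a k + of_real h * galerkin_field \<sigma> N a k) = (\<lambda>x. trig {1..int N} a x + of_real h * trig {1..int N} (galerkin_field \<sigma> N a) x)"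
      by (rule ext) (simp add: trig_def distrib_right sum.distrib sum_distrib_left mult.assoc)
    have "\<bar>hamiltonian \<sigma> (\<lambda>x. trig {1..int N} a x + of_real h * trig {1..int N} (galerkin_field \<sigma> N a) x) - hamiltonian \<sigma> (trig {1..int N} a) - 4 * h * 0\<bar>
       \<le> 2816 * h\<^sup>2 * (L^4 + L'^4)"
      using hamiltonian_expand[OF f g h s] unfolding energy_identity .
    moreover have "2816 * h\<^sup>2 * (L^4 + L'^4) \<le> K * h\<^sup>2"
    proof -
      have "2816 * (L^4 + L'^4) * h\<^sup>2 \<le> K * h\<^sup>2" by (intro mult_right_mono) (auto simp: K_def)
      then show ?thesis by (simp only: mult_ac)
    qed
    ultimately have "hamiltonian \<sigma> (trig {1..int N} (\<lambda>k. a k + of_real h * galerkin_field \<sigma> N a k)) \<le> hamiltonian \<sigma> (trig {1..int N} a) + K * h\<^sup>2"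
      unfolding eq by linarith
    with 1 show ?thesis by blast
  qed
  with K0 show ?thesis by blast
qed

primrec euler :: "real \<Rightarrow> nat \<Rightarrow> real \<Rightarrow> (int \<Rightarrow> complex) \<Rightarrow> nat \<Rightarrow> int \<Rightarrow> complex" where
  "euler \<sigma> N h a 0 = a"
| "euler \<sigma> N h a (Suc n) = (\<lambda>k. euler \<sigma> N h a n k + of_real h * galerkin_field \<sigma> N (euler \<sigma> N h a n) k)"

text \<open>An error of \<open>K h\<^sup>2\<close> per step adds up to at most \<open>T K h\<close>. Smallness of the mass increments keeps all steps
inside the bounded set where \<open>K\<close> is valid.\<close>

lemma euler_bounds:
  assumes s: "\<bar>\<sigma>\<bar> \<le> 1" and T: "1 \<le> T"
  shows "\<exists>h>0. h \<le> 1 / T \<and> (\<forall>n. real n * h \<le> T \<longrightarrow>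
    mass N (euler \<sigma> N h a n) \<le> mass N a + 1 \<and>
    hamiltonian \<sigma> (trig {1..int N} (euler \<sigma> N h a n)) \<le> hamiltonian \<sigma> (trig {1..int N} a) + 1)"
proof -
  obtain K where K0: "K \<ge> 0" and K: "\<And>b h. mass N b \<le> mass N a + 1 \<Longrightarrow> 0 \<le> h \<Longrightarrow> h \<le> 1 \<Longrightarrow>
    mass N (\<lambda>k. b k + of_real h * galerkin_field \<sigma> N b k) \<le> mass N b + K * h\<^sup>2 \<and>
    hamiltonian \<sigma> (trig {1..int N} (\<lambda>k. b k + of_real h * galerkin_field \<sigma> N b k)) \<le> hamiltonian \<sigma> (trig {1..int N} b) + K * h\<^sup>2"
    using euler_step[OF s, of "mass N a + 1" N] mass_nonneg[of N a] by auto
  \<comment> \<open>The total error \<open>T K h\<close> of the scheme is below 1.\<close>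
  define h where "h = 1 / (T * (K + 1))"
  have h0: "h > 0" using T K0 by (simp add: h_def)
  have hT: "h \<le> 1 / T" unfolding h_def using T K0 by (intro divide_left_mono) auto
  also have "1 / T \<le> 1" using T by simp
  finally have h1: "h \<le> 1" .
  have small: "real n * (K * h\<^sup>2) \<le> 1" if "real n * h \<le> T" for n
  proof -
    have "real n * (K * h\<^sup>2) = (real n * h) * (K * h)" by (simp add: power2_eq_square)
    also have "\<dots> \<le> T * ((K + 1) * h)" using that h0 K0 T by (intro mult_mono) auto
    also have "\<dots> = 1" using T K0 by (simp add: h_def)
    finally show ?thesis .
  qed
  have "mass N (euler \<sigma> N h a n) \<le> mass N a + real n * (K * h\<^sup>2) \<and>
    hamiltonian \<sigma> (trig {1..int N} (euler \<sigma> N h a n)) \<le> hamiltonian \<sigma> (trig {1..int N} a) + real n * (K * h\<^sup>2)"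
    if "real n * h \<le> T" for n
    using that
  proof (induction n)
    case (Suc n)
    have n: "real n * h \<le> T" using Suc.prems h0 by (simp add: algebra_simps)
    have "mass N (euler \<sigma> N h a n) \<le> mass N a + 1" using Suc.IH[OF n] small[OF n] by linarith
    from K[OF this, of h] h0 h1 Suc.IH[OF n] show ?case by (simp add: algebra_simps)
  qed simp
  then have "mass N (euler \<sigma> N h a n) \<le> mass N a + 1 \<and>
    hamiltonian \<sigma> (trig {1..int N} (euler \<sigma> N h a n)) \<le> hamiltonian \<sigma> (trig {1..int N} a) + 1"
    if "real n * h \<le> T" for n
    using small[OF that] that by (meson add_left_mono order_trans)
  with h0 hT show ?thesis by blast
qed

lemma euler_support:
  "(\<And>k. k \<notin> {1..int N} \<Longrightarrow> a k = 0) \<Longrightarrow> k \<notin> {1..int N} \<Longrightarrow> euler \<sigma> N h a n k = 0"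
  by (induction n) (auto simp: galerkin_field_def)

text \<open>The quartic term of the Hamiltonian is absorbed: \<open>\<integral> |f|\<^sup>4 \<le> 8 E / (128 \<pi>) + 8 \<integral> |S\<^sub>1\<^sub>2\<^sub>8 f|\<^sup>4\<close>, with \<open>S\<^sub>M\<close> for the Fejer
mean, where the first term is half of \<open>E / (8 \<pi>)\<close> and the second one is bounded by the \<open>L\<^sup>2\<close> norm, since the
Fejer sum has 127 terms. The bound on \<open>\<integral> |f|\<^sup>4\<close> follows from the Fejer mean of order one, which is zero.\<close>

lemma energy_bound:
  assumes s: "0 \<le> \<sigma>" "\<sigma> \<le> 1" and supp: "\<And>k. k \<notin> {1..int N} \<Longrightarrow> a k = 0"
    and m: "mass N a \<le> m" and H: "hamiltonian \<sigma> (trig {1..int N} a) \<le> H"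
  defines "E \<equiv> 16 * pi * (H + 64 * (127 * sqrt m)^4)"
  shows "0 \<le> E" "W_energy (trig {1..int N} a) \<le> ennreal E" "L4 (trig {1..int N} a) \<le> ennreal E"
proof -
  define f where "f = trig {1..int N} a"
  have f: "chord_lip (trig_lip {1..int N} a) f" unfolding f_def by (rule chord_lip_trig) simp
  note I = chord_lip_integrals[OF f]
  have pf: "periodic_borel f" and intf: "integrable circle f" by (simp_all add: f_def)
  define e where "e = (LINT p|circle2. energy_density f p)"
  have Ee: "W_energy f = ennreal e" unfolding W_energy_def e_def by (rule nn_integral_eq_integral[OF I(1)]) simp
  have e0: "0 \<le> e" unfolding e_def by (rule Bochner_Integration.integral_nonneg) simp
  have fc: "fourier_coeff f k = a k" for k unfolding f_def by (rule fourier_coeff_trig) (auto intro: supp)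
  then have fc': "fourier_coeff f = a" by blast
  have fm: "fejer_mean M f = fejer_sum M a" for M
    using fejer_mean_eq_fejer_sum[OF pf intf, of M] supp unfolding fc' by auto
  have err: "L4 (\<lambda>x. f x - fejer_sum M a x) \<le> ennreal (1 / (pi * real M) * e)" if "M > 0" for M
    using fejer_mean_L4_error[OF pf intf that] e0 unfolding fm Ee by (subst L4_minus_commute) (simp only: ennreal_mult[OF _ e0] zero_le_divide_1_iff mult_nonneg_nonneg pi_ge_zero of_nat_0_le_iff)
  have m0: "0 \<le> m" using m mass_nonneg[of N a] by linarith
  have ak: "cmod (a k) \<le> sqrt m" for k
  proof (cases "k \<in> {1..int N}")
    case True
    then show ?thesis using norm_le_mass[OF True, of a] m by (meson order_trans real_sqrt_le_mono)
  qed (use supp m0 in auto)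
  have "cmod (fejer_sum 128 a x) \<le> 127 * sqrt m" for x
  proof -
    have "cmod (fejer_sum 128 a x) \<le> (\<Sum>k\<in>{1..<128}. cmod (of_real (1 - of_int k / 128) * a k * cis (of_int k * x)))"
      unfolding fejer_sum_def trig_def by (rule order_trans[OF norm_sum]) simp
    also have "\<dots> \<le> of_nat (card {1..<128::int}) * sqrt m"
    proof (rule sum_bounded_above)
      fix k :: int assume k: "k \<in> {1..<128}"
      have "cmod (of_real (1 - of_int k / 128) * a k * cis (of_int k * x)) = \<bar>1 - of_int k / 128\<bar> * cmod (a k)"
        by (simp only: norm_mult norm_cis norm_of_real mult_1_right)
      also have "\<dots> \<le> 1 * sqrt m" using k by (intro mult_mono ak) auto
      finally show "cmod (of_real (1 - of_int k / 128) * a k * cis (of_int k * x)) \<le> sqrt m" by simp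
    qed
    finally show ?thesis by simp
  qed
  then have S: "L4 (\<lambda>x. fejer_sum 128 a x - 0) \<le> ennreal (8 * (127 * sqrt m)^4)"
    by (intro L4_bounded) simp
  \<comment> \<open>The order 128 makes the coefficient of the energy \<open>1 / (16 \<pi>)\<close>, half of that in the Hamiltonian.\<close>
  have "L4 (\<lambda>x. f x - 0) \<le> ennreal (8 * (1 / (pi * real 128) * e + 8 * (127 * sqrt m)^4))"
    by (rule L4_diff[OF pf _ _ err S]) (use e0 m0 in auto)
  then have "L4 f \<le> ennreal (e / (16 * pi) + 64 * (127 * sqrt m)^4)" by simp
  then have q: "(LINT x|circle. cmod (f x) ^ 4) \<le> e / (16 * pi) + 64 * (127 * sqrt m)^4"
    using e0 m0 by (intro L4_integrable(2)[OF pf]) auto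
  have "\<sigma> * (LINT x|circle. cmod (f x) ^ 4) \<le> 1 * (LINT x|circle. cmod (f x) ^ 4)"
    using s by (intro mult_right_mono Bochner_Integration.integral_nonneg) auto
  with q H have "1 / (8 * pi) * e - e / (16 * pi) \<le> H + 64 * (127 * sqrt m)^4"
    unfolding f_def[symmetric] hamiltonian_def e_def[symmetric] by linarith
  then have "e / (16 * pi) \<le> H + 64 * (127 * sqrt m)^4" by simp
  then have eE: "e \<le> E" unfolding E_def by (simp add: divide_le_eq mult_ac)
  then show "0 \<le> E" using e0 by simp
  show "W_energy (trig {1..int N} a) \<le> ennreal E" using eE Ee by (simp add: f_def ennreal_leI)
  have "L4 f \<le> ennreal (1 / pi * e)" using err[of 1] by (simp add: fejer_sum_def trig_def)
  also have "1 / pi * e \<le> 1 * E" using pi_gt3 e0 eE by (intro mult_mono) auto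
  finally show "L4 (trig {1..int N} a) \<le> ennreal E" by (simp add: f_def ennreal_leI)
qed

lemma parseval_trig: "(LINT x|circle. (cmod (trig {1..int N} a x))\<^sup>2) = 2 * pi * mass N a"
proof -
  define b where "b k = (if k \<in> {1..int N} then a k else 0)" for k
  have tb: "trig {1..int N} a = trig {1..int N} b" by (rule trig_cong) (simp add: b_def)
  have fc: "(LINT x|circle. trig {1..int N} b x * cis (- (of_int k * x))) = 2 * pi * b k" for k
  proof -
    have "fourier_coeff (trig {1..int N} b) k = b k"
      by (rule fourier_coeff_trig) (auto simp: b_def)
    then have "of_real (2 * pi) * ((1 / (2 * pi)) *\<^sub>R (LINT x|circle. trig {1..int N} b x * cis (- (of_int k * x)))) = of_real (2 * pi) * b k"
      unfolding fourier_coeff_circle by (simp only:)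
    then show ?thesis by (simp add: scaleR_conv_of_real)
  qed
  have i: "integrable circle (\<lambda>x. trig {1..int N} b x * cis (- (of_int k * x)))" for k
    using periodic_borel_measurable[OF periodic_borel_cis[of "-k"]] by (intro integrable_circle_mult_bounded(1)[where B=1]) auto
  have "complex_of_real (LINT x|circle. (cmod (trig {1..int N} a x))\<^sup>2) = (LINT x|circle. complex_of_real ((cmod (trig {1..int N} a x))\<^sup>2))"
    by (rule integral_complex_of_real[symmetric])
  also have "\<dots> = (LINT x|circle. (\<Sum>k\<in>{1..int N}. cnj (b k) * (trig {1..int N} b x * cis (- (of_int k * x)))))"
  proof (intro Bochner_Integration.integral_cong refl)
    fix x
    have "complex_of_real ((cmod (trig {1..int N} b x))\<^sup>2) = trig {1..int N} b x * cnj (trig {1..int N} b x)"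
      by (rule complex_norm_square)
    also have "cnj (trig {1..int N} b x) = (\<Sum>k\<in>{1..int N}. cnj (b k) * cis (- (of_int k * x)))"
      by (simp add: trig_def cis_cnj)
    finally show "complex_of_real ((cmod (trig {1..int N} a x))\<^sup>2) = (\<Sum>k\<in>{1..int N}. cnj (b k) * (trig {1..int N} b x * cis (- (of_int k * x))))"
      unfolding tb by (simp add: sum_distrib_left mult_ac)
  qed
  also have "\<dots> = (\<Sum>k\<in>{1..int N}. cnj (b k) * (2 * pi * b k))"
    using i by (simp add: Bochner_Integration.integral_sum fc)
  also have "\<dots> = complex_of_real (2 * pi * mass N a)"
    unfolding mass_def of_real_mult of_real_sum sum_distrib_left
    by (intro sum.cong) (auto simp: b_def complex_norm_square mult.commute simp del: of_real_power)
  finally show ?thesis by (simp only: of_real_eq_iff)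
qed

text \<open>Fejer sums of the data are used as initial values, because sharp truncations would not obviously keep the
energy bounded. The constant does not depend on \<open>N\<close>.\<close>

lemma galerkin:
  assumes s: "0 \<le> \<sigma>" "\<sigma> \<le> 1" and C: "0 \<le> C"
    and bd: "\<And>M. M > 0 \<Longrightarrow> W_energy (fejer_sum M c) \<le> ennreal C"
  shows "\<exists>C1\<ge>0. \<forall>N\<ge>1. \<exists>h>0. h \<le> 1 / real N \<and>
    (\<forall>n. real n * h \<le> real N \<longrightarrow> (let a = euler \<sigma> N h (fourier_coeff (fejer_sum (Suc N) c)) n in
      W_energy (trig {1..int N} a) \<le> ennreal C1 \<and> L4 (trig {1..int N} a) \<le> ennreal C1 \<and> (\<forall>k. cmod (a k) \<le> C1)))"
proof -
  define m where "m = (1 + C) + 1"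
  define H where "H = C + 1"
  define E where "E = 16 * pi * (H + 64 * (127 * sqrt m)^4)"
  define C1 where "C1 = max E (sqrt m)"
  have m0: "m \<ge> 0" using C by (simp add: m_def)
  have C1: "C1 \<ge> 0" using m0 by (simp add: C1_def le_max_iff_disj)
  have "\<exists>h>0. h \<le> 1 / real N \<and>
    (\<forall>n. real n * h \<le> real N \<longrightarrow> (let a = euler \<sigma> N h (fourier_coeff (fejer_sum (Suc N) c)) n in
      W_energy (trig {1..int N} a) \<le> ennreal C1 \<and> L4 (trig {1..int N} a) \<le> ennreal C1 \<and> (\<forall>k. cmod (a k) \<le> C1)))"
    if N: "N \<ge> 1" for N
  proof -
    define a0 where "a0 = fourier_coeff (fejer_sum (Suc N) c)"
    have supp: "a0 k = 0" if "k \<notin> {1..int N}" for k using that by (auto simp: a0_def fourier_coeff_fejer_sum)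
    have f0: "trig {1..int N} a0 = fejer_sum (Suc N) c"
      unfolding fejer_sum_def
    proof -
      have "{1..int N} = {1..<int (Suc N)}" by auto
      then show "trig {1..int N} a0 = trig {1..<int (Suc N)} (\<lambda>k. complex_of_real (1 - real_of_int k / real (Suc N)) * c k)"
        by (simp only:) (rule trig_cong, auto simp: a0_def fourier_coeff_fejer_sum)
    qed
    have E0: "W_energy (trig {1..int N} a0) \<le> ennreal C" unfolding f0 by (rule bd) simp
    have "fourier_coeff (trig {1..int N} a0) = a0" by (rule ext, rule fourier_coeff_trig) (auto intro: supp)
    then have "fejer_mean 1 (trig {1..int N} a0) = fejer_sum 1 a0"
      using fejer_mean_eq_fejer_sum[OF periodic_borel_trig integrable_trig, of "{1..int N}" a0 1] supp by auto
    then have "fejer_mean 1 (trig {1..int N} a0) = (\<lambda>x. 0)" by (simp add: fejer_sum_def trig_def[abs_def])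
    then have "L4 (trig {1..int N} a0) \<le> ennreal (1 / pi) * W_energy (trig {1..int N} a0)"
      using fejer_mean_L4_error[OF periodic_borel_trig integrable_trig, of 1 "{1..int N}" a0] by (simp add: L4_def)
    also have "\<dots> \<le> ennreal 1 * ennreal C" using pi_gt3 by (intro mult_mono E0 ennreal_leI) auto
    finally have L0: "L4 (trig {1..int N} a0) \<le> ennreal C" by simp
    have "2 * pi * mass N a0 \<le> 2 * pi * 1 + C / 1"
      unfolding parseval_trig[symmetric] by (rule L4_imp_L2(2)[OF periodic_borel_trig L0 C]) simp
    also have "\<dots> \<le> 2 * pi * (1 + C)"
      using mult_right_mono[of 1 "2 * pi" C] C pi_gt3 by (simp add: distrib_left)
    finally have m1: "mass N a0 \<le> 1 + C" by simp
    have "hamiltonian \<sigma> (trig {1..int N} a0) \<le> C"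
    proof -
      have "hamiltonian \<sigma> (trig {1..int N} a0) \<le> 1 / (8 * pi) * (LINT p|circle2. energy_density (trig {1..int N} a0) p)"
        unfolding hamiltonian_def using s(1) by (simp add: Bochner_Integration.integral_nonneg)
      also have "\<dots> \<le> 1 * C"
        using pi_gt3 W_energy_integrable[OF periodic_borel_trig E0 C] by (intro mult_mono Bochner_Integration.integral_nonneg) auto
      finally show ?thesis by simp
    qed
    then have hH: "hamiltonian \<sigma> (trig {1..int N} a0) + 1 \<le> H" by (simp add: H_def)
    have mm: "mass N a0 + 1 \<le> m" using m1 by (simp add: m_def)
    obtain h where h: "h > 0" "h \<le> 1 / real N" and hb: "\<And>n. real n * h \<le> real N \<Longrightarrow>
      mass N (euler \<sigma> N h a0 n) \<le> mass N a0 + 1 \<and>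
      hamiltonian \<sigma> (trig {1..int N} (euler \<sigma> N h a0 n)) \<le> hamiltonian \<sigma> (trig {1..int N} a0) + 1"
      using euler_bounds[of \<sigma> "real N" N a0] s N by auto
    have "let a = euler \<sigma> N h a0 n in W_energy (trig {1..int N} a) \<le> ennreal C1 \<and> L4 (trig {1..int N} a) \<le> ennreal C1 \<and> (\<forall>k. cmod (a k) \<le> C1)"
      if n: "real n * h \<le> real N" for n
    proof -
      define a where "a = euler \<sigma> N h a0 n"
      have sp: "a k = 0" if "k \<notin> {1..int N}" for k unfolding a_def by (rule euler_support[OF supp that])
      have am: "mass N a \<le> m" and ah: "hamiltonian \<sigma> (trig {1..int N} a) \<le> H"
        using hb[OF n] mm hH unfolding a_def by auto
      note eb = energy_bound[OF s sp am ah, folded E_def]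
      have "cmod (a k) \<le> sqrt m" for k
      proof (cases "k \<in> {1..int N}")
        case True
        then show ?thesis using norm_le_mass[OF True, of a] am by (meson order_trans real_sqrt_le_mono)
      qed (use sp m0 in auto)
      moreover have "ennreal E \<le> ennreal C1" by (intro ennreal_leI) (simp add: C1_def)
      ultimately show ?thesis using eb(2,3) unfolding Let_def a_def[symmetric] C1_def
        by (auto intro: order_trans simp: le_max_iff_disj)
    qed
    with h show ?thesis unfolding a0_def by blast
  qed
  with C1 show ?thesis by blast
qed

section \<open>Passage to the limit in the Galerkin scheme\<close>

lemma finite_lborel_Ico: "emeasure lborel {a..<b :: real} < top" "emeasure lborel {a..b :: real} < top"
proof -
  have "emeasure lborel {a..b :: real} < \<infinity>" by (rule emeasure_bounded_finite) simp
  then show "emeasure lborel {a..b :: real} < top" by simp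
  then show "emeasure lborel {a..<b :: real} < top"
    by (rule le_less_trans[rotated]) (intro emeasure_mono, auto)
qed

text \<open>The parameter \<open>h N\<close> is the time step used on the modes \<open>1, \<dots>, Suc N\<close> up to time \<open>Suc N\<close>.\<close>

locale galerkin_scheme =
  fixes \<sigma> :: real and c :: "int \<Rightarrow> complex" and C :: real and h :: "nat \<Rightarrow> real"
  assumes sigma: "\<bar>\<sigma>\<bar> \<le> 1" and c_pos: "\<And>k. k < 1 \<Longrightarrow> c k = 0" and C0: "0 \<le> C"
    and h0: "\<And>N. 0 < h N" and h1: "\<And>N. h N \<le> 1 / real (Suc N)"
    and bounds: "\<And>N n. real n * h N \<le> real (Suc N) \<Longrightarrow>
      (let a = euler \<sigma> (Suc N) (h N) (fourier_coeff (fejer_sum (Suc (Suc N)) c)) n in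
      W_energy (trig {1..int (Suc N)} a) \<le> ennreal C \<and> L4 (trig {1..int (Suc N)} a) \<le> ennreal C \<and> (\<forall>k. cmod (a k) \<le> C))"
begin

definition euler_coeff :: "nat \<Rightarrow> nat \<Rightarrow> int \<Rightarrow> complex" where
  "euler_coeff N = euler \<sigma> (Suc N) (h N) (fourier_coeff (fejer_sum (Suc (Suc N)) c))"

definition time_index :: "nat \<Rightarrow> real \<Rightarrow> nat" where
  "time_index N t = nat \<lfloor>t / h N\<rfloor>"

text \<open>Piecewise constant interpolation in time of the Euler iterates.\<close>

definition galerkin_coeff :: "nat \<Rightarrow> real \<Rightarrow> int \<Rightarrow> complex" where
  "galerkin_coeff N t = euler_coeff N (time_index N t)"

definition galerkin_sol :: "nat \<Rightarrow> real \<Rightarrow> real \<Rightarrow> complex" where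
  "galerkin_sol N t = trig {1..int (Suc N)} (galerkin_coeff N t)"

text \<open>A bound for the derivative in time of the coefficient of index \<open>k\<close>, uniform in the approximation.\<close>

definition V :: "int \<Rightarrow> real" where
  "V k = \<bar>of_int k\<bar> * (2 * (\<bar>of_int k\<bar> + 1) * (50 + 2 * C))"

lemma V0: "0 \<le> V k" using C0 by (simp add: V_def)

lemma step_bounds:
  assumes "0 \<le> t"
  shows "real (time_index N t) * h N \<le> t" "t < real (time_index N t) * h N + h N"
proof -
  have "real (time_index N t) = of_int \<lfloor>t / h N\<rfloor>" using assms h0[of N] by (simp add: time_index_def)
  then have "real (time_index N t) \<le> t / h N" "t / h N < real (time_index N t) + 1" by linarith+
  then show "real (time_index N t) * h N \<le> t" "t < real (time_index N t) * h N + h N"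
    using h0[of N] by (auto simp: field_simps)
qed

lemma e_support: "k \<notin> {1..int (Suc N)} \<Longrightarrow> euler_coeff N n k = 0"
  unfolding euler_coeff_def by (rule euler_support) (auto simp: fourier_coeff_fejer_sum)

lemma w_support: "k \<notin> {1..int (Suc N)} \<Longrightarrow> galerkin_coeff N t k = 0"
  unfolding galerkin_coeff_def by (rule e_support)

lemma e_bounds:
  assumes "real n * h N \<le> real (Suc N)"
  shows "W_energy (trig {1..int (Suc N)} (euler_coeff N n)) \<le> ennreal C" "L4 (trig {1..int (Suc N)} (euler_coeff N n)) \<le> ennreal C" "cmod (euler_coeff N n k) \<le> C"
  using bounds[OF assms] unfolding Let_def euler_coeff_def by auto

lemma w_bounds:
  assumes "0 \<le> t" "t \<le> real N"
  shows "W_energy (galerkin_sol N t) \<le> ennreal C" "L4 (galerkin_sol N t) \<le> ennreal C" "cmod (galerkin_coeff N t k) \<le> C"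
proof -
  have "real (time_index N t) * h N \<le> real (Suc N)" using step_bounds(1)[of t N] assms by simp
  from e_bounds[OF this] show "W_energy (galerkin_sol N t) \<le> ennreal C" "L4 (galerkin_sol N t) \<le> ennreal C" "cmod (galerkin_coeff N t k) \<le> C"
    unfolding galerkin_sol_def galerkin_coeff_def by auto
qed

lemma periodic_borel_f [simp]: "periodic_borel (galerkin_sol N t)" and integrable_f [simp]: "integrable circle (galerkin_sol N t)"
  by (simp_all add: galerkin_sol_def)

lemma fourier_coeff_f: "fourier_coeff (galerkin_sol N t) = galerkin_coeff N t"
  unfolding galerkin_sol_def by (rule ext, rule fourier_coeff_trig) (auto intro: w_support)

lemma fejer_mean_f: "fejer_mean M (galerkin_sol N t) = fejer_sum M (galerkin_coeff N t)"
  using fejer_mean_eq_fejer_sum[OF periodic_borel_f integrable_f, of N t M] w_support[of _ N t]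
  by (auto simp: fourier_coeff_f)

lemma e_galerkin_field:
  assumes "real n * h N \<le> real (Suc N)"
  shows "cmod (galerkin_field \<sigma> (Suc N) (euler_coeff N n) k) \<le> V k"
proof (cases "1 \<le> k \<and> k \<le> int (Suc N)")
  case True
  have "cmod (galerkin_field \<sigma> (Suc N) (euler_coeff N n) k) = real_of_int k / (2 * pi) * cmod (nonlin_form \<sigma> (trig {1..int (Suc N)} (euler_coeff N n)) (\<lambda>x. cis (of_int k * x)))"
    using True by (simp add: galerkin_field_def norm_mult norm_divide)
  also have "\<dots> \<le> \<bar>of_int k\<bar> * (2 * (\<bar>of_int k\<bar> + 1) * (50 + 2 * C))"
  proof (rule mult_mono)
    have "real_of_int k / (2 * pi) \<le> real_of_int k / 1" using True pi_gt3 by (intro divide_left_mono) auto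
    then show "real_of_int k / (2 * pi) \<le> \<bar>of_int k\<bar>" by simp
    show "cmod (nonlin_form \<sigma> (trig {1..int (Suc N)} (euler_coeff N n)) (\<lambda>x. cis (of_int k * x))) \<le> 2 * (\<bar>of_int k\<bar> + 1) * (50 + 2 * C)"
      by (rule norm_nonlin_form_le[OF periodic_borel_trig e_bounds(1,2)[OF assms] C0 chord_lip_cis sigma])
  qed auto
  finally show ?thesis by (simp add: V_def)
next
  case False
  then have "galerkin_field \<sigma> (Suc N) (euler_coeff N n) k = 0" by (simp only: galerkin_field_def if_False)
  then show ?thesis using V0[of k] by simp
qed

lemma e_Suc: "euler_coeff N (Suc n) k = euler_coeff N n k + of_real (h N) * galerkin_field \<sigma> (Suc N) (euler_coeff N n) k"
  by (simp add: euler_coeff_def)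

lemma e_increment:
  assumes "real (n + m) * h N \<le> real (Suc N)"
  shows "cmod (euler_coeff N (n + m) k - euler_coeff N n k) \<le> real m * h N * V k"
  using assms
proof (induction m)
  case (Suc m)
  have nm: "real (n + m) * h N \<le> real (Suc N)" using Suc.prems h0[of N] by (simp add: algebra_simps)
  have "euler_coeff N (n + Suc m) k - euler_coeff N n k = (euler_coeff N (n + m) k - euler_coeff N n k) + of_real (h N) * galerkin_field \<sigma> (Suc N) (euler_coeff N (n + m)) k"
    by (simp add: e_Suc)
  also have "cmod \<dots> \<le> real m * h N * V k + h N * V k"
    using h0[of N] by (intro order_trans[OF norm_triangle_ineq] add_mono Suc.IH nm)
      (auto simp: norm_mult intro!: mult_left_mono e_galerkin_field nm)
  finally show ?case by (simp add: algebra_simps)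
qed simp

text \<open>The interpolated coefficients are Lipschitz in time up to one time step, which is enough for
equicontinuity in the limit.\<close>

lemma w_increment:
  assumes "0 \<le> s" "s \<le> t" "t \<le> real N"
  shows "cmod (galerkin_coeff N t k - galerkin_coeff N s k) \<le> (t - s + h N) * V k"
proof -
  have le: "time_index N s \<le> time_index N t" unfolding time_index_def using assms h0[of N]
    by (intro nat_mono floor_mono divide_right_mono) auto
  then obtain m where m: "time_index N t = time_index N s + m" using le_Suc_ex by blast
  have t0: "0 \<le> t" using assms by simp
  have 1: "real (time_index N s + m) * h N \<le> real (Suc N)"
    using step_bounds(1)[OF t0, of N] assms m by simp
  have "cmod (galerkin_coeff N t k - galerkin_coeff N s k) \<le> real m * h N * V k"
    unfolding galerkin_coeff_def m by (rule e_increment[OF 1])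
  also have "\<dots> \<le> (t - s + h N) * V k"
  proof (rule mult_right_mono[OF _ V0])
    have "real m * h N = real (time_index N t) * h N - real (time_index N s) * h N" by (simp add: m algebra_simps)
    then show "real m * h N \<le> t - s + h N"
      using step_bounds(1)[OF t0, of N] step_bounds(2)[OF assms(1), of N] by linarith
  qed
  finally show ?thesis .
qed

lemma w_increment_abs:
  assumes "0 \<le> s" "0 \<le> t" "s \<le> real N" "t \<le> real N"
  shows "cmod (galerkin_coeff N t k - galerkin_coeff N s k) \<le> (\<bar>t - s\<bar> + h N) * V k"
  using w_increment[of s t N k] w_increment[of t s N k] assms
  by (cases "s \<le> t") (auto simp: norm_minus_commute)

lemma h_tendsto: "h \<longlonglongrightarrow> 0"
proof (rule real_tendsto_sandwich)
  show "eventually (\<lambda>n. 0 \<le> h n) sequentially" using h0 by (intro always_eventually allI less_imp_le)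
  show "eventually (\<lambda>n. h n \<le> 1 / real (Suc n)) sequentially" using h1 by (intro always_eventually allI)
  show "(\<lambda>n. 1 / real (Suc n)) \<longlonglongrightarrow> 0" using LIMSEQ_inverse_real_of_nat by (simp add: inverse_eq_divide)
qed simp

text \<open>A diagonal sequence converges for all modes at all rational times; equicontinuity extends this to
real times.\<close>

lemma limit_coefficients:
  obtains r :: "nat \<Rightarrow> nat" and u :: "real \<Rightarrow> int \<Rightarrow> complex" where "strict_mono r"
    "\<And>t k. 0 \<le> t \<Longrightarrow> (\<lambda>n. galerkin_coeff (r n) t k) \<longlonglongrightarrow> u t k"
proof -
  define F where "F N = (\<lambda>(q, k). if 0 \<le> q \<and> q \<le> real N then galerkin_coeff N q k else 0)" for N
  have cS: "countable (\<rat> \<times> (UNIV :: int set) :: (real \<times> int) set)" by (intro countable_SIGMA countable_rat) auto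
  have "norm (F N x) \<le> C" for N x
    using w_bounds(3) C0 by (cases x) (auto simp: F_def)
  then obtain r where r: "strict_mono r" and conv: "\<And>x. x \<in> \<rat> \<times> (UNIV :: int set) \<Longrightarrow> \<exists>l. (\<lambda>n. F (r n) x) \<longlonglongrightarrow> l"
    using function_convergent_subsequence[OF cS, of F C] by metis
  have "convergent (\<lambda>n. galerkin_coeff (r n) t k)" if t: "0 \<le> t" for t k
  proof (rule Cauchy_convergent, rule CauchyI)
    fix \<epsilon> :: real assume eps: "\<epsilon> > 0"
    define D where "D = V k + 1"
    define \<delta> where "\<delta> = \<epsilon> / (8 * D)"
    have D: "D > 0" "V k \<le> D" using V0[of k] by (auto simp: D_def)
    have d: "\<delta> > 0" using eps D by (simp add: \<delta>_def)
    \<comment> \<open>\<open>\<delta>\<close> is such that the coefficients at \<open>t\<close> and \<open>q\<close> differ by at most \<open>\<epsilon> / 4\<close> once the time step is below \<open>\<delta>\<close>.\<close>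
    obtain q where q: "q \<in> \<rat>" "t < q" "q < t + \<delta>" using Rats_dense_in_real[of t "t + \<delta>"] d by auto
    obtain l where "(\<lambda>n. F (r n) (q, k)) \<longlonglongrightarrow> l" using conv[of "(q, k)"] q by auto
    then have cau: "Cauchy (\<lambda>n. F (r n) (q, k))" by (rule LIMSEQ_imp_Cauchy)
    have "0 < \<epsilon> / 4" using eps by simp
    from CauchyD[OF cau this] obtain N1 where N1: "\<And>m n. m \<ge> N1 \<Longrightarrow> n \<ge> N1 \<Longrightarrow> norm (F (r m) (q, k) - F (r n) (q, k)) < \<epsilon> / 4"
      by blast
    obtain N2 where N2: "\<And>n. n \<ge> N2 \<Longrightarrow> h n < \<delta>"
      using order_tendstoD(2)[OF h_tendsto d] by (auto simp: eventually_sequentially)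
    obtain N3 where N3: "q \<le> real N3" using real_arch_simple by blast
    have near: "cmod (galerkin_coeff (r n) t k - F (r n) (q, k)) \<le> \<epsilon> / 4 \<and> q \<le> real (r n)" if "n \<ge> N2 + N3" for n
    proof -
      have rn: "n \<le> r n" using seq_suble[OF r] .
      have qr: "q \<le> real (r n)" using N3 rn that by linarith
      have "cmod (galerkin_coeff (r n) t k - galerkin_coeff (r n) q k) \<le> (\<bar>t - q\<bar> + h (r n)) * V k"
        by (rule w_increment_abs) (use t q qr in auto)
      also have "\<dots> \<le> (\<delta> + \<delta>) * D"
        using N2[of "r n"] rn that q V0[of k] D h0[of "r n"] by (intro mult_mono) auto
      also have "\<dots> = \<epsilon> / 4" using D(1) by (simp add: \<delta>_def field_simps)
      finally show ?thesis using t q qr by (auto simp: F_def)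
    qed
    have "norm (galerkin_coeff (r m) t k - galerkin_coeff (r n) t k) < \<epsilon>" if "m \<ge> N1 + N2 + N3" "n \<ge> N1 + N2 + N3" for m n
    proof -
      have "galerkin_coeff (r m) t k - galerkin_coeff (r n) t k = (galerkin_coeff (r m) t k - F (r m) (q, k)) + (F (r m) (q, k) - F (r n) (q, k)) - (galerkin_coeff (r n) t k - F (r n) (q, k))"
        by simp
      also have "cmod \<dots> \<le> cmod (galerkin_coeff (r m) t k - F (r m) (q, k)) + cmod (F (r m) (q, k) - F (r n) (q, k)) + cmod (galerkin_coeff (r n) t k - F (r n) (q, k))"
        by (intro order_trans[OF norm_triangle_ineq4] add_right_mono norm_triangle_ineq)
      also have "\<dots> < \<epsilon>" using near[of m] near[of n] N1[of m n] that eps by auto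
      finally show ?thesis .
    qed
    then show "\<exists>N. \<forall>m\<ge>N. \<forall>n\<ge>N. norm (galerkin_coeff (r m) t k - galerkin_coeff (r n) t k) < \<epsilon>" by blast
  qed
  then have "\<And>t k. 0 \<le> t \<Longrightarrow> (\<lambda>n. galerkin_coeff (r n) t k) \<longlonglongrightarrow> lim (\<lambda>n. galerkin_coeff (r n) t k)" by (simp add: convergent_LIMSEQ_iff)
  with r show thesis by (rule that)
qed

end

locale galerkin_limit = galerkin_scheme +
  fixes r :: "nat \<Rightarrow> nat" and u :: "real \<Rightarrow> int \<Rightarrow> complex"
  assumes r: "strict_mono r" and lim: "\<And>t k. 0 \<le> t \<Longrightarrow> (\<lambda>n. galerkin_coeff (r n) t k) \<longlonglongrightarrow> u t k"
begin

lemma eventually_le_subseq: "eventually (\<lambda>n. t \<le> real (r n)) sequentially"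
proof -
  obtain N where "t \<le> real N" using real_arch_simple by blast
  then show ?thesis using seq_suble[OF r] by (intro eventually_sequentiallyI[of N]) (meson of_nat_le_iff order_trans)
qed

lemma u_pos:
  assumes "0 \<le> t" "k < 1"
  shows "u t k = 0"
proof -
  have "galerkin_coeff (r n) t k = 0" for n using assms by (intro w_support) auto
  then show ?thesis using lim[OF assms(1), of k] by (simp add: LIMSEQ_const_iff)
qed

lemma u_bound:
  assumes "0 \<le> t"
  shows "cmod (u t k) \<le> C"
  by (rule tendsto_upperbound[OF tendsto_norm[OF lim[OF assms]]])
     (use eventually_mono[OF eventually_le_subseq w_bounds(3)[OF assms]] in auto)

lemma u_lipschitz:
  assumes "0 \<le> s" "0 \<le> t"
  shows "cmod (u t k - u s k) \<le> \<bar>t - s\<bar> * V k"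
proof -
  have 1: "(\<lambda>n. cmod (galerkin_coeff (r n) t k - galerkin_coeff (r n) s k)) \<longlonglongrightarrow> cmod (u t k - u s k)"
    by (intro tendsto_intros lim assms)
  have hr: "(\<lambda>n. h (r n)) \<longlonglongrightarrow> 0" using LIMSEQ_subseq_LIMSEQ[OF h_tendsto r] by (simp add: comp_def)
  have 2: "(\<lambda>n. (\<bar>t - s\<bar> + h (r n)) * V k) \<longlonglongrightarrow> (\<bar>t - s\<bar> + 0) * V k"
    by (intro tendsto_intros hr)
  have "eventually (\<lambda>n. cmod (galerkin_coeff (r n) t k - galerkin_coeff (r n) s k) \<le> (\<bar>t - s\<bar> + h (r n)) * V k) sequentially"
    using eventually_le_subseq[of s] eventually_le_subseq[of t] by eventually_elim (rule w_increment_abs[OF assms])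
  from tendsto_le[OF _ 2 1 this] show ?thesis by simp
qed

lemma fejer_sum_lim:
  assumes "0 \<le> t"
  shows "(\<lambda>n. fejer_sum M (galerkin_coeff (r n) t) x) \<longlonglongrightarrow> fejer_sum M (u t) x"
  unfolding fejer_sum_def trig_def by (intro tendsto_intros lim assms)

text \<open>The energy bound passes to the limit for each Fejer sum separately, as these depend on finitely many
coefficients.\<close>

lemma u_spectrum:
  assumes t: "0 \<le> t"
  shows "bounded_spectrum (u t) C"
proof
  fix M :: nat assume M: "M > 0"
  show "W_energy (fejer_sum M (u t)) \<le> ennreal C"
  proof (rule W_energy_fatou)
    show "AE x in circle. (\<lambda>n. fejer_sum M (galerkin_coeff (r n) t) x) \<longlonglongrightarrow> fejer_sum M (u t) x"
      by (intro AE_I2 fejer_sum_lim t)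
    show "eventually (\<lambda>n. W_energy (fejer_sum M (galerkin_coeff (r n) t)) \<le> ennreal C) sequentially"
      using eventually_le_subseq[of t]
    proof eventually_elim
      case (elim n)
      have "W_energy (fejer_mean M (galerkin_sol (r n) t)) \<le> W_energy (galerkin_sol (r n) t)" by (rule fejer_mean_W_energy) (auto simp: M)
      also have "\<dots> \<le> ennreal C" by (rule w_bounds(1)[OF t elim])
      finally show ?case by (simp add: fejer_mean_f)
    qed
  qed simp
qed (use u_pos t C0 in auto)

text \<open>Compactness: replacing a function by its Fejer mean of order \<open>M\<close> costs \<open>O(1 / M)\<close> uniformly in \<open>n\<close>, and
for fixed \<open>M\<close> only finitely many coefficients have to converge. The shift by \<open>n0\<close> discards the
approximations that are not defined up to time \<open>t\<close>.\<close>

lemma strong_convergence: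
  assumes t: "0 \<le> t"
  obtains n0 B where "\<And>n. t \<le> real (r (n + n0))" "\<And>n. 0 \<le> B n" "B \<longlonglongrightarrow> 0"
    "\<And>n. L4 (\<lambda>x. galerkin_sol (r (n + n0)) t x - fejer_limit (u t) x) \<le> ennreal (B n)"
proof -
  interpret bounded_spectrum "u t" C by (rule u_spectrum[OF t])
  obtain n0 where n0: "\<And>n. n \<ge> n0 \<Longrightarrow> t \<le> real (r n)" using eventually_le_subseq[of t] by (auto simp: eventually_sequentially)
  define R where "R n = r (n + n0)" for n
  have tR: "t \<le> real (R n)" for n unfolding R_def by (rule n0) simp
  define X where "X M n = (\<Sum>k\<in>{1..<int M}. cmod (of_real (1 - of_int k / real M) * (galerkin_coeff (R n) t k - u t k)))" for M n
  have main: "L4 (\<lambda>x. galerkin_sol (R n) t x - fejer_limit (u t) x) \<le> ennreal (72 * (C / (pi * real M)) + 512 * X M n ^ 4)"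
    if M: "M > 0" for M n
  proof -
    have X0: "0 \<le> X M n" by (simp add: X_def sum_nonneg)
    have 1: "L4 (\<lambda>x. galerkin_sol (R n) t x - fejer_sum M (galerkin_coeff (R n) t) x) \<le> ennreal (C / (pi * real M))"
    proof -
      have "L4 (\<lambda>x. fejer_sum M (galerkin_coeff (R n) t) x - galerkin_sol (R n) t x) \<le> ennreal (1 / (pi * real M)) * W_energy (galerkin_sol (R n) t)"
        using fejer_mean_L4_error[OF periodic_borel_f integrable_f M] by (simp add: fejer_mean_f)
      also have "\<dots> \<le> ennreal (1 / (pi * real M)) * ennreal C"
        by (intro mult_left_mono w_bounds(1) t tR) auto
      also have "\<dots> = ennreal (C / (pi * real M))" using C0 by (simp add: ennreal_mult[symmetric])
      finally show ?thesis by (simp only: L4_minus_commute)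
    qed
    have 2: "L4 (\<lambda>x. fejer_sum M (galerkin_coeff (R n) t) x - fejer_sum M (u t) x) \<le> ennreal (8 * X M n ^ 4)"
    proof (rule L4_bounded)
      fix x
      have eq: "fejer_sum M (galerkin_coeff (R n) t) x - fejer_sum M (u t) x
        = (\<Sum>k\<in>{1..<int M}. of_real (1 - of_int k / real M) * (galerkin_coeff (R n) t k - u t k) * cis (of_int k * x))"
        unfolding fejer_sum_def trig_def sum_subtractf[symmetric] by (intro sum.cong) (auto simp: algebra_simps)
      have "cmod (fejer_sum M (galerkin_coeff (R n) t) x - fejer_sum M (u t) x)
        \<le> (\<Sum>k\<in>{1..<int M}. cmod (of_real (1 - of_int k / real M) * (galerkin_coeff (R n) t k - u t k) * cis (of_int k * x)))"
        unfolding eq by (rule norm_sum)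
      also have "\<dots> = X M n" unfolding X_def by (intro sum.cong refl) (simp only: norm_mult norm_cis mult_1_right)
      finally show "cmod (fejer_sum M (galerkin_coeff (R n) t) x - fejer_sum M (u t) x) \<le> X M n" .
    qed
    have 3: "L4 (\<lambda>x. fejer_sum M (u t) x - fejer_limit (u t) x) \<le> ennreal (C / (pi * real M))"
      by (rule L4_fejer_limit_error[OF M])
    have 4: "L4 (\<lambda>x. fejer_sum M (galerkin_coeff (R n) t) x - fejer_limit (u t) x) \<le> ennreal (8 * (8 * X M n ^ 4 + C / (pi * real M)))"
      by (rule L4_diff[OF _ _ _ 2 3]) (use C0 periodic_borel_fejer_limit in auto)
    have "L4 (\<lambda>x. galerkin_sol (R n) t x - fejer_limit (u t) x) \<le> ennreal (8 * (C / (pi * real M) + 8 * (8 * X M n ^ 4 + C / (pi * real M))))"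
      by (rule L4_diff[OF _ _ _ 1 4]) (use C0 periodic_borel_fejer_limit X0 in auto)
    then show ?thesis by (simp add: algebra_simps)
  qed
  define B where "B n = enn2real (L4 (\<lambda>x. galerkin_sol (R n) t x - fejer_limit (u t) x))" for n
  have fin: "L4 (\<lambda>x. galerkin_sol (R n) t x - fejer_limit (u t) x) < top" for n
    using main[of 1 n] by (auto intro: le_less_trans)
  have B: "L4 (\<lambda>x. galerkin_sol (R n) t x - fejer_limit (u t) x) = ennreal (B n)" for n
    unfolding B_def using fin[of n] by simp
  have B0: "0 \<le> B n" for n by (simp add: B_def)
  have "B \<longlonglongrightarrow> 0"
  proof (rule LIMSEQ_I)
    fix \<epsilon> :: real assume eps: "\<epsilon> > 0"
    have "(\<lambda>M. 72 * C / pi * inverse (real (Suc M))) \<longlonglongrightarrow> 0"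
      using tendsto_mult_right_zero[OF LIMSEQ_inverse_real_of_nat] by blast
    then have "eventually (\<lambda>M. 72 * C / pi * inverse (real (Suc M)) < \<epsilon> / 2) sequentially"
      using eps by (intro order_tendstoD(2)[of _ 0]) auto
    then obtain M where M: "72 * C / pi * inverse (real (Suc M)) < \<epsilon> / 2"
      by (auto simp: eventually_sequentially)
    have "(\<lambda>n. galerkin_coeff (R n) t k) \<longlonglongrightarrow> u t k" for k
      unfolding R_def by (rule LIMSEQ_ignore_initial_segment[OF lim[OF t]])
    then have "(\<lambda>n. 512 * X (Suc M) n ^ 4) \<longlonglongrightarrow> 512 * (\<Sum>k\<in>{1..<int (Suc M)}. cmod (of_real (1 - of_int k / real (Suc M)) * (u t k - u t k))) ^ 4"
      unfolding X_def by (intro tendsto_intros)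
    then have "(\<lambda>n. 512 * X (Suc M) n ^ 4) \<longlonglongrightarrow> 0" by simp
    then have "eventually (\<lambda>n. 512 * X (Suc M) n ^ 4 < \<epsilon> / 2) sequentially"
      using eps by (intro order_tendstoD(2)[of _ 0]) auto
    then obtain N where N: "\<And>n. n \<ge> N \<Longrightarrow> 512 * X (Suc M) n ^ 4 < \<epsilon> / 2" by (auto simp: eventually_sequentially)
    have "norm (B n - 0) < \<epsilon>" if "n \<ge> N" for n
    proof -
      have "0 \<le> X (Suc M) n" by (simp add: X_def sum_nonneg)
      then have "0 \<le> 72 * (C / (pi * real (Suc M))) + 512 * X (Suc M) n ^ 4" using C0 by simp
      moreover have "ennreal (B n) \<le> ennreal (72 * (C / (pi * real (Suc M))) + 512 * X (Suc M) n ^ 4)"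
        unfolding B[symmetric] by (rule main) simp
      ultimately have "B n \<le> 72 * (C / (pi * real (Suc M))) + 512 * X (Suc M) n ^ 4"
        by (simp only: ennreal_le_iff)
      also have "72 * (C / (pi * real (Suc M))) = 72 * C / pi * inverse (real (Suc M))" by (simp add: field_simps)
      finally show ?thesis using M N[OF that] B0[of n] by simp
    qed
    then show "\<exists>no. \<forall>n\<ge>no. norm (B n - 0) < \<epsilon>" by blast
  qed
  with tR B0 B show thesis unfolding R_def by (intro that[of n0 B]) auto
qed

lemma nonlin_form_lim:
  assumes t: "0 \<le> t"
  shows "(\<lambda>n. nonlin_form \<sigma> (galerkin_sol (r n) t) (\<lambda>x. cis (of_int k * x))) \<longlonglongrightarrow> nonlin_form \<sigma> (fejer_limit (u t)) (\<lambda>x. cis (of_int k * x))"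
proof -
  interpret bounded_spectrum "u t" C by (rule u_spectrum[OF t])
  obtain n0 B where n0: "\<And>n. t \<le> real (r (n + n0))" and B: "\<And>n. 0 \<le> B n" "B \<longlonglongrightarrow> 0"
    "\<And>n. L4 (\<lambda>x. galerkin_sol (r (n + n0)) t x - fejer_limit (u t) x) \<le> ennreal (B n)"
    using strong_convergence[OF t] by blast
  have "(\<lambda>n. nonlin_form \<sigma> (galerkin_sol (r (n + n0)) t) (\<lambda>x. cis (of_int k * x))) \<longlonglongrightarrow> nonlin_form \<sigma> (fejer_limit (u t)) (\<lambda>x. cis (of_int k * x))"
    by (rule nonlin_form_tendsto[OF _ _ _ periodic_borel_fejer_limit W_energy_fejer_limit L4_fejer_limit C0 B(3,1,2) chord_lip_cis])
       (use w_bounds[OF t n0] in auto)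
  then show ?thesis by (rule LIMSEQ_offset)
qed

text \<open>Extended by zero to negative times, so that it is a Borel function on the line.\<close>

definition galerkin_field_lim :: "int \<Rightarrow> real \<Rightarrow> complex" where
  "galerkin_field_lim k s = (if 0 \<le> s then \<i> * of_int k / (2 * of_real pi) * nonlin_form \<sigma> (fejer_limit (u s)) (\<lambda>x. cis (of_int k * x)) else 0)"

lemma measurable_step: "(\<lambda>s. g (time_index N s) :: complex) \<in> borel_measurable borel"
proof -
  have "(\<lambda>s. time_index N s) \<in> borel \<rightarrow>\<^sub>M count_space UNIV" unfolding time_index_def by measurable
  then show ?thesis by (rule measurable_compose) simp
qed

lemma galerkin_field_lim_tendsto:
  assumes "0 \<le> s" "1 \<le> k"
  shows "(\<lambda>n. galerkin_field \<sigma> (Suc (r n)) (galerkin_coeff (r n) s) k) \<longlonglongrightarrow> galerkin_field_lim k s"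
proof -
  have "(\<lambda>n. \<i> * of_int k / (2 * of_real pi) * nonlin_form \<sigma> (galerkin_sol (r n) s) (\<lambda>x. cis (of_int k * x))) \<longlonglongrightarrow> galerkin_field_lim k s"
    unfolding galerkin_field_lim_def using assms by (auto intro!: tendsto_intros nonlin_form_lim)
  moreover have "eventually (\<lambda>n. \<i> * of_int k / (2 * of_real pi) * nonlin_form \<sigma> (galerkin_sol (r n) s) (\<lambda>x. cis (of_int k * x)) = galerkin_field \<sigma> (Suc (r n)) (galerkin_coeff (r n) s) k) sequentially"
    using eventually_le_subseq[of "of_int k"]
  proof eventually_elim
    case (elim n)
    then have "k \<le> int (Suc (r n))" by linarith
    then show ?case using assms(2) by (simp add: galerkin_field_def galerkin_sol_def)
  qed
  ultimately show ?thesis by (rule Lim_transform_eventually)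
qed

lemma galerkin_field_lim_measurable:
  assumes "1 \<le> k"
  shows "galerkin_field_lim k \<in> borel_measurable borel"
proof (rule borel_measurable_LIMSEQ_metric)
  fix n
  have [measurable]: "(\<lambda>s. galerkin_field \<sigma> (Suc (r n)) (galerkin_coeff (r n) s) k) \<in> borel_measurable borel"
    unfolding galerkin_coeff_def by (rule measurable_step[of "\<lambda>m. galerkin_field \<sigma> (Suc (r n)) (euler_coeff (r n) m) k"])
  show "(\<lambda>s. indicator {0..} s * galerkin_field \<sigma> (Suc (r n)) (galerkin_coeff (r n) s) k) \<in> borel_measurable borel" by measurable
next
  fix s :: real
  show "(\<lambda>n. indicator {0..} s * galerkin_field \<sigma> (Suc (r n)) (galerkin_coeff (r n) s) k) \<longlonglongrightarrow> galerkin_field_lim k s"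
  proof (cases "0 \<le> s")
    case True
    then show ?thesis using galerkin_field_lim_tendsto[OF True assms] by simp
  qed (simp add: galerkin_field_lim_def)
qed

lemma w_galerkin_field_bound:
  assumes "0 \<le> s" "s \<le> real N"
  shows "cmod (galerkin_field \<sigma> (Suc N) (galerkin_coeff N s) k) \<le> V k"
  unfolding galerkin_coeff_def by (rule e_galerkin_field) (use step_bounds(1)[of s N] assms in simp)

lemma galerkin_field_lim_bound: "1 \<le> k \<Longrightarrow> cmod (galerkin_field_lim k s) \<le> V k"
proof (cases "0 \<le> s")
  case True
  assume "1 \<le> k"
  show ?thesis
    by (rule tendsto_upperbound[OF tendsto_norm[OF galerkin_field_lim_tendsto[OF True \<open>1 \<le> k\<close>]]])
       (use eventually_mono[OF eventually_le_subseq w_galerkin_field_bound[OF True]] in auto)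
qed (simp add: galerkin_field_lim_def V0)

lemma e_integral:
  "euler_coeff N n k = euler_coeff N 0 k + (LINT s|lborel. indicator {0..<real n * h N} s * galerkin_field \<sigma> (Suc N) (galerkin_coeff N s) k)"
  "integrable lborel (\<lambda>s. indicator {0..<real n * h N} s * galerkin_field \<sigma> (Suc N) (galerkin_coeff N s) k)"
proof (induction n)
  case (Suc n)
  let ?v = "galerkin_field \<sigma> (Suc N) (euler_coeff N n) k"
  have h: "0 < h N" by (rule h0)
  have split: "indicator {0..<real (Suc n) * h N} s * galerkin_field \<sigma> (Suc N) (galerkin_coeff N s) k
    = indicator {0..<real n * h N} s * galerkin_field \<sigma> (Suc N) (galerkin_coeff N s) k + indicator {real n * h N..<real (Suc n) * h N} s *\<^sub>R ?v" for s
  proof (cases "real n * h N \<le> s \<and> s < real (Suc n) * h N")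
    case True
    then have "real n \<le> s / h N" "s / h N < real n + 1" using h by (auto simp: field_simps)
    then have "\<lfloor>s / h N\<rfloor> = int n" by linarith
    then have "galerkin_coeff N s = euler_coeff N n" by (simp add: galerkin_coeff_def time_index_def)
    moreover have "0 \<le> s" using True h by (meson mult_nonneg_nonneg of_nat_0_le_iff less_imp_le order_trans)
    ultimately show ?thesis using True by (auto simp: indicator_def)
  next
    case False
    moreover have "real n * h N \<le> real (Suc n) * h N" using h by simp
    ultimately show ?thesis by (auto simp: indicator_def)
  qed
  have i: "integrable lborel (\<lambda>s. indicator {real n * h N..<real (Suc n) * h N} s *\<^sub>R ?v)"
    by (rule integrable_scaleR_left) (use finite_lborel_Ico in \<open>auto simp: integrable_indicator_iff\<close>)
  have v: "(LINT s|lborel. indicator {real n * h N..<real (Suc n) * h N} s *\<^sub>R ?v) = of_real (h N) * ?v"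
    using h by (subst integral_scaleR_left) (auto simp: integrable_indicator_iff scaleR_conv_of_real algebra_simps)
  show "integrable lborel (\<lambda>s. indicator {0..<real (Suc n) * h N} s * galerkin_field \<sigma> (Suc N) (galerkin_coeff N s) k)"
    unfolding split using Suc.IH(2) i by (rule Bochner_Integration.integrable_add)
  show "euler_coeff N (Suc n) k = euler_coeff N 0 k + (LINT s|lborel. indicator {0..<real (Suc n) * h N} s * galerkin_field \<sigma> (Suc N) (galerkin_coeff N s) k)"
    unfolding split Bochner_Integration.integral_add[OF Suc.IH(2) i] v e_Suc using Suc.IH(1) by simp
qed auto

text \<open>The Euler scheme is the integrated equation up to the last time grid point, which tends to \<open>t\<close>; the
integrands converge pointwise and are bounded by \<open>V k\<close>.\<close>

lemma u_integral:
  assumes t: "0 \<le> t" and k: "1 \<le> k"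
  shows "u t k = c k + (LINT s|lborel. indicator {0..<t} s * galerkin_field_lim k s)"
proof -
  let ?\<tau> = "\<lambda>n. real (time_index (r n) t) * h (r n)"
  have tau: "?\<tau> \<longlonglongrightarrow> t"
  proof (rule real_tendsto_sandwich)
    have hr: "(\<lambda>n. h (r n)) \<longlonglongrightarrow> 0" using LIMSEQ_subseq_LIMSEQ[OF h_tendsto r] by (simp add: comp_def)
    show "(\<lambda>n. t - h (r n)) \<longlonglongrightarrow> t" using tendsto_diff[OF tendsto_const hr, of t] by simp
    show "eventually (\<lambda>n. t - h (r n) \<le> ?\<tau> n) sequentially"
      using step_bounds(2)[OF t] by (intro always_eventually allI) (simp add: less_imp_le algebra_simps)
    show "eventually (\<lambda>n. ?\<tau> n \<le> t) sequentially" using step_bounds(1)[OF t] by simp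
  qed simp
  obtain n0 where n0: "\<And>n. n \<ge> n0 \<Longrightarrow> t \<le> real (r n)" using eventually_le_subseq[of t] by (auto simp: eventually_sequentially)
  have "(\<lambda>n. LINT s|lborel. indicator {0..<?\<tau> (n + n0)} s * galerkin_field \<sigma> (Suc (r (n + n0))) (galerkin_coeff (r (n + n0)) s) k)
     \<longlonglongrightarrow> (LINT s|lborel. indicator {0..<t} s * galerkin_field_lim k s)"
  proof (rule integral_dominated_convergence)
    have [measurable]: "galerkin_field_lim k \<in> borel_measurable borel" by (rule galerkin_field_lim_measurable[OF k])
    have "(\<lambda>s. indicator {0..<t} s * galerkin_field_lim k s) \<in> borel_measurable borel" by measurable
    then show "(\<lambda>s. indicator {0..<t} s * galerkin_field_lim k s) \<in> borel_measurable lborel" by simp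
    show "(\<lambda>s. indicator {0..<?\<tau> (n + n0)} s * galerkin_field \<sigma> (Suc (r (n + n0))) (galerkin_coeff (r (n + n0)) s) k) \<in> borel_measurable lborel" for n
      using e_integral(2) by (rule borel_measurable_integrable)
    show "integrable lborel (\<lambda>s. indicator {0..t} s *\<^sub>R V k)"
      by (rule integrable_scaleR_left) (use finite_lborel_Ico in \<open>auto simp: integrable_indicator_iff\<close>)
    show "AE s in lborel. (\<lambda>n. indicator {0..<?\<tau> (n + n0)} s * galerkin_field \<sigma> (Suc (r (n + n0))) (galerkin_coeff (r (n + n0)) s) k) \<longlonglongrightarrow> indicator {0..<t} s * galerkin_field_lim k s"
      using AE_lborel_singleton[of t]
    proof eventually_elim
      case (elim s)
      have tau': "(\<lambda>n. ?\<tau> (n + n0)) \<longlonglongrightarrow> t" by (rule LIMSEQ_ignore_initial_segment[OF tau])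
      show ?case
      proof (cases "0 \<le> s \<and> s < t")
        case True
        have "eventually (\<lambda>n. s < ?\<tau> (n + n0)) sequentially" using order_tendstoD(1)[OF tau'] True by blast
        then have "eventually (\<lambda>n. galerkin_field \<sigma> (Suc (r (n + n0))) (galerkin_coeff (r (n + n0)) s) k = indicator {0..<?\<tau> (n + n0)} s * galerkin_field \<sigma> (Suc (r (n + n0))) (galerkin_coeff (r (n + n0)) s) k) sequentially"
          by eventually_elim (use True in simp)
        moreover have "(\<lambda>n. galerkin_field \<sigma> (Suc (r (n + n0))) (galerkin_coeff (r (n + n0)) s) k) \<longlonglongrightarrow> galerkin_field_lim k s"
          by (rule LIMSEQ_ignore_initial_segment[OF galerkin_field_lim_tendsto]) (use True k in auto)
        ultimately show ?thesis using True by (auto intro: Lim_transform_eventually)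
      next
        case False
        have "\<not> (0 \<le> s \<and> s < ?\<tau> (n + n0))" for n
          using False elim step_bounds(1)[OF t, of "r (n + n0)"] by auto
        then have "indicator {0..<?\<tau> (n + n0)} s = (0::complex)" for n by (simp add: indicator_def)
        moreover have "indicator {0..<t} s = (0::complex)" using False by (simp add: indicator_def)
        ultimately show ?thesis by (simp only: mult_zero_left tendsto_const)
      qed
    qed
    show "AE s in lborel. norm (indicator {0..<?\<tau> (n + n0)} s * galerkin_field \<sigma> (Suc (r (n + n0))) (galerkin_coeff (r (n + n0)) s) k) \<le> indicator {0..t} s *\<^sub>R V k" for n
    proof (intro AE_I2)
      fix s
      show "norm (indicator {0..<?\<tau> (n + n0)} s * galerkin_field \<sigma> (Suc (r (n + n0))) (galerkin_coeff (r (n + n0)) s) k) \<le> indicator {0..t} s *\<^sub>R V k"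
      proof (cases "0 \<le> s \<and> s < ?\<tau> (n + n0)")
        case True
        then have "s \<le> t" using step_bounds(1)[OF t, of "r (n + n0)"] by linarith
        moreover have "t \<le> real (r (n + n0))" by (rule n0) simp
        ultimately show ?thesis using True w_galerkin_field_bound[of s "r (n + n0)" k] by (simp add: indicator_def)
      next
        case False
        then show ?thesis using V0[of k] by (auto simp: indicator_def)
      qed
    qed
  qed
  moreover have "(LINT s|lborel. indicator {0..<?\<tau> (n + n0)} s * galerkin_field \<sigma> (Suc (r (n + n0))) (galerkin_coeff (r (n + n0)) s) k) = galerkin_coeff (r (n + n0)) t k - euler_coeff (r (n + n0)) 0 k" for n
    using e_integral(1)[of "r (n + n0)" "time_index (r (n + n0)) t" k] by (simp add: galerkin_coeff_def)
  ultimately have "(\<lambda>n. galerkin_coeff (r (n + n0)) t k - euler_coeff (r (n + n0)) 0 k) \<longlonglongrightarrow> (LINT s|lborel. indicator {0..<t} s * galerkin_field_lim k s)"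
    by simp
  moreover have "(\<lambda>n. galerkin_coeff (r (n + n0)) t k - euler_coeff (r (n + n0)) 0 k) \<longlonglongrightarrow> u t k - c k"
  proof (intro tendsto_intros LIMSEQ_ignore_initial_segment[OF lim[OF t]])
    have "(\<lambda>M. fourier_coeff (fejer_sum M c) k) \<longlonglongrightarrow> c k" by (rule fourier_coeff_fejer_sum_tendsto[OF c_pos])
    then have "(\<lambda>N. euler_coeff N 0 k) \<longlonglongrightarrow> c k"
      unfolding euler_coeff_def euler.simps by (intro LIMSEQ_Suc)
    then have "((\<lambda>N. euler_coeff N 0 k) \<circ> r) \<longlonglongrightarrow> c k" by (rule LIMSEQ_subseq_LIMSEQ[OF _ r])
    then show "(\<lambda>n. euler_coeff (r (n + n0)) 0 k) \<longlonglongrightarrow> c k"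
      unfolding comp_def by (rule LIMSEQ_ignore_initial_segment)
  qed
  ultimately have "u t k - c k = (LINT s|lborel. indicator {0..<t} s * galerkin_field_lim k s)" by (rule LIMSEQ_unique[rotated])
  then show ?thesis by (simp add: algebra_simps)
qed

end

text \<open>The integrated equation for each Fourier coefficient, together with the bounds on which the passage to
the weak formulation depends.\<close>

locale mode_solution =
  fixes \<sigma> :: real and c :: "int \<Rightarrow> complex" and C :: real and V :: "int \<Rightarrow> real"
    and u :: "real \<Rightarrow> int \<Rightarrow> complex" and G :: "int \<Rightarrow> real \<Rightarrow> complex"
  assumes sigma: "\<bar>\<sigma>\<bar> \<le> 1" and C0: "0 \<le> C"
    and spectrum: "\<And>t. 0 \<le> t \<Longrightarrow> bounded_spectrum (u t) C"
    and u_bound: "\<And>t k. 0 \<le> t \<Longrightarrow> cmod (u t k) \<le> C"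
    and u_lipschitz: "\<And>s t k. 0 \<le> s \<Longrightarrow> 0 \<le> t \<Longrightarrow> cmod (u t k - u s k) \<le> \<bar>t - s\<bar> * V k"
    and V0: "\<And>k. 0 \<le> V k"
    and G_meas: "\<And>k. 1 \<le> k \<Longrightarrow> G k \<in> borel_measurable borel"
    and G_bound: "\<And>k t. 1 \<le> k \<Longrightarrow> cmod (G k t) \<le> V k"
    and G_eq: "\<And>k t. 0 \<le> t \<Longrightarrow> G k t = \<i> * of_int k / (2 * of_real pi) * nonlin_form \<sigma> (fejer_limit (u t)) (\<lambda>x. cis (of_int k * x))"
    and u_integral: "\<And>k t. 0 \<le> t \<Longrightarrow> 1 \<le> k \<Longrightarrow> u t k = c k + (LINT s|lborel. indicator {0..<t} s * G k s)"

lemma mode_solution_exists: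
  assumes s: "0 \<le> \<sigma>" "\<sigma> \<le> 1" and C: "0 \<le> C" and pos: "\<And>k. k < 1 \<Longrightarrow> c k = 0"
    and bd: "\<And>M. M > 0 \<Longrightarrow> W_energy (fejer_sum M c) \<le> ennreal C"
  shows "\<exists>C' V u G. mode_solution \<sigma> c C' V u G"
proof -
  obtain C' where C': "C' \<ge> 0" and ex: "\<And>N. N \<ge> 1 \<Longrightarrow> \<exists>h>0. h \<le> 1 / real N \<and>
    (\<forall>n. real n * h \<le> real N \<longrightarrow> (let a = euler \<sigma> N h (fourier_coeff (fejer_sum (Suc N) c)) n in
      W_energy (trig {1..int N} a) \<le> ennreal C' \<and> L4 (trig {1..int N} a) \<le> ennreal C' \<and> (\<forall>k. cmod (a k) \<le> C')))"
    using galerkin[OF s C bd] by blast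
  have "\<exists>h. \<forall>N. h N > 0 \<and> h N \<le> 1 / real (Suc N) \<and>
    (\<forall>n. real n * h N \<le> real (Suc N) \<longrightarrow> (let a = euler \<sigma> (Suc N) (h N) (fourier_coeff (fejer_sum (Suc (Suc N)) c)) n in
      W_energy (trig {1..int (Suc N)} a) \<le> ennreal C' \<and> L4 (trig {1..int (Suc N)} a) \<le> ennreal C' \<and> (\<forall>k. cmod (a k) \<le> C')))"
  proof (rule choice, rule allI)
    fix N
    show "\<exists>h. h > 0 \<and> h \<le> 1 / real (Suc N) \<and>
      (\<forall>n. real n * h \<le> real (Suc N) \<longrightarrow> (let a = euler \<sigma> (Suc N) h (fourier_coeff (fejer_sum (Suc (Suc N)) c)) n in
      W_energy (trig {1..int (Suc N)} a) \<le> ennreal C' \<and> L4 (trig {1..int (Suc N)} a) \<le> ennreal C' \<and> (\<forall>k. cmod (a k) \<le> C')))"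
      by (rule ex) simp
  qed
  then obtain h where h: "\<And>N. h N > 0 \<and> h N \<le> 1 / real (Suc N) \<and>
    (\<forall>n. real n * h N \<le> real (Suc N) \<longrightarrow> (let a = euler \<sigma> (Suc N) (h N) (fourier_coeff (fejer_sum (Suc (Suc N)) c)) n in
      W_energy (trig {1..int (Suc N)} a) \<le> ennreal C' \<and> L4 (trig {1..int (Suc N)} a) \<le> ennreal C' \<and> (\<forall>k. cmod (a k) \<le> C')))"
    by blast
  interpret galerkin_scheme \<sigma> c C' h
    by unfold_locales (use s pos C' h in auto)
  obtain r u where "strict_mono r" "\<And>t k. 0 \<le> t \<Longrightarrow> (\<lambda>n. galerkin_coeff (r n) t k) \<longlonglongrightarrow> u t k"
    using limit_coefficients by blast
  then interpret galerkin_limit \<sigma> c C' h r u by unfold_locales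
  have "mode_solution \<sigma> c C' V u galerkin_field_lim"
  proof (rule mode_solution.intro)
    show "galerkin_field_lim k t = \<i> * of_int k / (2 * of_real pi) * nonlin_form \<sigma> (fejer_limit (u t)) (\<lambda>x. cis (of_int k * x))" if "0 \<le> t" for k t
      using that by (simp add: galerkin_field_lim_def)
  qed (fact sigma C' u_spectrum u_bound u_lipschitz V0 galerkin_field_lim_measurable galerkin_field_lim_bound u_integral)+
  then show ?thesis by blast
qed

section \<open>Borel representatives and membership in the function space\<close>

text \<open>A Borel function that agrees with \<open>f\<close> almost everywhere on one period is extended periodically.\<close>

lemma borel_representative:
  assumes per: "periodic_2pi f" and m: "f \<in> borel_measurable torus_measure"
  shows "\<exists>g. periodic_borel g \<and> (AE x in circle. g x = f x)"
proof -
  define S where "S = {0..2 * pi}"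
  have fm: "(\<lambda>x. if x \<in> S then f x else 0) \<in> borel_measurable lebesgue"
    using m unfolding S_def by (subst borel_measurable_if) auto
  have "(\<lambda>x. Re (if x \<in> S then f x else 0)) \<in> borel_measurable (completion lborel)"
    "(\<lambda>x. Im (if x \<in> S then f x else 0)) \<in> borel_measurable (completion lborel)"
    using fm by measurable
  from this[THEN completion_ex_borel_measurable_real]
  obtain a b where ab: "a \<in> borel_measurable lborel" "AE x in lborel. Re (if x \<in> S then f x else 0) = a x"
    "b \<in> borel_measurable lborel" "AE x in lborel. Im (if x \<in> S then f x else 0) = b x"
    by blast
  define v where "v x = Complex (a (period_rep x)) (b (period_rep x))" for x
  have [measurable]: "a \<in> borel_measurable borel" "b \<in> borel_measurable borel" using ab by auto
  have "v = (\<lambda>x. of_real (a (period_rep x)) + \<i> * of_real (b (period_rep x)))"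
    by (rule ext) (simp add: v_def complex_eq_iff)
  then have "v \<in> borel_measurable borel" by simp
  then have "periodic_borel v" by (simp add: periodic_borel_def periodic_2pi_def v_def period_rep_plus)
  moreover have "AE x in circle. v x = f x"
  proof -
    have "AE x in lborel. x \<noteq> 2 * pi" by (rule AE_lborel_singleton)
    with ab(2,4) have "AE x in lborel. x \<in> S \<longrightarrow> v x = f x"
    proof eventually_elim
      case (elim x)
      show ?case
      proof
        assume x: "x \<in> S"
        then have "period_rep x = x" using elim by (intro period_rep_id) (auto simp: S_def)
        then show "v x = f x" using elim x by (simp add: v_def complex_eq_iff)
      qed
    qed
    then have "AE x in lebesgue. x \<in> S \<longrightarrow> v x = f x" by (rule AE_completion)
    then show ?thesis unfolding circle_def S_def by (subst AE_restrict_space_iff) auto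
  qed
  ultimately show ?thesis by blast
qed

lemma W_norm_pow4_cong_AE:
  assumes "AE x in circle. g x = f x"
  shows "W_norm_pow4 g = W_norm_pow4 f"
proof -
  have 1: "(\<integral>\<^sup>+x. ennreal (cmod (g x) ^ 4) \<partial>circle) = (\<integral>\<^sup>+x. ennreal (cmod (f x) ^ 4) \<partial>circle)"
    by (rule nn_integral_cong_AE) (use assms in \<open>eventually_elim, simp\<close>)
  have 2: "(\<integral>\<^sup>+x. ennreal (cmod (g x - z) ^ 4 / (1 - cos (x - y))) \<partial>circle)
    = (\<integral>\<^sup>+x. ennreal (cmod (f x - z) ^ 4 / (1 - cos (x - y))) \<partial>circle)" for y z
    by (rule nn_integral_cong_AE) (use assms in \<open>eventually_elim, simp\<close>)
  have "(\<integral>\<^sup>+y. (\<integral>\<^sup>+x. ennreal (cmod (g x - g y) ^ 4 / (1 - cos (x - y))) \<partial>circle) \<partial>circle)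
     = (\<integral>\<^sup>+y. (\<integral>\<^sup>+x. ennreal (cmod (f x - f y) ^ 4 / (1 - cos (x - y))) \<partial>circle) \<partial>circle)"
    unfolding 2 by (rule nn_integral_cong_AE) (use assms in \<open>eventually_elim, simp\<close>)
  with 1 show ?thesis by (simp add: W_norm_pow4_def circle_def)
qed

lemma W_spaceI:
  assumes "periodic_borel f" "W_energy f \<le> ennreal A" "L4 f \<le> ennreal B"
  shows "f \<in> W_space"
proof -
  have "f \<in> borel_measurable torus_measure"
    using measurable_circle_borel[OF periodic_borel_measurable[OF assms(1)]] by (simp add: circle_def)
  moreover have "W_norm_pow4 f < \<infinity>"
    unfolding W_norm_pow4_eq[OF assms(1)] using assms(2,3)
    by (simp add: order_le_less_trans[OF _ ennreal_less_top])
  ultimately show ?thesis using assms(1) by (simp add: W_space_def periodic_borel_def)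
qed

lemma W_norm_le:
  assumes "periodic_borel f" "W_energy f \<le> ennreal A" "L4 f \<le> ennreal B" "0 \<le> A" "0 \<le> B"
  shows "W_norm f \<le> root 4 (A + B)"
proof -
  have "L4 f + W_energy f \<le> ennreal (B + A)" using assms by (simp add: add_mono)
  then have "enn2real (L4 f + W_energy f) \<le> B + A"
    using assms by (intro enn2real_leI) auto
  then show ?thesis unfolding W_norm_def W_norm_pow4_eq[OF assms(1)] by (simp add: add.commute)
qed

lemma W_norm_nonneg: "0 \<le> W_norm f" by (simp add: W_norm_def)

section \<open>Strong convergence of Fejer means and strong measurability\<close>

context bounded_spectrum
begin

text \<open>Convergence almost everywhere and convergence of the energies imply convergence in energy: apply
Scheffe's lemma to the nonnegative functions \<open>8 (|a\<^sub>n|\<^sup>4 + |a|\<^sup>4) - |a\<^sub>n - a|\<^sup>4\<close>, whose integrals do not exceed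
that of their limit \<open>16 |a|\<^sup>4\<close> because Fejer means do not increase the energy.\<close>

lemma fejer_sum_W_energy_tendsto:
  "(\<lambda>n. W_energy (\<lambda>x. fejer_sum (16 ^ n) a x - fejer_limit a x)) \<longlonglongrightarrow> 0"
proof -
  define g where "g = energy_density (fejer_limit a)"
  define gn where "gn n = energy_density (fejer_sum (16 ^ n) a)" for n
  define dn where "dn n = energy_density (\<lambda>x. fejer_sum (16 ^ n) a x - fejer_limit a x)" for n
  define E where "E = (LINT p|circle2. g p)"
  have g: "integrable circle2 g" unfolding g_def by (rule W_energy_integrable(1)[OF periodic_borel_fejer_limit W_energy_fejer_limit C0])
  have gE: "W_energy (fejer_limit a) = ennreal E" unfolding W_energy_def E_def g_def
    by (rule nn_integral_eq_integral) (use g g_def in auto)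
  have pd: "periodic_borel (\<lambda>x. fejer_sum (16 ^ n) a x - fejer_limit a x)" for n by (intro periodic_borel_diff periodic_borel_fejer_limit) simp
  have gn: "integrable circle2 (gn n)" for n
    unfolding gn_def by (rule W_energy_integrable(1)[OF periodic_borel_fejer_sum bd C0]) simp
  have gnE: "(\<integral>\<^sup>+p. ennreal (gn n p) \<partial>circle2) \<le> ennreal E" for n
  proof -
    have "W_energy (fejer_mean (16 ^ n) (fejer_limit a)) \<le> W_energy (fejer_limit a)"
      by (rule fejer_mean_W_energy[OF periodic_borel_fejer_limit integrable_fejer_limit]) simp
    then show ?thesis unfolding fejer_mean_fejer_limit gE by (simp add: W_energy_def gn_def)
  qed
  have dle: "dn n p \<le> 8 * (gn n p + g p)" for n p
  proof -
    have "cmod ((f - f') - (h - h')) ^ 4 \<le> 8 * (cmod (f - h) ^ 4 + cmod (f' - h') ^ 4)" for f f' h h'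
      using norm_power4_add_le[of "f - h" "- (f' - h')"] by (simp add: algebra_simps norm_minus_commute)
    then have "cmod ((f - f') - (h - h')) ^ 4 / q \<le> 8 * (cmod (f - h) ^ 4 + cmod (f' - h') ^ 4) / q" if "0 \<le> q" for f f' h h' q
      using that by (intro divide_right_mono) auto
    note * = this
    show ?thesis
      using *[where q="1 - cos (fst p - snd p)", OF one_minus_cos_bounds(1)]
      unfolding dn_def gn_def g_def energy_density_def by (simp add: add_divide_distrib)
  qed
  have d0: "0 \<le> dn n p" "0 \<le> gn n p" "0 \<le> g p" for n p by (simp_all add: dn_def gn_def g_def)
  have dn: "integrable circle2 (dn n)" for n
    by (rule Bochner_Integration.integrable_bound[of _ "\<lambda>p. 8 * (gn n p + g p)"])
       (use g gn dle d0 in \<open>auto simp: dn_def intro!: measurable_energy_density periodic_borel_measurable pd AE_I2\<close>)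
  \<comment> \<open>Nonnegative by the convexity inequality for fourth powers.\<close>
  define F where "F n p = 8 * (gn n p + g p) - dn n p" for n p
  have F: "integrable circle2 (F n)" for n unfolding F_def using g gn dn by simp
  have F0: "0 \<le> F n p" for n p using dle[of n p] by (simp add: F_def)
  have [measurable]: "g \<in> borel_measurable circle2" "gn n \<in> borel_measurable circle2" for n using g gn by auto
  have AE: "AE p in circle2. (\<lambda>n. F n p) \<longlonglongrightarrow> 16 * g p"
    using AE_circle2[OF AE_fejer_limit]
  proof eventually_elim
    case (elim p)
    have "(\<lambda>n. gn n p) \<longlonglongrightarrow> g p" unfolding gn_def g_def by (rule energy_density_tendsto) (use elim in auto)
    moreover have "(\<lambda>n. dn n p) \<longlonglongrightarrow> energy_density (\<lambda>x. fejer_limit a x - fejer_limit a x) p"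
      unfolding dn_def by (rule energy_density_tendsto) (rule tendsto_diff[OF _ tendsto_const], use elim in simp)+
    ultimately have "(\<lambda>n. F n p) \<longlonglongrightarrow> 8 * (g p + g p) - energy_density (\<lambda>x. fejer_limit a x - fejer_limit a x) p"
      unfolding F_def by (intro tendsto_intros)
    then show ?case by (simp add: energy_density_def)
  qed
  have Fle: "(\<integral>\<^sup>+p. norm (F n p) \<partial>circle2) \<le> (\<integral>\<^sup>+p. norm (16 * g p) \<partial>circle2)" for n
  proof -
    have "(\<integral>\<^sup>+p. norm (F n p) \<partial>circle2) \<le> (\<integral>\<^sup>+p. ennreal 8 * (ennreal (gn n p) + ennreal (g p)) \<partial>circle2)"
    proof (rule nn_integral_mono)
      fix p
      have "norm (F n p) \<le> 8 * (gn n p + g p)" using F0[of n p] d0(1)[of n p] by (simp add: F_def)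
      then have "ennreal (norm (F n p)) \<le> ennreal (8 * (gn n p + g p))" by (rule ennreal_leI)
      also have "\<dots> = ennreal 8 * (ennreal (gn n p) + ennreal (g p))"
        using d0(2)[of n p] d0(3)[of p] by (subst ennreal_mult) auto
      finally show "ennreal (norm (F n p)) \<le> ennreal 8 * (ennreal (gn n p) + ennreal (g p))" .
    qed
    also have "\<dots> = ennreal 8 * ((\<integral>\<^sup>+p. ennreal (gn n p) \<partial>circle2) + (\<integral>\<^sup>+p. ennreal (g p) \<partial>circle2))"
      by (simp add: nn_integral_cmult nn_integral_add)
    also have "\<dots> \<le> ennreal 8 * (ennreal E + ennreal E)"
      using gE by (intro mult_left_mono add_mono gnE) (auto simp: W_energy_def g_def)
    also have "\<dots> = ennreal 16 * ennreal E"
    proof -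
      have "0 \<le> E" unfolding E_def by (rule Bochner_Integration.integral_nonneg) (rule d0)
      then have E: "0 \<le> E" .
      have "ennreal 8 * (ennreal E + ennreal E) = ennreal (8 * (E + E))"
        unfolding ennreal_plus[OF E E, symmetric] by (rule ennreal_mult[symmetric]) (use E in auto)
      also have "\<dots> = ennreal (16 * E)" by simp
      also have "\<dots> = ennreal 16 * ennreal E" by (rule ennreal_mult) (use E in auto)
      finally show ?thesis .
    qed
    also have "\<dots> = (\<integral>\<^sup>+p. ennreal 16 * ennreal (g p) \<partial>circle2)"
      unfolding gE[unfolded W_energy_def, folded g_def, symmetric] by (rule nn_integral_cmult[symmetric]) simp
    also have "\<dots> = (\<integral>\<^sup>+p. norm (16 * g p) \<partial>circle2)"
      using d0 by (intro nn_integral_cong) (simp add: ennreal_mult)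
    finally show ?thesis .
  qed
  have "(\<lambda>n. \<integral>\<^sup>+p. norm (F n p - 16 * g p) \<partial>circle2) \<longlonglongrightarrow> 0"
  proof (rule Scheffe_lemma1[OF F _ AE])
    show "integrable circle2 (\<lambda>p. 16 * g p)" using g by simp
    show "limsup (\<lambda>n. \<integral>\<^sup>+p. norm (F n p) \<partial>circle2) \<le> (\<integral>\<^sup>+p. norm (16 * g p) \<partial>circle2)"
      by (rule Limsup_bounded) (use Fle in auto)
  qed
  moreover have "(\<integral>\<^sup>+p. norm (F n p - 16 * g p) \<partial>circle2) = ennreal (LINT p|circle2. norm (F n p - 16 * g p))" for n
    by (rule nn_integral_eq_integral) (use F g in auto)
  ultimately have lim: "(\<lambda>n. ennreal (LINT p|circle2. norm (F n p - 16 * g p))) \<longlonglongrightarrow> 0" by simp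
  have "W_energy (\<lambda>x. fejer_sum (16 ^ n) a x - fejer_limit a x) \<le> ennreal (LINT p|circle2. norm (F n p - 16 * g p))" for n
  proof -
    have "W_energy (\<lambda>x. fejer_sum (16 ^ n) a x - fejer_limit a x) = ennreal (LINT p|circle2. dn n p)"
      unfolding W_energy_def dn_def by (rule nn_integral_eq_integral) (use dn d0 in \<open>auto simp: dn_def\<close>)
    also have "(LINT p|circle2. dn n p) = 8 * (LINT p|circle2. gn n p) + 8 * E - (LINT p|circle2. F n p)"
      unfolding F_def E_def using g gn dn by simp
    also have "(LINT p|circle2. gn n p) \<le> E"
    proof -
      have "0 \<le> E" unfolding E_def by (rule Bochner_Integration.integral_nonneg) (rule d0)
      moreover have "ennreal (LINT p|circle2. gn n p) \<le> ennreal E"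
        using gnE[of n] d0 by (subst (asm) nn_integral_eq_integral[OF gn]) auto
      ultimately show ?thesis by (simp only: ennreal_le_iff)
    qed
    then have "8 * (LINT p|circle2. gn n p) + 8 * E - (LINT p|circle2. F n p) \<le> - (LINT p|circle2. F n p - 16 * g p)"
      using F g unfolding E_def by simp
    also have "\<dots> \<le> (LINT p|circle2. norm (F n p - 16 * g p))"
    proof -
      have "norm (LINT p|circle2. F n p - 16 * g p) \<le> (LINT p|circle2. norm (F n p - 16 * g p))"
        by (rule integral_norm_bound)
      then show ?thesis unfolding real_norm_def by linarith
    qed
    finally show ?thesis by (simp add: ennreal_leI)
  qed
  then show ?thesis
    by (intro tendsto_sandwich[OF _ _ tendsto_const lim]) (auto intro: always_eventually)
qed

end

text \<open>Rounding to the grid of mesh \<open>1 / K\<close> gives a finite range on bounded sets, and hence simple functions.\<close>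

definition rounding :: "real \<Rightarrow> complex \<Rightarrow> complex" where
  "rounding K z = Complex (of_int \<lfloor>K * Re z\<rfloor> / K) (of_int \<lfloor>K * Im z\<rfloor> / K)"

lemma rounding_error:
  assumes K: "K > 0"
  shows "cmod (rounding K z - z) \<le> 2 / K"
proof -
  have 1: "\<bar>of_int \<lfloor>K * x\<rfloor> / K - x\<bar> \<le> 1 / K" for x
  proof -
    have "of_int \<lfloor>K * x\<rfloor> / K - x = (of_int \<lfloor>K * x\<rfloor> - K * x) / K" using K by (simp add: diff_divide_distrib)
    moreover have "\<bar>of_int \<lfloor>K * x\<rfloor> - K * x\<bar> \<le> 1" by linarith
    ultimately show ?thesis using K by (simp add: divide_right_mono)
  qed
  have "cmod (rounding K z - z) \<le> \<bar>Re (rounding K z - z)\<bar> + \<bar>Im (rounding K z - z)\<bar>" by (rule cmod_le)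
  also have "\<dots> \<le> 1 / K + 1 / K" using 1 by (intro add_mono) (auto simp: rounding_def)
  finally show ?thesis by simp
qed

lemma simple_function_rounding:
  assumes f: "f \<in> borel_measurable M" and b: "\<And>t. t \<in> space M \<Longrightarrow> cmod (f t) \<le> B" and K: "K > 0"
  shows "simple_function M (\<lambda>t. rounding K (f t))"
proof -
  have *: "simple_function M (\<lambda>t. \<lfloor>K * g t\<rfloor>)" if g: "g \<in> borel_measurable M" "\<And>t. t \<in> space M \<Longrightarrow> \<bar>g t\<bar> \<le> B" for g :: "'a \<Rightarrow> real"
    unfolding simple_function_eq_measurable
  proof
    have "\<lfloor>K * g t\<rfloor> \<in> {\<lfloor>- (K * B)\<rfloor>..\<lfloor>K * B\<rfloor>}" if "t \<in> space M" for t
    proof -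
      have "- B \<le> g t" "g t \<le> B" using g(2)[OF that] by auto
      then have "- (K * B) \<le> K * g t" "K * g t \<le> K * B"
        using mult_left_mono[of "- B" "g t" K] mult_left_mono[of "g t" B K] K by auto
      then show ?thesis by (auto intro: floor_mono)
    qed
    then have "(\<lambda>t. \<lfloor>K * g t\<rfloor>) ` space M \<subseteq> {\<lfloor>- (K * B)\<rfloor>..\<lfloor>K * B\<rfloor>}" by blast
    then show "finite ((\<lambda>t. \<lfloor>K * g t\<rfloor>) ` space M)" by (rule finite_subset) simp
    have "(\<lambda>t. K * g t) \<in> borel_measurable M" using g(1) by simp
    then show "(\<lambda>t. \<lfloor>K * g t\<rfloor>) \<in> M \<rightarrow>\<^sub>M count_space UNIV"
      by (rule measurable_compose) (rule measurable_real_floor)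
  qed
  have "(\<lambda>t. Re (f t)) \<in> borel_measurable M" "(\<lambda>t. Im (f t)) \<in> borel_measurable M" using f by auto
  moreover have "\<bar>Re (f t)\<bar> \<le> B" "\<bar>Im (f t)\<bar> \<le> B" if "t \<in> space M" for t
    using b[OF that] abs_Re_le_cmod[of "f t"] abs_Im_le_cmod[of "f t"] by linarith+
  ultimately have "simple_function M (\<lambda>t. \<lfloor>K * Re (f t)\<rfloor>)" "simple_function M (\<lambda>t. \<lfloor>K * Im (f t)\<rfloor>)"
    using *[of "\<lambda>t. Re (f t)"] *[of "\<lambda>t. Im (f t)"] by auto
  then show ?thesis unfolding rounding_def
    by (rule simple_function_compose2[where h="\<lambda>m n. Complex (of_int m / K) (of_int n / K)"])
qed

lemma simple_function_trig:
  assumes "finite A" "\<And>k. k \<in> A \<Longrightarrow> simple_function M (\<lambda>t. a t k)"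
  shows "simple_function M (\<lambda>t. trig A (a t))"
  using assms
proof (induction A rule: finite_induct)
  case empty
  then show ?case by (simp add: trig_def[abs_def])
next
  case (insert k A)
  have "simple_function M (\<lambda>t. (\<lambda>z f x. z * cis (of_int k * x) + f x) (a t k) (trig A (a t)))"
    by (rule simple_function_compose2[where h="\<lambda>z f x. z * cis (of_int k * x) + f x"]) (use insert in auto)
  moreover have "trig (insert k A) (a t) = (\<lambda>z f x. z * cis (of_int k * x) + f x) (a t k) (trig A (a t))" for t
    using insert by (auto simp: trig_def)
  ultimately show ?case by simp
qed

context mode_solution
begin

lemma u_continuous: "continuous_on {0..} (\<lambda>t. u t k)"
  unfolding continuous_on_iff
proof (intro ballI allI impI)
  fix s \<epsilon> :: real assume s: "s \<in> {0..}" and e: "0 < \<epsilon>"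
  have V1: "V k + 1 > 0" using V0[of k] by linarith
  have "dist (u t k) (u s k) < \<epsilon>" if "t \<in> {0..}" "dist t s < \<epsilon> / (V k + 1)" for t
  proof -
    have "dist (u t k) (u s k) \<le> \<bar>t - s\<bar> * V k" unfolding dist_norm by (rule u_lipschitz) (use s that in auto)
    also have "\<dots> \<le> \<bar>t - s\<bar> * (V k + 1)" by (intro mult_left_mono) auto
    also have "\<dots> < \<epsilon>" using that V1 by (simp add: dist_real_def pos_less_divide_eq)
    finally show ?thesis .
  qed
  then show "\<exists>d>0. \<forall>t\<in>{0..}. dist t s < d \<longrightarrow> dist (u t k) (u s k) < \<epsilon>"
    using e V1 by (intro exI[of _ "\<epsilon> / (V k + 1)"]) auto
qed

lemma u_measurable: "(\<lambda>t. u t k) \<in> borel_measurable (lebesgue_on {0..})"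
  by (rule continuous_imp_measurable_on_sets_lebesgue[OF u_continuous]) simp

definition U :: "real \<Rightarrow> real \<Rightarrow> complex" where
  "U t = fejer_limit (u t)"

lemma U:
  assumes "0 \<le> t"
  shows "periodic_borel (U t)" "W_energy (U t) \<le> ennreal C" "L4 (U t) \<le> ennreal C" "integrable circle (U t)"
    "fourier_coeff (U t) k = u t k" "U t \<in> W_space"
proof -
  interpret bounded_spectrum "u t" C by (rule spectrum[OF assms])
  show "periodic_borel (U t)" "W_energy (U t) \<le> ennreal C" "L4 (U t) \<le> ennreal C" "integrable circle (U t)"
    "fourier_coeff (U t) k = u t k"
    unfolding U_def by (fact periodic_borel_fejer_limit W_energy_fejer_limit L4_fejer_limit integrable_fejer_limit fourier_coeff_fejer_limit)+
  then show "U t \<in> W_space" by (intro W_spaceI)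
qed

lemma U_positive: "0 \<le> t \<Longrightarrow> is_P_plus (U t) (U t)"
proof -
  assume t: "0 \<le> t"
  interpret bounded_spectrum "u t" C by (rule spectrum[OF t])
  show ?thesis using U(4)[OF t] pos unfolding is_P_plus_def U(5)[OF t]
    by (auto simp: circle_def indicator_def)
qed

text \<open>The simple functions are Fejer sums of order \<open>16\<^sup>n\<close> with rounded coefficients. There are fewer than \<open>16\<^sup>n\<close>
frequencies, all below \<open>16\<^sup>n\<close>, so rounding with mesh \<open>16\<^sup>-\<^sup>3\<^sup>n\<close> gives an error of order \<open>16\<^sup>-\<^sup>n\<close> in the Lipschitz
constant and hence in the norm of the space.\<close>

lemma U_strongly_measurable: "strongly_measurable_W {0..} U"
  unfolding strongly_measurable_W_def
proof (intro exI conjI allI ballI)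
  define K where "K n = (16 ^ n :: real) ^ 3" for n :: nat
  define A where "A n = {1..<int (16 ^ n)}" for n :: nat
  define b where "b n t k = complex_of_real (1 - of_int k / real (16 ^ n)) * rounding (K n) (u t k)" for n t k
  define s where "s n t = trig (A n) (b n t)" for n t
  have K: "K n > 0" for n by (simp add: K_def)
  show "simple_function (lebesgue_on {0..}) (s n)" for n
    unfolding s_def
  proof (rule simple_function_trig)
    show "simple_function (lebesgue_on {0..}) (\<lambda>t. b n t k)" for k
      unfolding b_def
      by (rule simple_function_compose1[where g="\<lambda>z. complex_of_real (1 - of_int k / real (16 ^ n)) * z"])
         (rule simple_function_rounding[OF u_measurable _ K, where B=C], use u_bound in auto)
  qed (simp add: A_def)
  show "s n t \<in> W_space" for n t
  proof -
    have "chord_lip (trig_lip (A n) (b n t)) (s n t)" unfolding s_def by (rule chord_lip_trig) (simp add: A_def)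
    then show ?thesis by (intro W_spaceI[OF lipgD(1) chord_lip_W_energy chord_lip_L4])
  qed
  have "(\<lambda>n. W_norm (\<lambda>x. s n t x - U t x)) \<longlonglongrightarrow> 0" if t: "t \<in> {0..}" for t
  proof -
    have t0: "0 \<le> t" using t by simp
    interpret bounded_spectrum "u t" C by (rule spectrum[OF t0])
    define d where "d n k = complex_of_real (1 - of_int k / real (16 ^ n)) * (rounding (K n) (u t k) - u t k)" for n k
    define q where "q n = enn2real (W_energy (\<lambda>x. fejer_sum (16 ^ n) (u t) x - U t x))" for n
    define \<rho> where "\<rho> n = C / pi * (1 / 16) ^ n" for n :: nat
    define \<beta> where "\<beta> n = 128 * (4 * (1 / 16 :: real) ^ n) ^ 4" for n :: nat
    have dec: "s n t x = trig (A n) (d n) x + fejer_sum (16 ^ n) (u t) x" for n x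
    proof -
      have "w * r * e = w * (r - z) * e + w * z * e" for w r z e :: complex by (simp add: algebra_simps)
      then show ?thesis
        unfolding s_def fejer_sum_def trig_def A_def sum.distrib[symmetric] b_def d_def
        by (intro sum.cong refl)
    qed
    have Dlip: "chord_lip (4 * (1 / 16) ^ n) (trig (A n) (d n))" for n
    proof (rule chord_lip_mono[OF chord_lip_trig])
      define N where "N = (16 ^ n :: real)"
      have N1: "1 \<le> N" by (simp add: N_def)
      have KN: "K n = N ^ 3" by (simp add: K_def N_def)
      have "trig_lip (A n) (d n) \<le> of_nat (card (A n)) * (2 / K n * (2 * N))"
        unfolding trig_lip_def
      proof (rule sum_bounded_above)
        fix k assume k: "k \<in> A n"
        then have "1 \<le> k" "k < int (16 ^ n)" by (auto simp: A_def)
        then have "real_of_int 1 \<le> real_of_int k" "real_of_int k < real_of_int (int (16 ^ n))"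
          by (simp_all only: of_int_le_iff of_int_less_iff)
        then have k1: "1 \<le> real_of_int k" "real_of_int k < N" by (simp_all add: N_def)
        have "cmod (d n k) = \<bar>1 - of_int k / N\<bar> * cmod (rounding (K n) (u t k) - u t k)"
          by (simp only: d_def norm_mult norm_of_real) (simp add: N_def)
        also have "\<dots> \<le> 1 * (2 / K n)"
          using k1 N1 by (intro mult_mono rounding_error K) auto
        finally have dk: "cmod (d n k) \<le> 2 / K n" by simp
        have "k + 1 \<le> int (16 ^ n)" using k by (simp add: A_def)
        then have "real_of_int (k + 1) \<le> real_of_int (int (16 ^ n))" by (rule of_int_le_iff[THEN iffD2])
        then have "\<bar>of_int k\<bar> + 1 \<le> N" using k1 by (simp add: N_def)
        then show "cmod (d n k) * (2 * (\<bar>of_int k\<bar> + 1)) \<le> 2 / K n * (2 * N)"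
          using K[of n] by (intro mult_mono dk) auto
      qed
      also have "\<dots> \<le> N * (2 / K n * (2 * N))"
        using K[of n] N1 by (intro mult_right_mono) (auto simp: A_def N_def)
      also have "\<dots> = 4 / N" using N1 by (simp add: KN power3_eq_cube)
      also have "\<dots> = 4 * (1 / 16) ^ n" by (simp add: N_def power_divide)
      finally show "trig_lip (A n) (d n) \<le> 4 * (1 / 16) ^ n" .
    qed (simp add: A_def)
    have Rp: "periodic_borel (\<lambda>x. fejer_sum (16 ^ n) (u t) x - U t x)" for n
      using U(1)[OF t0] by (intro periodic_borel_diff) auto
    have qfin: "W_energy (\<lambda>x. fejer_sum (16 ^ n) (u t) x - U t x) = ennreal (q n)" for n
    proof -
      have "W_energy (\<lambda>x. fejer_sum (16 ^ n) (u t) x + - U t x) \<le> ennreal 8 * (W_energy (fejer_sum (16 ^ n) (u t)) + W_energy (\<lambda>x. - U t x))"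
        by (rule W_energy_add) (use U(1)[OF t0] periodic_borel_diff[OF periodic_borel_const[of 0]] in auto)
      also have "W_energy (\<lambda>x. - U t x) = W_energy (U t)" by (simp add: W_energy_def energy_density_def norm_minus_commute)
      also have "ennreal 8 * (W_energy (fejer_sum (16 ^ n) (u t)) + W_energy (U t)) \<le> ennreal 8 * (ennreal C + ennreal C)"
        by (intro mult_left_mono add_mono bd U(2)[OF t0]) auto
      also have "\<dots> < top" by (simp add: ennreal_mult_less_top)
      finally show ?thesis unfolding q_def by simp
    qed
    have q0: "0 \<le> q n" for n by (simp add: q_def)
    have qlim: "q \<longlonglongrightarrow> 0"
    proof -
      have "(\<lambda>n. ennreal (q n)) \<longlonglongrightarrow> ennreal 0"
        using fejer_sum_W_energy_tendsto unfolding qfin[symmetric] U_def by simp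
      then show ?thesis by (subst (asm) tendsto_ennreal_iff) (auto simp: q0)
    qed
    have RL: "L4 (\<lambda>x. fejer_sum (16 ^ n) (u t) x - U t x) \<le> ennreal (\<rho> n)" for n
      using L4_fejer_limit_error[of "16 ^ n"] by (simp add: U_def \<rho>_def power_divide)
    have D4: "0 \<le> \<beta> n" for n by (simp add: \<beta>_def)
    have r0: "0 \<le> \<rho> n" for n using C0 by (simp add: \<rho>_def)
    have le: "W_norm (\<lambda>x. s n t x - U t x) \<le> root 4 (8 * (\<beta> n + q n) + 8 * (\<beta> n + \<rho> n))" for n
    proof -
      have eq: "(\<lambda>x. s n t x - U t x) = (\<lambda>x. trig (A n) (d n) x + (fejer_sum (16 ^ n) (u t) x - U t x))"
        by (rule ext) (simp add: dec)
      have 1: "W_energy (\<lambda>x. s n t x - U t x) \<le> ennreal (8 * (\<beta> n + q n))"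
      proof -
        have "W_energy (\<lambda>x. s n t x - U t x) \<le> ennreal 8 * (W_energy (trig (A n) (d n)) + W_energy (\<lambda>x. fejer_sum (16 ^ n) (u t) x - U t x))"
          unfolding eq by (rule W_energy_add[OF periodic_borel_trig Rp])
        also have "\<dots> \<le> ennreal 8 * (ennreal (\<beta> n) + ennreal (q n))"
          unfolding \<beta>_def by (intro mult_left_mono add_mono chord_lip_W_energy Dlip) (auto simp: qfin)
        also have "\<dots> = ennreal (8 * (\<beta> n + q n))" using D4 q0 by (simp add: ennreal_mult)
        finally show ?thesis .
      qed
      have 2: "L4 (\<lambda>x. s n t x - U t x) \<le> ennreal (8 * (\<beta> n + \<rho> n))"
      proof -
        have "L4 (\<lambda>x. s n t x - U t x) \<le> ennreal 8 * (L4 (trig (A n) (d n)) + L4 (\<lambda>x. fejer_sum (16 ^ n) (u t) x - U t x))"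
          unfolding eq by (rule L4_add[OF periodic_borel_trig Rp])
        also have "\<dots> \<le> ennreal 8 * (ennreal (\<beta> n) + ennreal (\<rho> n))"
          unfolding \<beta>_def by (intro mult_left_mono add_mono chord_lip_L4 Dlip RL) auto
        also have "\<dots> = ennreal (8 * (\<beta> n + \<rho> n))" using D4 r0 by (simp add: ennreal_mult)
        finally show ?thesis .
      qed
      have p: "periodic_borel (\<lambda>x. s n t x - U t x)" unfolding eq by (intro periodic_borel_add periodic_borel_trig Rp)
      show ?thesis by (rule W_norm_le[OF p 1 2]) (use D4[of n] q0[of n] r0[of n] in auto)
    qed
    have b0: "\<beta> \<longlonglongrightarrow> 128 * (4 * 0) ^ 4" unfolding \<beta>_def by (intro tendsto_intros LIMSEQ_realpow_zero) auto
    have rl: "\<rho> \<longlonglongrightarrow> C / pi * 0" unfolding \<rho>_def by (intro tendsto_intros LIMSEQ_realpow_zero) auto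
    have "(\<lambda>n. root 4 (8 * (\<beta> n + q n) + 8 * (\<beta> n + \<rho> n))) \<longlonglongrightarrow> root 4 (8 * (128 * (4 * 0) ^ 4 + 0) + 8 * (128 * (4 * 0) ^ 4 + C / pi * 0))"
      by (intro tendsto_intros b0 rl qlim)
    then have lim: "(\<lambda>n. root 4 (8 * (\<beta> n + q n) + 8 * (\<beta> n + \<rho> n))) \<longlonglongrightarrow> 0" by simp
    show ?thesis
      by (rule tendsto_sandwich[OF _ _ tendsto_const lim]; intro always_eventually allI W_norm_nonneg le)
  qed
  then show "AE t in lebesgue_on {0..}. (\<lambda>n. W_norm (\<lambda>x. s n t x - U t x)) \<longlonglongrightarrow> 0"
    by (intro AE_I2) simp
qed

lemma U_L_infinity: "U \<in> L_infinity_W {0..}"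
  unfolding L_infinity_W_def
proof (intro CollectI conjI ballI exI)
  show "strongly_measurable_W {0..} U" by (rule U_strongly_measurable)
  show "AE t in lebesgue_on {0..}. W_norm (U t) \<le> root 4 (C + C)"
    by (intro AE_I2 W_norm_le U C0) auto
qed (use U in auto)

end

section \<open>Test functions\<close>

text \<open>Taylor's formula of order four, with \<open>x\<^sup>2 \<le> (16/5)\<^sup>2\<close>.\<close>

lemma square_le_one_minus_cos:
  assumes "\<bar>x\<bar> \<le> pi"
  shows "x\<^sup>2 \<le> 16 * (1 - cos x)"
proof -
  obtain t where t: "cos x = (\<Sum>m<4. cos_coeff m * x ^ m) + (cos (t + 1 / 2 * real 4 * pi) / fact 4) * x ^ 4"
    using Maclaurin_cos_expansion[of x 4] by blast
  have "(\<Sum>m<4. cos_coeff m * x ^ m) = 1 - x\<^sup>2 / 2"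
  proof -
    have "{..<4} = {0, 1, 2, 3::nat}" by auto
    then show ?thesis by (simp add: cos_coeff_def fact_numeral)
  qed
  moreover have "cos (t + 1 / 2 * real 4 * pi) / fact 4 * x ^ 4 \<le> 1 / fact 4 * x ^ 4"
    by (intro mult_right_mono divide_right_mono) auto
  ultimately have c: "cos x \<le> 1 - x\<^sup>2 / 2 + x ^ 4 / 24" using t by (simp add: fact_numeral)
  have "x\<^sup>2 \<le> (16/5)\<^sup>2" using assms pi_approx by (intro power2_le_iff_abs_le[THEN iffD2]) auto
  then have "x\<^sup>2 * x\<^sup>2 \<le> x\<^sup>2 * (16/5)\<^sup>2" by (intro mult_left_mono) auto
  then have "x ^ 4 \<le> 256/25 * x\<^sup>2" by (simp add: power4_eq_xxxx power2_eq_square)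
  moreover have "a \<le> 16 * (1 - c)" if "c \<le> 1 - a / 2 + b / 24" "0 \<le> a" "b \<le> 256 / 25 * a" for a b c :: real
    using that by simp
  ultimately show ?thesis using c zero_le_power2[of x] by blast
qed

lemma periodic_vector_derivative:
  fixes f f' :: "real \<Rightarrow> complex"
  assumes per: "\<And>x. f (x + 2 * pi) = f x" and d: "\<And>x. (f has_vector_derivative f' x) (at x)"
  shows "f' (x + 2 * pi) = f' x"
proof -
  have "((f \<circ> (\<lambda>x. x + 2 * pi)) has_vector_derivative (1 *\<^sub>R f' (x + 2 * pi))) (at x)"
    by (rule vector_diff_chain_at) (auto intro!: derivative_eq_intros d)
  moreover have "f \<circ> (\<lambda>x. x + 2 * pi) = f" using per by auto
  ultimately have "(f has_vector_derivative f' (x + 2 * pi)) (at x)" by simp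
  then show ?thesis using d[of x] by (rule vector_derivative_unique_at)
qed

text \<open>By periodicity the points may be taken at distance at most \<open>\<pi>\<close>, where the length of an arc is comparable
to that of its chord.\<close>

lemma periodic_chord_lipschitz:
  fixes g g' :: "real \<Rightarrow> complex"
  assumes per: "\<And>x. g (x + 2 * pi) = g x" and d: "\<And>x. (g has_vector_derivative g' x) (at x)"
    and b: "\<And>x. cmod (g' x) \<le> B"
  shows "cmod (g x - g y) \<le> 4 * B * sqrt (1 - cos (x - y))"
proof -
  have B0: "0 \<le> B" using b[of 0] norm_ge_zero order_trans by blast
  have lip: "cmod (g x - g y) \<le> B * \<bar>x - y\<bar>" for x y
  proof -
    have "norm (g x - g y) \<le> B * norm (x - y)"
    proof (rule differentiable_bound[of UNIV g "\<lambda>x h. h *\<^sub>R g' x"])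
      show "(g has_derivative (\<lambda>h. h *\<^sub>R g' x)) (at x within UNIV)" for x
        using d[of x] by (simp add: has_vector_derivative_def)
      show "onorm (\<lambda>h. h *\<^sub>R g' x) \<le> B" for x
        by (rule onorm_le) (use b[of x] in \<open>simp add: mult.commute[of B] mult_left_mono\<close>)
    qed auto
    then show ?thesis by simp
  qed
  define n where "n = \<lfloor>(x - y + pi) / (2 * pi)\<rfloor>"
  \<comment> \<open>The difference of the two points, reduced to \<open>[-\<pi>, \<pi>)\<close>.\<close>
  define \<theta> where "\<theta> = x - (y + 2 * pi * of_int n)"
  have "of_int n \<le> (x - y + pi) / (2 * pi)" "(x - y + pi) / (2 * pi) < of_int n + 1"
    unfolding n_def by linarith+
  then have "of_int n * (2 * pi) \<le> x - y + pi" "x - y + pi < (of_int n + 1) * (2 * pi)"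
    by (simp_all add: pos_le_divide_eq pos_divide_less_eq)
  then have th: "\<bar>\<theta>\<bar> \<le> pi" unfolding \<theta>_def by (simp add: algebra_simps abs_le_iff)
  have cos: "cos \<theta> = cos (x - y)"
    using periodic_int_shift[of cos \<theta> n] cos_periodic by (simp add: \<theta>_def algebra_simps)
  have "\<theta>\<^sup>2 \<le> 16 * (1 - cos (x - y))" using square_le_one_minus_cos[OF th] cos by simp
  then have "\<bar>\<theta>\<bar> \<le> sqrt (16 * (1 - cos (x - y)))" using real_le_rsqrt[of "\<bar>\<theta>\<bar>"] by simp
  also have "\<dots> = 4 * sqrt (1 - cos (x - y))" 
  proof -
    have "sqrt 16 = (4::real)" by (rule real_sqrt_unique) auto
    then show ?thesis unfolding real_sqrt_mult by simp
  qed
  finally have t: "\<bar>\<theta>\<bar> \<le> 4 * sqrt (1 - cos (x - y))" .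
  have "cmod (g x - g y) = cmod (g x - g (y + 2 * pi * of_int n))"
    using periodic_int_shift[of g y n, OF per] by simp
  also have "\<dots> \<le> B * \<bar>\<theta>\<bar>" unfolding \<theta>_def by (rule lip)
  also have "\<dots> \<le> B * (4 * sqrt (1 - cos (x - y)))" using t B0 by (rule mult_left_mono)
  finally show ?thesis by simp
qed

lemma time_interval_infinity: "time_interval \<infinity> = {0..}"
  by (auto simp: time_interval_def)

abbreviation half_line :: "real measure" where "half_line \<equiv> lebesgue_on {0..}"

lemma measurable_half_line: "f \<in> borel_measurable borel \<Longrightarrow> f \<in> borel_measurable half_line" for f :: "real \<Rightarrow> complex"
  by (intro measurable_restrict_space1 measurable_completion) simp

lemma continuous_measurable_half_line: "continuous_on {0..} f \<Longrightarrow> f \<in> borel_measurable half_line" for f :: "real \<Rightarrow> complex"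
  by (rule continuous_imp_measurable_on_sets_lebesgue) auto

lemma integral_half_line:
  fixes F :: "real \<Rightarrow> complex"
  assumes "(\<lambda>t. indicator {0..} t *\<^sub>R F t) \<in> borel_measurable borel"
  shows "(LINT t|half_line. F t) = (LINT t|lborel. indicator {0..} t *\<^sub>R F t)"
  by (subst integral_restrict_space) (use assms in \<open>auto intro!: integral_completion\<close>)

lemma integrable_half_line_indicator: "integrable half_line (\<lambda>t. A * indicator {0..T} t :: real)"
proof -
  have "integrable lborel (\<lambda>t. indicator {0..T} t *\<^sub>R A)"
    by (rule integrable_scaleR_left) (use finite_lborel_Ico in \<open>auto simp: integrable_indicator_iff\<close>)
  moreover have "(\<lambda>t. indicator {0..} t *\<^sub>R (A * indicator {0..T} t)) = (\<lambda>t. indicator {0..T} t *\<^sub>R A)"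
    by (auto simp: indicator_def)
  moreover have "(\<lambda>t. indicator {0..T} t *\<^sub>R A) \<in> borel_measurable lborel" by simp
  ultimately show ?thesis by (subst integrable_restrict_space) (auto simp: integrable_completion)
qed

lemma integrable_half_line_bounded:
  fixes f :: "real \<Rightarrow> complex"
  assumes f: "f \<in> borel_measurable half_line" and b: "\<And>t. 0 \<le> t \<Longrightarrow> cmod (f t) \<le> A * indicator {0..T} t"
  shows "integrable half_line f"
  by (rule Bochner_Integration.integrable_bound[OF integrable_half_line_indicator[of A T] f])
     (intro AE_I2 order_trans[OF b], auto)

locale test_fun =
  fixes \<phi> :: "real \<Rightarrow> real \<Rightarrow> complex"
  assumes test: "test_function \<infinity> \<phi>"
begin

definition \<psi> where "\<psi> = partial_t {0..} \<phi>"
definition g where "g = partial_x \<phi>"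
definition g2 where "g2 = partial_x g"

lemma phi_periodic: "0 \<le> t \<Longrightarrow> \<phi> t (x + 2 * pi) = \<phi> t x"
  using test by (simp add: test_function_def time_interval_infinity periodic_2pi_def)

lemma test_Ck: "Ck_on n {0..} \<phi>"
  using test by (simp add: test_function_def time_interval_infinity)

lemma phi_cont: "continuous_on ({0..} \<times> UNIV) (\<lambda>(t, x). \<phi> t x)"
  and psi_cont: "continuous_on ({0..} \<times> UNIV) (\<lambda>(t, x). \<psi> t x)"
  and g_cont: "continuous_on ({0..} \<times> UNIV) (\<lambda>(t, x). g t x)"
  and g2_cont: "continuous_on ({0..} \<times> UNIV) (\<lambda>(t, x). g2 t x)"
  using test_Ck[of "Suc (Suc 0)"] unfolding \<psi>_def g_def g2_def by simp_all

lemma phi_dx: "0 \<le> t \<Longrightarrow> (\<phi> t has_vector_derivative g t x) (at x)"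
  and phi_dt: "0 \<le> t \<Longrightarrow> ((\<lambda>s. \<phi> s x) has_vector_derivative \<psi> t x) (at t within {0..})"
  using test_Ck[of "Suc 0"] unfolding \<psi>_def g_def partial_t_def partial_x_def
  by (simp_all add: vector_derivative_works[symmetric])

lemma g_dx:
  assumes "0 \<le> t"
  shows "(g t has_vector_derivative g2 t x) (at x)"
proof -
  have "g t differentiable (at x)"
    using test_Ck[of "Suc (Suc 0)"] assms unfolding g_def by simp
  then show ?thesis unfolding g2_def partial_x_def[of g] by (simp add: vector_derivative_works[symmetric])
qed

lemma g_periodic: "0 \<le> t \<Longrightarrow> g t (x + 2 * pi) = g t x"
  by (rule periodic_vector_derivative[of "\<phi> t" "g t"]) (auto simp: phi_periodic phi_dx)

lemma g2_periodic: "0 \<le> t \<Longrightarrow> g2 t (x + 2 * pi) = g2 t x"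
  by (rule periodic_vector_derivative[of "g t" "g2 t"]) (auto simp: g_periodic g_dx)

lemma support_exists: "\<exists>T>0. \<forall>t\<ge>T. \<forall>x. \<phi> t x = 0 \<and> \<psi> t x = 0 \<and> g t x = 0 \<and> g2 t x = 0"
proof -
  obtain K where K: "compact K" "\<And>t x. 0 \<le> t \<Longrightarrow> t \<notin> K \<Longrightarrow> \<phi> t x = 0"
    using test by (auto simp: test_function_def time_interval_infinity)
  obtain b where b: "\<And>t. t \<in> K \<Longrightarrow> \<bar>t\<bar> \<le> b"
    using compact_imp_bounded[OF K(1)] by (auto simp: bounded_iff)
  have phi0: "\<phi> t x = 0" if "t > \<bar>b\<bar>" for t x
    using K(2)[of t x] b[of t] that by force
  have gz: "g t = (\<lambda>x. 0)" if "t > \<bar>b\<bar>" for t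
  proof -
    have "\<phi> t = (\<lambda>x. 0)" using phi0[OF that] by auto
    then show ?thesis by (auto simp: g_def partial_x_def)
  qed
  have "g2 t x = 0" if "t > \<bar>b\<bar>" for t x
    by (simp add: g2_def partial_x_def gz[OF that])
  moreover have "\<psi> t x = 0" if "t > \<bar>b\<bar>" for t x
  proof -
    have t0: "0 < t" using that by linarith
    have "((\<lambda>s. \<phi> s x) has_vector_derivative \<psi> t x) (at t within {0..})" by (rule phi_dt) (use t0 in simp)
    then have 1: "((\<lambda>s. \<phi> s x) has_vector_derivative \<psi> t x) (at t)"
      using t0 by (subst (asm) at_within_interior) (auto simp: interior_real_atLeast)
    have 2: "((\<lambda>s. \<phi> s x) has_vector_derivative 0) (at t)"
      by (rule has_vector_derivative_transform_within_open[of "\<lambda>s. 0" _ _ "{\<bar>b\<bar><..}"]) (use that phi0 in auto)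
    show ?thesis using vector_derivative_unique_at[OF 1 2] .
  qed
  ultimately show ?thesis using phi0 gz by (intro exI[of _ "\<bar>b\<bar> + 1"]) auto
qed

text \<open>A time after which the test function and its derivatives vanish.\<close>

definition T where "T = (SOME T. T > 0 \<and> (\<forall>t\<ge>T. \<forall>x. \<phi> t x = 0 \<and> \<psi> t x = 0 \<and> g t x = 0 \<and> g2 t x = 0))"

lemma T: "T > 0" "T \<le> t \<Longrightarrow> \<phi> t x = 0" "T \<le> t \<Longrightarrow> \<psi> t x = 0" "T \<le> t \<Longrightarrow> g t x = 0" "T \<le> t \<Longrightarrow> g2 t x = 0"
  using someI_ex[OF support_exists] unfolding T_def[symmetric] by auto

lemma bounded_exists: "\<exists>B\<ge>0. \<forall>t\<ge>0. \<forall>x\<in>{0..2 * pi}. cmod (\<phi> t x) \<le> B \<and> cmod (\<psi> t x) \<le> B \<and> cmod (g t x) \<le> B \<and> cmod (g2 t x) \<le> B"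
proof -
  have *: "\<exists>b\<ge>0. \<forall>t\<ge>0. \<forall>x\<in>{0..2 * pi}. cmod (f t x) \<le> b"
    if c: "continuous_on ({0..} \<times> UNIV) (\<lambda>(t, x). f t x)" and z: "\<And>t x. T \<le> t \<Longrightarrow> f t x = 0" for f :: "real \<Rightarrow> real \<Rightarrow> complex"
  proof -
    have "compact ((\<lambda>(t, x). f t x) ` ({0..T} \<times> {0..2 * pi}))"
      by (intro compact_continuous_image continuous_on_subset[OF c] compact_Times) auto
    then obtain b where b: "\<And>z. z \<in> (\<lambda>(t, x). f t x) ` ({0..T} \<times> {0..2 * pi}) \<Longrightarrow> norm z \<le> b"
      using compact_imp_bounded bounded_iff by metis
    have "cmod (f t x) \<le> \<bar>b\<bar>" if "t \<ge> 0" "x \<in> {0..2 * pi}" for t x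
    proof (cases "t \<le> T")
      case True
      then have "cmod (f t x) \<le> b" using that by (intro b) (force simp: image_iff)
      then show ?thesis by simp
    qed (use z in auto)
    then show ?thesis by (intro exI[of _ "\<bar>b\<bar>"]) auto
  qed
  obtain b1 where b1: "b1 \<ge> 0" "\<And>t x. t \<ge> 0 \<Longrightarrow> x \<in> {0..2 * pi} \<Longrightarrow> cmod (\<phi> t x) \<le> b1"
    using *[OF phi_cont T(2)] by blast
  obtain b2 where b2: "b2 \<ge> 0" "\<And>t x. t \<ge> 0 \<Longrightarrow> x \<in> {0..2 * pi} \<Longrightarrow> cmod (\<psi> t x) \<le> b2"
    using *[OF psi_cont T(3)] by blast
  obtain b3 where b3: "b3 \<ge> 0" "\<And>t x. t \<ge> 0 \<Longrightarrow> x \<in> {0..2 * pi} \<Longrightarrow> cmod (g t x) \<le> b3"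
    using *[OF g_cont T(4)] by blast
  obtain b4 where b4: "b4 \<ge> 0" "\<And>t x. t \<ge> 0 \<Longrightarrow> x \<in> {0..2 * pi} \<Longrightarrow> cmod (g2 t x) \<le> b4"
    using *[OF g2_cont T(5)] by blast
  have "cmod (\<phi> t x) \<le> b1 + b2 + b3 + b4 \<and> cmod (\<psi> t x) \<le> b1 + b2 + b3 + b4 \<and>
    cmod (g t x) \<le> b1 + b2 + b3 + b4 \<and> cmod (g2 t x) \<le> b1 + b2 + b3 + b4"
    if "t \<ge> 0" "x \<in> {0..2 * pi}" for t x
    using b1(1) b2(1) b3(1) b4(1) b1(2)[OF that] b2(2)[OF that] b3(2)[OF that] b4(2)[OF that] by linarith
  then show ?thesis using b1(1) b2(1) b3(1) b4(1) by (intro exI[of _ "b1 + b2 + b3 + b4"]) auto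
qed

text \<open>A bound on one period suffices: test functions occur under integrals over the circle, and the
\<open>x\<close>-derivatives are periodic.\<close>

definition B where "B = (SOME B. B \<ge> 0 \<and> (\<forall>t\<ge>0. \<forall>x\<in>{0..2 * pi}. cmod (\<phi> t x) \<le> B \<and> cmod (\<psi> t x) \<le> B \<and> cmod (g t x) \<le> B \<and> cmod (g2 t x) \<le> B))"

lemma B: "B \<ge> 0" and B_circle: "t \<ge> 0 \<Longrightarrow> x \<in> space circle \<Longrightarrow> cmod (\<phi> t x) \<le> B"
  "t \<ge> 0 \<Longrightarrow> x \<in> space circle \<Longrightarrow> cmod (\<psi> t x) \<le> B"
  "t \<ge> 0 \<Longrightarrow> x \<in> space circle \<Longrightarrow> cmod (g t x) \<le> B"
  "t \<ge> 0 \<Longrightarrow> x \<in> space circle \<Longrightarrow> cmod (g2 t x) \<le> B"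
  using someI_ex[OF bounded_exists] unfolding B_def[symmetric] space_circle by auto

lemma continuous_slice:
  assumes "continuous_on ({0..} \<times> UNIV) (\<lambda>(t, x). f t x)" "0 \<le> t"
  shows "continuous_on UNIV (f t :: real \<Rightarrow> complex)"
proof -
  have "continuous_on UNIV ((\<lambda>(t, x). f t x) \<circ> (\<lambda>x. (t, x)))"
    by (intro continuous_on_compose continuous_intros continuous_on_subset[OF assms(1)]) (use assms(2) in auto)
  then show ?thesis by (simp add: comp_def)
qed

lemma measurable_slice:
  assumes "continuous_on ({0..} \<times> UNIV) (\<lambda>(t, x). f t x)" "0 \<le> t"
  shows "(f t :: real \<Rightarrow> complex) \<in> borel_measurable borel"
  using continuous_slice[OF assms] by (rule borel_measurable_continuous_onI)

lemma chord_lip_g: "0 \<le> t \<Longrightarrow> chord_lip (4 * B) (g t)"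
proof (rule lipgI)
  assume t: "0 \<le> t"
  show "periodic_borel (g t)" using measurable_slice[OF g_cont t] g_periodic[OF t] by (simp add: periodic_borel_def periodic_2pi_def)
  have r: "period_rep x \<in> space circle" for x using period_rep_range[of x] by (simp add: space_circle)
  have "cmod (g t x) \<le> B" for x
    using B_circle(3)[OF t r, of x] periodic_period_rep[of "g t" x, OF g_periodic[OF t]] by simp
  then show "cmod (g t x) \<le> 4 * B" for x using B order_trans[of "cmod (g t x)" B "4 * B"] by simp
  show "cmod (g t x - g t y) \<le> 4 * B * sqrt (1 - cos (x - y))" for x y
  proof (rule periodic_chord_lipschitz[OF g_periodic[OF t] g_dx[OF t]])
    show "cmod (g2 t x) \<le> B" for x
      using B_circle(4)[OF t r, of x] periodic_period_rep[of "g2 t" x, OF g2_periodic[OF t]] by simp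
  qed
qed (use B in auto)

definition phihat where "phihat k t = fourier_coeff (\<phi> t) k"
definition psihat where "psihat k t = fourier_coeff (\<psi> t) k"

lemma phihat_pos: "0 \<le> t \<Longrightarrow> k < 1 \<Longrightarrow> phihat k t = 0"
proof -
  assume "0 \<le> t" "k < 1"
  then have "fourier_coeff (\<phi> t) k = indicator {1..} k * fourier_coeff (\<phi> t) k"
    using test unfolding test_function_def time_interval_infinity is_P_plus_def by (metis atLeast_iff)
  then show ?thesis using \<open>k < 1\<close> by (simp add: phihat_def)
qed

lemma hat_bound:
  assumes "\<And>x. x \<in> space circle \<Longrightarrow> cmod (f x) \<le> B" "f \<in> borel_measurable borel"
  shows "cmod (fourier_coeff f k) \<le> B"
proof -
  have "cmod (LINT x|circle. f x * cis (- (of_int k * x))) \<le> (LINT x|circle. B)"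
  proof (rule Bochner_Integration.integral_norm_bound_integral)
    show "integrable circle (\<lambda>x. f x * cis (- (of_int k * x)))"
      using assms periodic_borel_measurable[OF periodic_borel_cis[of "-k"]]
      by (intro circle.integrable_const_bound[where B=B]) (auto simp: norm_mult intro!: AE_I2 measurable_circle_borel)
  qed (use assms in \<open>auto simp: norm_mult\<close>)
  then show ?thesis by (simp add: fourier_coeff_circle measure_circle divide_le_eq mult.commute)
qed

lemma phihat_bound: "0 \<le> t \<Longrightarrow> cmod (phihat k t) \<le> B" and psihat_bound: "0 \<le> t \<Longrightarrow> cmod (psihat k t) \<le> B"
  unfolding phihat_def psihat_def by (auto intro!: hat_bound B_circle measurable_slice phi_cont psi_cont)

lemma phihat_zero: "T \<le> t \<Longrightarrow> phihat k t = 0" and psihat_zero: "T \<le> t \<Longrightarrow> psihat k t = 0"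
  unfolding phihat_def psihat_def fourier_coeff_circle by (simp_all add: T)

lemma hat_continuous:
  fixes f :: "real \<Rightarrow> real \<Rightarrow> complex"
  assumes c: "continuous_on ({0..} \<times> UNIV) (\<lambda>(t, x). f t x)" and b: "\<And>t x. 0 \<le> t \<Longrightarrow> x \<in> space circle \<Longrightarrow> cmod (f t x) \<le> B"
  shows "continuous_on {0..} (\<lambda>t. fourier_coeff (f t) k)"
proof (rule continuous_on_sequentiallyI)
  fix \<tau> :: "nat \<Rightarrow> real" and t assume "t \<in> {0..} " and "\<forall>n. \<tau> n \<in> {0..}" and "\<tau> \<longlonglongrightarrow> t"
  then have t: "0 \<le> t" and tau: "\<And>n. 0 \<le> \<tau> n" "\<tau> \<longlonglongrightarrow> t" by auto
  have m: "(\<lambda>x. cis (- (of_int k * x))) \<in> borel_measurable borel"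
    using periodic_borel_measurable[OF periodic_borel_cis[of "-k"]] by simp
  have "(\<lambda>n. LINT x|circle. f (\<tau> n) x * cis (- (of_int k * x))) \<longlonglongrightarrow> (LINT x|circle. f t x * cis (- (of_int k * x)))"
  proof (rule integral_dominated_convergence)
    show "integrable circle (\<lambda>x. B)" by simp
    show "AE x in circle. (\<lambda>n. f (\<tau> n) x * cis (- (of_int k * x))) \<longlonglongrightarrow> f t x * cis (- (of_int k * x))"
    proof (intro AE_I2 tendsto_mult tendsto_const)
      fix x
      have "(\<lambda>n. (\<lambda>(t, x). f t x) (\<tau> n, x)) \<longlonglongrightarrow> (\<lambda>(t, x). f t x) (t, x)"
        by (rule continuous_on_tendsto_compose[OF c]) (use t tau in \<open>auto intro!: tendsto_intros\<close>)
      then show "(\<lambda>n. f (\<tau> n) x) \<longlonglongrightarrow> f t x" by simp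
    qed
    show "AE x in circle. norm (f (\<tau> n) x * cis (- (of_int k * x))) \<le> B" for n
      by (intro AE_I2) (use b tau in \<open>auto simp: norm_mult\<close>)
  qed (use m measurable_slice[OF c] t tau in \<open>auto intro!: measurable_circle_borel\<close>)
  then show "(\<lambda>n. fourier_coeff (f (\<tau> n)) k) \<longlonglongrightarrow> fourier_coeff (f t) k"
    unfolding fourier_coeff_circle by (intro tendsto_intros)
qed

lemma phihat_continuous: "continuous_on {0..} (phihat k)"
  unfolding phihat_def[abs_def] by (rule hat_continuous[OF phi_cont B_circle(1)])

lemma psihat_continuous: "continuous_on {0..} (psihat k)"
  unfolding psihat_def[abs_def] by (rule hat_continuous[OF psi_cont B_circle(2)])

lemma integral_circle_FTC:
  fixes F f :: "real \<Rightarrow> complex"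
  assumes d: "\<And>x. (F has_vector_derivative f x) (at x)" and c: "continuous_on UNIV f"
  shows "(LINT x|circle. f x) = F (2 * pi) - F 0"
proof -
  have "integrable circle f"
  proof -
    have "bounded (f ` {0..2 * pi})"
      by (intro compact_imp_bounded compact_continuous_image continuous_on_subset[OF c]) auto
    then have "\<exists>b. \<forall>x\<in>{0..2 * pi}. cmod (f x) \<le> b" by (auto simp: bounded_iff)
    then obtain b where "\<And>x. x \<in> {0..2 * pi} \<Longrightarrow> cmod (f x) \<le> b" by blast
    then show ?thesis using borel_measurable_continuous_onI[OF c]
      by (intro circle.integrable_const_bound[where B=b]) (auto simp: space_circle intro!: AE_I2 measurable_circle_borel)
  qed
  then have "(LINT x|circle. f x) = integral {0..2 * pi} f"
    unfolding circle_def by (rule lebesgue_integral_eq_integral) simp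
  also have "\<dots> = F (2 * pi) - F 0"
    by (intro integral_unique fundamental_theorem_of_calculus) (auto intro: has_vector_derivative_at_within d)
  finally show ?thesis .
qed

lemma fourier_coeff_g:
  assumes t: "0 \<le> t"
  shows "fourier_coeff (g t) k = \<i> * of_int k * phihat k t"
proof -
  define e where "e x = cis (- (of_int k * x))" for x
  have de: "(e has_vector_derivative (- \<i> * of_int k * e x)) (at x)" for x
  proof -
    have "((\<lambda>z. exp (- (\<i> * of_int k * z))) has_field_derivative (- \<i> * of_int k * exp (- (\<i> * of_int k * of_real x)))) (at (of_real x))"
      by (auto intro!: derivative_eq_intros)
    from has_vector_derivative_real_field[OF this] show ?thesis
      by (simp add: e_def[abs_def] cis_conv_exp mult.assoc)
  qed
  have ec: "continuous_on UNIV e" unfolding e_def cis_conv_exp by (intro continuous_intros)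
  have eper: "e (2 * pi) = e 0"
    using periodic_borel_periodic[OF periodic_borel_cis[of "-k"], of 0] by (simp add: e_def)
  have bounds: "integrable circle (\<lambda>x. g t x * e x)" "integrable circle (\<lambda>x. \<phi> t x * (- \<i> * of_int k * e x))"
  proof -
    have ne: "cmod (e x) = 1" for x by (simp add: e_def)
    have me: "e \<in> borel_measurable borel" by (rule borel_measurable_continuous_onI[OF ec])
    have "integrable circle (g t)" "integrable circle (\<phi> t)"
      by (intro circle.integrable_const_bound[where B=B] AE_I2 B_circle t measurable_circle_borel measurable_slice g_cont phi_cont; simp)+
    then show "integrable circle (\<lambda>x. g t x * e x)" "integrable circle (\<lambda>x. \<phi> t x * (- \<i> * of_int k * e x))"
      using me by (auto intro!: integrable_circle_mult_bounded(1)[where B="1 + \<bar>of_int k\<bar>"] simp: norm_mult ne)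
  qed
  have "(LINT x|circle. g t x * e x + \<phi> t x * (- \<i> * of_int k * e x)) = \<phi> t (2 * pi) * e (2 * pi) - \<phi> t 0 * e 0"
  proof (rule integral_circle_FTC)
    show "((\<lambda>x. \<phi> t x * e x) has_vector_derivative g t x * e x + \<phi> t x * (- \<i> * of_int k * e x)) (at x)" for x
      using has_vector_derivative_mult[OF phi_dx[OF t, of x] de[of x]] by (simp add: add.commute)
    show "continuous_on UNIV (\<lambda>x. g t x * e x + \<phi> t x * (- \<i> * of_int k * e x))"
      by (intro continuous_intros ec continuous_slice[OF g_cont t] continuous_slice[OF phi_cont t])
  qed
  also have "\<dots> = 0" using phi_periodic[OF t, of 0] eper by simp
  finally have "(LINT x|circle. g t x * e x) + (LINT x|circle. \<phi> t x * (- \<i> * of_int k * e x)) = 0"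
    using bounds by simp
  moreover have "(LINT x|circle. \<phi> t x * (- \<i> * of_int k * e x)) = - \<i> * of_int k * (LINT x|circle. \<phi> t x * e x)"
  proof -
    have "(\<lambda>x. \<phi> t x * (- \<i> * of_int k * e x)) = (\<lambda>x. (- \<i> * of_int k) * (\<phi> t x * e x))" by (simp add: mult_ac)
    then show ?thesis by (simp only: Bochner_Integration.integral_mult_right_zero)
  qed
  ultimately have "(LINT x|circle. g t x * e x) = \<i> * of_int k * (LINT x|circle. \<phi> t x * e x)"
    by (simp add: add_eq_0_iff)
  then show ?thesis unfolding phihat_def fourier_coeff_circle e_def[symmetric] by (simp add: scaleR_conv_of_real)
qed

lemma phi_time_integral:
  assumes s: "0 \<le> s"
  shows "\<phi> s x = - (LINT \<tau>|lborel. indicator {s<..T} \<tau> *\<^sub>R \<psi> \<tau> x)"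
proof (cases "s \<le> T")
  case True
  have c: "continuous_on {s..T} (\<lambda>\<tau>. \<psi> \<tau> x)"
  proof -
    have "continuous_on {s..T} ((\<lambda>(t, x). \<psi> t x) \<circ> (\<lambda>t. (t, x)))"
      by (intro continuous_on_compose continuous_intros continuous_on_subset[OF psi_cont]) (use s in auto)
    then show ?thesis by (simp add: comp_def)
  qed
  have "(LINT \<tau>|lborel. indicator {s<..T} \<tau> *\<^sub>R \<psi> \<tau> x) = (LINT \<tau>|lborel. indicator {s..T} \<tau> *\<^sub>R \<psi> \<tau> x)"
  proof (rule integral_cong_AE)
    show m: "(\<lambda>\<tau>. indicator {s..T} \<tau> *\<^sub>R \<psi> \<tau> x) \<in> borel_measurable lborel"
      using borel_measurable_continuous_on_indicator[OF _ c] by simp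
    have "(\<lambda>\<tau>. indicator {s<..T} \<tau> *\<^sub>R (indicator {s..T} \<tau> *\<^sub>R \<psi> \<tau> x)) \<in> borel_measurable lborel"
      by (rule borel_measurable_scaleR[OF borel_measurable_indicator m]) simp
    moreover have "(\<lambda>\<tau>. indicator {s<..T} \<tau> *\<^sub>R (indicator {s..T} \<tau> *\<^sub>R \<psi> \<tau> x)) = (\<lambda>\<tau>. indicator {s<..T} \<tau> *\<^sub>R \<psi> \<tau> x)"
      by (auto simp: indicator_def)
    ultimately show "(\<lambda>\<tau>. indicator {s<..T} \<tau> *\<^sub>R \<psi> \<tau> x) \<in> borel_measurable lborel" by simp
    show "AE \<tau> in lborel. indicator {s<..T} \<tau> *\<^sub>R \<psi> \<tau> x = indicator {s..T} \<tau> *\<^sub>R \<psi> \<tau> x"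
      using AE_lborel_singleton[of s] by eventually_elim (auto simp: indicator_def)
  qed
  also have "\<dots> = integral {s..T} (\<lambda>\<tau>. \<psi> \<tau> x)"
    using set_borel_integral_eq_integral(2)[OF borel_integrable_atLeastAtMost'[OF c]]
    by (simp add: set_lebesgue_integral_def)
  also have "\<dots> = \<phi> T x - \<phi> s x"
    by (intro integral_unique fundamental_theorem_of_calculus True has_vector_derivative_within_subset[OF phi_dt])
       (use s in auto)
  finally show ?thesis using T(2)[of T x] by simp
next
  case False
  then show ?thesis using T(2)[of s x] by simp
qed

text \<open>The hypothesis for Fubini's theorem in \<open>phihat_time_integral\<close>.\<close>

lemma psi_integrable_product:
  assumes "0 \<le> s"
  shows "integrable (lborel \<Otimes>\<^sub>M circle) (\<lambda>(\<tau>, x). indicator {s<..T} \<tau> *\<^sub>R \<psi> \<tau> x * cis (- (of_int k * x)))"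
proof (rule Bochner_Integration.integrable_bound)
  let ?A = "{0..T} \<times> space circle"
  have "emeasure (lborel \<Otimes>\<^sub>M circle) ?A = emeasure lborel {0..T} * emeasure circle (space circle)"
    by (rule circle.emeasure_pair_measure_Times) auto
  also have "\<dots> < \<infinity>"
    using finite_lborel_Ico by (simp add: emeasure_circle ennreal_mult_less_top)
  finally have "emeasure (lborel \<Otimes>\<^sub>M circle) ?A < \<infinity>" .
  then show "integrable (lborel \<Otimes>\<^sub>M circle) (\<lambda>z. indicator ?A z *\<^sub>R B)"
    by (intro integrable_scaleR_left) (auto simp: integrable_indicator_iff)
  have \<Psi>: "(\<lambda>z. indicator ({0..} \<times> UNIV) z *\<^sub>R (\<lambda>(\<tau>, x). \<psi> \<tau> x) z) \<in> borel_measurable (borel \<Otimes>\<^sub>M borel)"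
    unfolding borel_prod by (rule borel_measurable_continuous_on_indicator[OF _ psi_cont]) (auto intro!: borel_closed closed_Times)
  have i: "(\<lambda>z. (fst z, snd z)) \<in> lborel \<Otimes>\<^sub>M circle \<rightarrow>\<^sub>M borel \<Otimes>\<^sub>M borel"
    by (intro measurable_Pair) (auto intro: measurable_compose[OF measurable_fst])
  have 1: "(\<lambda>z. indicator ({0..} \<times> UNIV) z *\<^sub>R \<psi> (fst z) (snd z)) \<in> borel_measurable (lborel \<Otimes>\<^sub>M circle)"
    using measurable_compose[OF i \<Psi>] by (simp add: split_beta')
  have 2: "(\<lambda>z. cis (- (of_int k * snd z))) \<in> borel_measurable (lborel \<Otimes>\<^sub>M circle)"
    using measurable_compose[OF measurable_snd_circle periodic_borel_measurable[OF periodic_borel_cis[of "-k"]], of lborel] by simp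
  have 3: "(\<lambda>z. indicator {s<..T} (fst z) :: real) \<in> borel_measurable (lborel \<Otimes>\<^sub>M circle)"
    by (intro measurable_compose[OF measurable_fst]) simp
  have "(\<lambda>z. indicator {s<..T} (fst z) *\<^sub>R (indicator ({0..} \<times> UNIV) z *\<^sub>R \<psi> (fst z) (snd z)) * cis (- (of_int k * snd z)))
    \<in> borel_measurable (lborel \<Otimes>\<^sub>M circle)"
    by (intro borel_measurable_times borel_measurable_scaleR 1 2 3)
  moreover have "(\<lambda>z. indicator {s<..T} (fst z) *\<^sub>R (indicator ({0..} \<times> UNIV) z *\<^sub>R \<psi> (fst z) (snd z)) * cis (- (of_int k * snd z)))
     = (\<lambda>(\<tau>, x). indicator {s<..T} \<tau> *\<^sub>R \<psi> \<tau> x * cis (- (of_int k * x)))"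
    using assms by (auto simp: indicator_def split_beta')
  ultimately show "(\<lambda>(\<tau>, x). indicator {s<..T} \<tau> *\<^sub>R \<psi> \<tau> x * cis (- (of_int k * x))) \<in> borel_measurable (lborel \<Otimes>\<^sub>M circle)"
    by simp
  show "AE z in lborel \<Otimes>\<^sub>M circle. norm ((\<lambda>(\<tau>, x). indicator {s<..T} \<tau> *\<^sub>R \<psi> \<tau> x * cis (- (of_int k * x))) z) \<le> norm (indicator ?A z *\<^sub>R B)"
  proof (rule AE_I2)
    fix z :: "real \<times> real" assume "z \<in> space (lborel \<Otimes>\<^sub>M circle)"
    then obtain \<tau> x where z: "z = (\<tau>, x)" "x \<in> space circle" by (auto simp: space_pair_measure)
    show "norm ((\<lambda>(\<tau>, x). indicator {s<..T} \<tau> *\<^sub>R \<psi> \<tau> x * cis (- (of_int k * x))) z) \<le> norm (indicator ?A z *\<^sub>R B)"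
    proof (cases "s < \<tau> \<and> \<tau> \<le> T")
      case True
      then show ?thesis using B_circle(2)[of \<tau> x] z B assms by (simp add: norm_mult)
    qed (auto simp: z indicator_def)
  qed
qed

interpretation LC: pair_sigma_finite lborel circle by unfold_locales

text \<open>The fundamental theorem of calculus from time \<open>s\<close> to \<open>T\<close>, where the test function vanishes, combined
with Fubini's theorem; this avoids differentiating under the integral sign.\<close>

lemma phihat_time_integral:
  assumes s: "0 \<le> s"
  shows "phihat k s = - (LINT \<tau>|lborel. indicator {s<..T} \<tau> *\<^sub>R psihat k \<tau>)"
proof -
  let ?e = "\<lambda>x. cis (- (of_int k * x))"
  have "(LINT x|circle. \<phi> s x * ?e x) = (LINT x|circle. - (LINT \<tau>|lborel. indicator {s<..T} \<tau> *\<^sub>R \<psi> \<tau> x * ?e x))"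
    unfolding integral_mult_left_zero phi_time_integral[OF s] by simp
  also have "\<dots> = - (LINT x|circle. (LINT \<tau>|lborel. indicator {s<..T} \<tau> *\<^sub>R \<psi> \<tau> x * ?e x))"
    by simp
  also have "(LINT x|circle. (LINT \<tau>|lborel. indicator {s<..T} \<tau> *\<^sub>R \<psi> \<tau> x * ?e x))
    = (LINT \<tau>|lborel. (LINT x|circle. indicator {s<..T} \<tau> *\<^sub>R \<psi> \<tau> x * ?e x))"
    by (rule LC.Fubini_integral[OF psi_integrable_product[OF s]])
  also have "\<dots> = (LINT \<tau>|lborel. of_real (2 * pi) * (indicator {s<..T} \<tau> *\<^sub>R psihat k \<tau>))"
    by (intro Bochner_Integration.integral_cong refl) (simp add: psihat_def fourier_coeff_circle scaleR_conv_of_real mult.assoc)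
  also have "\<dots> = of_real (2 * pi) * (LINT \<tau>|lborel. indicator {s<..T} \<tau> *\<^sub>R psihat k \<tau>)"
    by (rule Bochner_Integration.integral_mult_right_zero)
  finally show ?thesis by (simp add: phihat_def fourier_coeff_circle scaleR_conv_of_real)
qed

lemma trig_pairing:
  assumes v: "v \<in> borel_measurable borel" "\<And>x. x \<in> space circle \<Longrightarrow> cmod (v x) \<le> B" and A: "finite A"
  shows "(LINT x|circle. trig A a x * cnj (v x)) = (\<Sum>k\<in>A. 2 * of_real pi * a k * cnj (fourier_coeff v k))"
proof -
  have i: "integrable circle (\<lambda>x. cnj (v x) * cis (of_int k * x))" for k
  proof (rule circle.integrable_const_bound[where B=B])
    show "(\<lambda>x. cnj (v x) * cis (of_int k * x)) \<in> borel_measurable circle"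
      using v(1) periodic_borel_measurable[OF periodic_borel_cis[of k]]
      by (intro measurable_circle_borel borel_measurable_times measurable_compose[OF _ measurable_cnj]) auto
  qed (auto intro!: AE_I2 simp: norm_mult v)
  have "cnj (LINT x|circle. v x * cis (- (of_int k * x))) = (LINT x|circle. cnj (v x) * cis (of_int k * x))" for k
    using Bochner_Integration.integral_cnj[of circle "\<lambda>x. v x * cis (- (of_int k * x))"] by (simp add: cis_cnj)
  then have fc: "2 * of_real pi * cnj (fourier_coeff v k) = (LINT x|circle. cnj (v x) * cis (of_int k * x))" for k
    by (simp add: fourier_coeff_circle scaleR_conv_of_real)
  have "(LINT x|circle. trig A a x * cnj (v x)) = (LINT x|circle. (\<Sum>k\<in>A. a k * (cnj (v x) * cis (of_int k * x))))"
    unfolding trig_def sum_distrib_right by (intro Bochner_Integration.integral_cong refl sum.cong) (auto simp: mult_ac)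
  also have "\<dots> = (\<Sum>k\<in>A. a k * (LINT x|circle. cnj (v x) * cis (of_int k * x)))"
    by (subst Bochner_Integration.integral_sum) (auto intro!: integrable_mult_right i)
  also have "\<dots> = (\<Sum>k\<in>A. 2 * of_real pi * a k * cnj (fourier_coeff v k))"
    unfolding fc[symmetric] by (intro sum.cong) (auto simp: mult_ac)
  finally show ?thesis .
qed

end

section \<open>The weak formulation\<close>

lemma L4_fejer_sum_le:
  assumes "bounded_spectrum a C" "M > 0"
  shows "L4 (fejer_sum M a) \<le> ennreal (16 * C)"
proof -
  interpret bounded_spectrum a C by fact
  have "L4 (\<lambda>x. fejer_sum M a x - fejer_sum 1 a x) \<le> ennreal (8 * (C / (pi * real 1) + C / (pi * real M)))"
    by (rule fejer_sum_L4_cauchy) (use assms in auto)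
  also have "\<dots> \<le> ennreal (16 * C)"
  proof (rule ennreal_leI)
    have "C / (pi * real N) \<le> C / 1" if "N > 0" for N :: nat
    proof (rule divide_left_mono)
      have "1 * 1 \<le> pi * real N" using that pi_gt3 by (intro mult_mono) auto
      then show "1 \<le> pi * real N" by simp
    qed (use C0 that in auto)
    from this[of 1] this[OF assms(2)] show "8 * (C / (pi * real 1) + C / (pi * real M)) \<le> 16 * C" by simp
  qed
  finally have "L4 (\<lambda>x. fejer_sum M a x - fejer_sum 1 a x) \<le> ennreal (16 * C)" .
  moreover have "fejer_sum 1 a x = 0" for x by (simp add: fejer_sum_def trig_def)
  ultimately show ?thesis by (simp only: diff_zero)
qed

context mode_solution
begin

text \<open>The Fejer sums of \<open>u\<close> depend continuously on time, and the form is continuous. The coupling constant is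
arbitrary here and below because the two parts of the form have to be integrated in time separately.\<close>

lemma nonlin_form_fejer_sum_continuous:
  assumes M: "M > 0"
  shows "continuous_on {0..} (\<lambda>t. nonlin_form \<sigma>' (fejer_sum M (u t)) (\<lambda>x. cis (of_int k * x)))"
proof (rule continuous_on_sequentiallyI)
  fix \<tau> :: "nat \<Rightarrow> real" and t assume "t \<in> {0..}" and "\<forall>n. \<tau> n \<in> {0..}" and lim: "\<tau> \<longlonglongrightarrow> t"
  then have t: "0 \<le> t" and tau: "0 \<le> \<tau> n" for n by auto
  define X where "X n = (\<Sum>j\<in>{1..<int M}. cmod (of_real (1 - of_int j / real M) * (u (\<tau> n) j - u t j)))" for n
  have X0: "0 \<le> X n" for n by (simp add: X_def sum_nonneg)
  have bd: "W_energy (fejer_sum M (u s)) \<le> ennreal (16 * C)" "L4 (fejer_sum M (u s)) \<le> ennreal (16 * C)" if "0 \<le> s" for s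
  proof -
    have "W_energy (fejer_sum M (u s)) \<le> ennreal C" by (rule bounded_spectrum.bd[OF spectrum[OF that] M])
    also have "\<dots> \<le> ennreal (16 * C)" using C0 by (intro ennreal_leI) simp
    finally show "W_energy (fejer_sum M (u s)) \<le> ennreal (16 * C)" .
    show "L4 (fejer_sum M (u s)) \<le> ennreal (16 * C)" by (rule L4_fejer_sum_le[OF spectrum[OF that] M])
  qed
  show "(\<lambda>n. nonlin_form \<sigma>' (fejer_sum M (u (\<tau> n))) (\<lambda>x. cis (of_int k * x))) \<longlonglongrightarrow> nonlin_form \<sigma>' (fejer_sum M (u t)) (\<lambda>x. cis (of_int k * x))"
  proof (rule nonlin_form_tendsto[where B="\<lambda>n. 8 * X n ^ 4" and C="16 * C"])
    show "L4 (\<lambda>x. fejer_sum M (u (\<tau> n)) x - fejer_sum M (u t) x) \<le> ennreal (8 * X n ^ 4)" for n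
    proof (rule L4_bounded)
      fix x
      have eq: "fejer_sum M (u (\<tau> n)) x - fejer_sum M (u t) x
        = (\<Sum>j\<in>{1..<int M}. of_real (1 - of_int j / real M) * (u (\<tau> n) j - u t j) * cis (of_int j * x))"
        unfolding fejer_sum_def trig_def sum_subtractf[symmetric] by (intro sum.cong) (auto simp: algebra_simps)
      have "cmod (fejer_sum M (u (\<tau> n)) x - fejer_sum M (u t) x)
        \<le> (\<Sum>j\<in>{1..<int M}. cmod (of_real (1 - of_int j / real M) * (u (\<tau> n) j - u t j) * cis (of_int j * x)))"
        unfolding eq by (rule norm_sum)
      also have "\<dots> = X n" unfolding X_def by (intro sum.cong refl) (simp only: norm_mult norm_cis mult_1_right)
      finally show "cmod (fejer_sum M (u (\<tau> n)) x - fejer_sum M (u t) x) \<le> X n" .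
    qed
    have "(\<lambda>n. u (\<tau> n) j) \<longlonglongrightarrow> u t j" for j
      by (rule continuous_on_tendsto_compose[OF u_continuous lim]) (use t tau in auto)
    then have "(\<lambda>n. 8 * X n ^ 4) \<longlonglongrightarrow> 8 * (\<Sum>j\<in>{1..<int M}. cmod (of_real (1 - of_int j / real M) * (u t j - u t j))) ^ 4"
      unfolding X_def by (intro tendsto_intros)
    then show "(\<lambda>n. 8 * X n ^ 4) \<longlonglongrightarrow> 0" by simp
  qed (use bd t tau C0 X0 chord_lip_cis in auto)
qed

lemma nonlin_form_mode_measurable: "(\<lambda>t. nonlin_form \<sigma>' (U t) (\<lambda>x. cis (of_int k * x))) \<in> borel_measurable half_line"
proof (rule borel_measurable_LIMSEQ_metric)
  show "(\<lambda>t. nonlin_form \<sigma>' (fejer_sum (Suc n) (u t)) (\<lambda>x. cis (of_int k * x))) \<in> borel_measurable half_line" for n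
    by (rule continuous_measurable_half_line[OF nonlin_form_fejer_sum_continuous]) simp
  fix t assume "t \<in> space half_line"
  then have t: "0 \<le> t" by simp
  interpret bounded_spectrum "u t" C by (rule spectrum[OF t])
  have CC: "ennreal C \<le> ennreal (16 * C)" using C0 by (intro ennreal_leI) simp
  show "(\<lambda>n. nonlin_form \<sigma>' (fejer_sum (Suc n) (u t)) (\<lambda>x. cis (of_int k * x))) \<longlonglongrightarrow> nonlin_form \<sigma>' (U t) (\<lambda>x. cis (of_int k * x))"
  proof (rule nonlin_form_tendsto[where B="\<lambda>n. C / pi * inverse (real (Suc n))" and C="16 * C"])
    show "L4 (\<lambda>x. fejer_sum (Suc n) (u t) x - U t x) \<le> ennreal (C / pi * inverse (real (Suc n)))" for n
      using L4_fejer_limit_error[of "Suc n"] by (simp add: U_def field_simps)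
    show "(\<lambda>n. C / pi * inverse (real (Suc n))) \<longlonglongrightarrow> 0"
      using tendsto_mult_right_zero[OF LIMSEQ_inverse_real_of_nat] by blast
    show "L4 (fejer_sum (Suc n) (u t)) \<le> ennreal (16 * C)" for n
      by (rule L4_fejer_sum_le[OF spectrum[OF t]]) simp
    show "W_energy (fejer_sum (Suc n) (u t)) \<le> ennreal (16 * C)" for n
      using order_trans[OF bd CC] by simp
    show "W_energy (U t) \<le> ennreal (16 * C)" "L4 (U t) \<le> ennreal (16 * C)"
      using order_trans[OF U(2)[OF t] CC] order_trans[OF U(3)[OF t] CC] by auto
    show "chord_lip (2 * (\<bar>of_int k\<bar> + 1)) (\<lambda>x. cis (of_int k * x))" by (rule chord_lip_cis)
  qed (use U(1)[OF t] C0 in auto)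
qed

end

locale weak_setting = mode_solution + test_fun
begin

text \<open>Integration by parts in time. Insert the integrated equation for \<open>u t k\<close> and exchange the order of the two
time integrals: the inner integral of the coefficient of \<open>\<partial>\<^sub>t\<phi>\<close> is then the coefficient of \<open>-\<phi>\<close>.\<close>

lemma mode_identity:
  assumes k: "1 \<le> k"
  shows "c k * cnj (phihat k 0) + (LINT t|half_line. u t k * cnj (psihat k t)) = - (LINT t|half_line. G k t * cnj (phihat k t))"
proof -
  define p where "p \<tau> = indicator {0..T} \<tau> *\<^sub>R cnj (psihat k \<tau>)" for \<tau> :: real
  define K where "K s t = indicator {0..<t} s * G k s * p t" for s t :: real
  have pb: "p \<in> borel_measurable borel"
    unfolding p_def by (rule borel_measurable_continuous_on_indicator)
      (auto intro!: continuous_intros continuous_on_subset[OF psihat_continuous])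
  note [measurable] = pb G_meas[OF k]
  have pbound: "cmod (p \<tau>) \<le> B * indicator {0..T} \<tau>" for \<tau>
    using psihat_bound[of \<tau> k] B by (auto simp: p_def indicator_def)
  have pint: "integrable lborel p"
  proof (rule Bochner_Integration.integrable_bound)
    show "integrable lborel (\<lambda>t. indicator {0..T} t *\<^sub>R B)"
      by (rule integrable_scaleR_left) (use finite_lborel_Ico in \<open>auto simp: integrable_indicator_iff\<close>)
    show "AE t in lborel. norm (p t) \<le> norm (indicator {0..T} t *\<^sub>R B)"
      using pbound B by (intro AE_I2) (simp add: mult.commute)
  qed simp
  have ptail: "(LINT t|lborel. indicator {s<..} t * p t) = - cnj (phihat k s)" if s: "0 \<le> s" for s
  proof -
    have "(LINT t|lborel. indicator {s<..} t * p t) = (LINT t|lborel. cnj (indicator {s<..T} t *\<^sub>R psihat k t))"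
      by (intro Bochner_Integration.integral_cong refl) (use s in \<open>auto simp: p_def indicator_def\<close>)
    also have "\<dots> = cnj (LINT t|lborel. indicator {s<..T} t *\<^sub>R psihat k t)"
      by (rule Bochner_Integration.integral_cnj)
    also have "\<dots> = - cnj (phihat k s)" using phihat_time_integral[OF s, of k] by simp
    finally show ?thesis .
  qed
  have p0: "(LINT t|lborel. p t) = - cnj (phihat k 0)"
  proof -
    have "(LINT t|lborel. p t) = (LINT t|lborel. indicator {0<..} t * p t)"
    proof (rule integral_cong_AE)
      show "AE t in lborel. p t = indicator {0<..} t * p t"
        using AE_lborel_singleton[of 0] by eventually_elim (auto simp: p_def indicator_def)
    qed simp_all
    then show ?thesis using ptail[of 0] by simp
  qed
  have Kint: "integrable (lborel \<Otimes>\<^sub>M lborel) (case_prod K)"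
  proof (rule Bochner_Integration.integrable_bound)
    let ?A = "{0..T} \<times> {0..T}"
    have "emeasure (lborel \<Otimes>\<^sub>M lborel) ?A = emeasure lborel {0..T} * emeasure lborel {0..T}"
      by (rule lborel.emeasure_pair_measure_Times) auto
    also have "\<dots> < \<infinity>" using finite_lborel_Ico by (simp add: ennreal_mult_less_top)
    finally have "emeasure (lborel \<Otimes>\<^sub>M lborel) ?A < \<infinity>" .
    then show "integrable (lborel \<Otimes>\<^sub>M lborel) (\<lambda>z. indicator ?A z *\<^sub>R (V k * B))"
      by (intro integrable_scaleR_left) (auto simp: integrable_indicator_iff)
    have "case_prod K = (\<lambda>z. (if 0 \<le> fst z \<and> fst z < snd z then 1 else 0) * G k (fst z) * p (snd z))"
      by (auto simp: K_def indicator_def)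
    moreover have "(\<lambda>z. (if 0 \<le> fst z \<and> fst z < snd z then 1 else 0) * G k (fst z) * p (snd z)) \<in> borel_measurable (borel \<Otimes>\<^sub>M borel)"
      by measurable
    ultimately show "case_prod K \<in> borel_measurable (lborel \<Otimes>\<^sub>M lborel)" by simp
    show "AE z in lborel \<Otimes>\<^sub>M lborel. norm (case_prod K z) \<le> norm (indicator ?A z *\<^sub>R (V k * B))"
    proof (intro AE_I2)
      fix z :: "real \<times> real"
      obtain s t where z: "z = (s, t)" by force
      show "norm (case_prod K z) \<le> norm (indicator ?A z *\<^sub>R (V k * B))"
      proof (cases "0 \<le> s \<and> s < t \<and> t \<le> T")
        case True
        have "cmod (G k s) * cmod (p t) \<le> V k * B"
          using G_bound[OF k, of s] pbound[of t] True V0[of k] B by (intro mult_mono) (auto simp: indicator_def)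
        then show ?thesis using True V0[of k] B by (simp add: z K_def norm_mult)
      next
        case False
        then have "K s t = 0" by (auto simp: K_def p_def indicator_def)
        then show ?thesis by (simp add: z)
      qed
    qed
  qed
  \<comment> \<open>\<open>K s t\<close> is the integrand of the double time integral; it is supported in \<open>0 \<le> s < t \<le> T\<close>.\<close>
  have uk: "indicator {0..} t *\<^sub>R (u t k * cnj (psihat k t)) = c k * p t + (LINT s|lborel. K s t)" for t
  proof (cases "0 \<le> t \<and> t \<le> T")
    case True
    then have "(LINT s|lborel. K s t) = (LINT s|lborel. indicator {0..<t} s * G k s) * p t"
      unfolding K_def by (subst integral_mult_left_zero[symmetric]) simp
    then show ?thesis using True u_integral[of t k] k by (simp add: p_def algebra_simps)
  next
    case False
    then have "p t = 0" by (simp add: p_def)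
    moreover have "indicator {0..} t *\<^sub>R (u t k * cnj (psihat k t)) = 0" using False psihat_zero[of t k] by (auto simp: indicator_def)
    ultimately show ?thesis by (simp add: K_def)
  qed
  have um: "(\<lambda>t. indicator {0..} t *\<^sub>R (u t k * cnj (psihat k t))) \<in> borel_measurable borel"
    by (rule borel_measurable_continuous_on_indicator)
      (auto intro!: continuous_intros u_continuous psihat_continuous)
  have "(LINT t|half_line. u t k * cnj (psihat k t)) = (LINT t|lborel. c k * p t + (LINT s|lborel. K s t))"
    unfolding integral_half_line[OF um] uk ..
  also have "\<dots> = c k * (LINT t|lborel. p t) + (LINT t|lborel. (LINT s|lborel. K s t))"
    using pint lborel_pair.integrable_snd[OF Kint] by simp
  also have "(LINT t|lborel. (LINT s|lborel. K s t)) = (LINT s|lborel. (LINT t|lborel. K s t))"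
    by (rule lborel_pair.Fubini_integral[OF Kint])
  also have "\<dots> = (LINT s|lborel. - (indicator {0..} s *\<^sub>R (G k s * cnj (phihat k s))))"
  proof (intro Bochner_Integration.integral_cong refl)
    fix s :: real
    have "(LINT t|lborel. K s t) = (LINT t|lborel. (indicator {0..} s * G k s) * (indicator {s<..} t * p t))"
      by (intro Bochner_Integration.integral_cong refl) (auto simp: K_def indicator_def)
    also have "\<dots> = (indicator {0..} s * G k s) * (LINT t|lborel. indicator {s<..} t * p t)"
      by (rule Bochner_Integration.integral_mult_right_zero)
    also have "\<dots> = - (indicator {0..} s *\<^sub>R (G k s * cnj (phihat k s)))"
      using ptail[of s] by (auto simp: indicator_def)
    finally show "(LINT t|lborel. K s t) = - (indicator {0..} s *\<^sub>R (G k s * cnj (phihat k s)))" .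
  qed
  also have "\<dots> = - (LINT s|half_line. G k s * cnj (phihat k s))"
  proof -
    have "(\<lambda>t. indicator {0..} t *\<^sub>R cnj (phihat k t)) \<in> borel_measurable borel"
      by (rule borel_measurable_continuous_on_indicator) (auto intro!: continuous_intros phihat_continuous)
    from borel_measurable_times[OF G_meas[OF k] this]
    have "(\<lambda>t. G k t * (indicator {0..} t *\<^sub>R cnj (phihat k t))) \<in> borel_measurable borel" .
    then have "(\<lambda>t. indicator {0..} t *\<^sub>R (G k t * cnj (phihat k t))) \<in> borel_measurable borel" by (simp only: mult_scaleR_right)
    from integral_half_line[OF this] show ?thesis by simp
  qed
  finally show ?thesis unfolding p0 by (simp only:) simp
qed

lemma integrable_u_psihat: "integrable half_line (\<lambda>t. u t k * cnj (psihat k t))"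
proof (rule integrable_half_line_bounded[where A="C * B" and T=T])
  show "(\<lambda>t. u t k * cnj (psihat k t)) \<in> borel_measurable half_line"
    by (rule continuous_measurable_half_line) (intro continuous_intros u_continuous psihat_continuous)
  show "cmod (u t k * cnj (psihat k t)) \<le> C * B * indicator {0..T} t" if "0 \<le> t" for t
  proof (cases "t \<le> T")
    case True
    have "cmod (u t k) * cmod (psihat k t) \<le> C * B"
      using that C0 by (intro mult_mono u_bound psihat_bound) auto
    then show ?thesis using True that by (simp add: norm_mult)
  qed (use psihat_zero in \<open>auto simp: indicator_def\<close>)
qed

lemma integrable_G_phihat:
  assumes "1 \<le> k"
  shows "integrable half_line (\<lambda>t. G k t * cnj (phihat k t))"
proof (rule integrable_half_line_bounded[where A="V k * B" and T=T])
  have "(\<lambda>t. cnj (phihat k t)) \<in> borel_measurable half_line"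
    by (rule continuous_measurable_half_line) (intro continuous_intros phihat_continuous)
  then show "(\<lambda>t. G k t * cnj (phihat k t)) \<in> borel_measurable half_line"
    using measurable_half_line[OF G_meas[OF assms]] by simp
  show "cmod (G k t * cnj (phihat k t)) \<le> V k * B * indicator {0..T} t" if "0 \<le> t" for t
  proof (cases "t \<le> T")
    case True
    have "cmod (G k t) * cmod (phihat k t) \<le> V k * B"
      using that V0[of k] assms by (intro mult_mono G_bound phihat_bound) auto
    then show ?thesis using True that by (simp add: norm_mult)
  qed (use phihat_zero in \<open>auto simp: indicator_def\<close>)
qed

lemma g_integrable: "0 \<le> t \<Longrightarrow> integrable circle (g t)"
  using lipgD(1,3)[OF chord_lip_g] by (intro integrable_circle_bounded[where B="4 * B"] periodic_borel_measurable)

lemma fejer_mean_g: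
  assumes t: "0 \<le> t"
  shows "fejer_mean M (g t) = trig {1..<int M} (\<lambda>k. of_real (1 - of_int k / real M) * (\<i> * of_int k * phihat k t))"
proof -
  have "fejer_mean M (g t) = fejer_sum M (fourier_coeff (g t))"
    using phihat_pos[OF t] by (intro fejer_mean_eq_fejer_sum lipgD(1)[OF chord_lip_g[OF t]] g_integrable t) (simp add: fourier_coeff_g[OF t])
  then show ?thesis unfolding fejer_sum_def fourier_coeff_g[OF t] .
qed

lemma fejer_mean_chord_lip:
  assumes g: "chord_lip L v" and M: "M > 0"
  shows "chord_lip L (fejer_mean M v)"
proof (rule lipgI)
  have iv: "integrable circle v" using lipgD(1,3)[OF g] by (intro integrable_circle_bounded[where B=L] periodic_borel_measurable)
  note pv = lipgD(1)[OF g]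
  have avg: "cmod (LINT h|circle. fejer_kernel M h *\<^sub>R w h) \<le> A"
    if "integrable circle (\<lambda>h. fejer_kernel M h *\<^sub>R w h)" "\<And>h. cmod (w h) \<le> A" for w :: "real \<Rightarrow> complex" and A
  proof -
    have "cmod (LINT h|circle. fejer_kernel M h *\<^sub>R w h) \<le> (LINT h|circle. fejer_kernel M h * A)"
      by (rule Bochner_Integration.integral_norm_bound_integral)
         (use that fejer_kernel_integrable fejer_kernel_nonneg in \<open>auto intro!: mult_left_mono\<close>)
    also have "\<dots> = A" using fejer_kernel_integral[OF M] by simp
    finally show ?thesis .
  qed
  show "periodic_borel (fejer_mean M v)" by (rule periodic_borel_fejer_mean[OF pv iv])
  show "0 \<le> L" by (rule lipgD[OF g])
  show "cmod (fejer_mean M v x) \<le> L" for x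
    unfolding fejer_mean_def by (rule avg[OF fejer_mean_integrable[OF pv iv]]) (rule lipgD[OF g])
  show "cmod (fejer_mean M v x - fejer_mean M v y) \<le> L * sqrt (1 - cos (x - y))" for x y
    unfolding fejer_mean_diff[OF pv iv]
  proof (rule avg)
    show "integrable circle (\<lambda>h. fejer_kernel M h *\<^sub>R (v (x + h) - v (y + h)))"
      unfolding scaleR_diff_right by (intro Bochner_Integration.integrable_diff fejer_mean_integrable pv iv)
    show "cmod (v (x + h) - v (y + h)) \<le> L * sqrt (1 - cos (x - y))" for h
      using lipgD(4)[OF g, of "x + h" "y + h"] by simp
  qed
qed

text \<open>With \<open>a = |v (x + h) - v x|\<close> and \<open>a\<^sup>2 \<le> L\<^sup>2 (1 - cos h)\<close>, split \<open>a \<le> s + a\<^sup>2 / s\<close>; the decay of the kernel bounds the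
second term by a constant times \<open>1 / (n s)\<close>, and \<open>s = n\<^sup>-\<^sup>1\<^sup>/\<^sup>2\<close> balances the two.\<close>

lemma fejer_mean_chord_lip_tendsto:
  assumes g: "chord_lip L v"
  shows "(\<lambda>n. fejer_mean (Suc n) v x) \<longlonglongrightarrow> v x"
proof (rule LIM_zero_cancel, rule Lim_null_comparison)
  note pv = lipgD(1)[OF g]
  have iv: "integrable circle v" using lipgD(1,3)[OF g] by (intro integrable_circle_bounded[where B=L] periodic_borel_measurable)
  define s where "s n = sqrt (inverse (real (Suc n)))" for n
  have s: "s n > 0" "s n * s n = inverse (real (Suc n))" for n by (simp_all add: s_def)
  show "eventually (\<lambda>n. norm (fejer_mean (Suc n) v x - v x) \<le> (1 + 2 * L\<^sup>2) * s n) sequentially"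
  proof (rule always_eventually, rule allI)
    fix n
    let ?K = "fejer_kernel (Suc n)"
    have pt: "norm (?K h *\<^sub>R (v (x + h) - v x)) \<le> ?K h * s n + L\<^sup>2 / s n * (1 / (pi * real (Suc n)))" for h
    proof -
      define a where "a = cmod (v (x + h) - v x)"
      have "(cmod (v (x + h) - v x))\<^sup>2 \<le> L\<^sup>2 * (1 - cos (x + h - x))" using g unfolding chord_lip_def by blast
      then have a2: "a\<^sup>2 \<le> L\<^sup>2 * (1 - cos h)" by (simp add: a_def)
      have "0 \<le> (a - s n)\<^sup>2" by simp
      then have "2 * (a * s n) \<le> s n * s n + a\<^sup>2" by (simp add: power2_eq_square algebra_simps)
      moreover have "0 \<le> a * s n" using s(1)[of n] by (simp add: a_def)
      ultimately have "a * s n \<le> s n * s n + a\<^sup>2" by linarith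
      then have "a \<le> s n + a\<^sup>2 / s n" using s(1)[of n] by (simp add: field_simps)
      also have "\<dots> \<le> s n + L\<^sup>2 * (1 - cos h) / s n" using a2 s(1)[of n] by (intro add_left_mono divide_right_mono) auto
      finally have "?K h * a \<le> ?K h * (s n + L\<^sup>2 * (1 - cos h) / s n)"
        by (rule mult_left_mono) (rule fejer_kernel_nonneg)
      also have "\<dots> = ?K h * s n + L\<^sup>2 / s n * (?K h * (1 - cos h))"
      proof -
        have "a * (b + c * q / b) = a * b + c / b * (a * q)" for a b c q :: real by (simp add: distrib_left mult_ac)
        then show ?thesis .
      qed
      also have "\<dots> \<le> ?K h * s n + L\<^sup>2 / s n * (1 / (pi * real (Suc n)))"
        using s(1)[of n] by (intro add_left_mono mult_left_mono fejer_kernel_decay) auto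
      finally show ?thesis by (simp add: a_def fejer_kernel_nonneg)
    qed
    have "norm (fejer_mean (Suc n) v x - v x) \<le> (LINT h|circle. ?K h * s n + L\<^sup>2 / s n * (1 / (pi * real (Suc n))))"
      unfolding fejer_mean_minus[OF pv iv zero_less_Suc]
    proof (rule Bochner_Integration.integral_norm_bound_integral[OF _ _ pt])
      show "integrable circle (\<lambda>h. ?K h *\<^sub>R (v (x + h) - v x))"
        unfolding scaleR_diff_right
        by (intro Bochner_Integration.integrable_diff fejer_mean_integrable pv iv integrable_scaleR_left fejer_kernel_integrable)
      show "integrable circle (\<lambda>h. ?K h * s n + L\<^sup>2 / s n * (1 / (pi * real (Suc n))))"
        using fejer_kernel_integrable by (intro Bochner_Integration.integrable_add integrable_mult_left) auto
    qed
    also have "\<dots> = s n + L\<^sup>2 / s n * (1 / (pi * real (Suc n))) * (2 * pi)"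
    proof -
      have "(LINT h|circle. ?K h * s n + L\<^sup>2 / s n * (1 / (pi * real (Suc n))))
        = (LINT h|circle. ?K h * s n) + (LINT h|circle. L\<^sup>2 / s n * (1 / (pi * real (Suc n))))"
        using fejer_kernel_integrable by (intro Bochner_Integration.integral_add integrable_mult_left) auto
      also have "(LINT h|circle. ?K h * s n) = s n"
        using fejer_kernel_integral[of "Suc n"] by simp
      also have "(LINT h|circle. L\<^sup>2 / s n * (1 / (pi * real (Suc n)))) = L\<^sup>2 / s n * (1 / (pi * real (Suc n))) * (2 * pi)"
        by (simp add: measure_circle)
      finally show ?thesis .
    qed
    also have "\<dots> = s n + 2 * L\<^sup>2 * (inverse (real (Suc n)) / s n)"
    proof -
      have "a / b * (1 / (pi * N)) * (2 * pi) = 2 * a * (inverse N / b)" for a b N :: real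
        by (cases "N = 0 \<or> b = 0") (auto simp: field_simps)
      then show ?thesis by simp
    qed
    also have "inverse (real (Suc n)) / s n = s n" unfolding s(2)[symmetric] using s(1)[of n] by simp
    finally have "norm (fejer_mean (Suc n) v x - v x) \<le> s n + 2 * L\<^sup>2 * s n" .
    then show "norm (fejer_mean (Suc n) v x - v x) \<le> (1 + 2 * L\<^sup>2) * s n" by (simp add: algebra_simps)
  qed
  show "(\<lambda>n. (1 + 2 * L\<^sup>2) * s n) \<longlonglongrightarrow> 0"
    unfolding s_def using tendsto_mult_right_zero[OF tendsto_real_sqrt[OF LIMSEQ_inverse_real_of_nat, simplified]] by simp
qed


lemma nonlin_form_g_measurable: "(\<lambda>t. nonlin_form \<sigma>' (U t) (g t)) \<in> borel_measurable half_line"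
  and nonlin_form_g_tendsto: "0 \<le> t \<Longrightarrow> (\<lambda>n. nonlin_form \<sigma>' (U t) (fejer_mean (Suc n) (g t))) \<longlonglongrightarrow> nonlin_form \<sigma>' (U t) (g t)"
  and nonlin_form_fejer_g_measurable: "(\<lambda>t. nonlin_form \<sigma>' (U t) (fejer_mean (Suc n) (g t))) \<in> borel_measurable half_line"
proof -
  show lim: "(\<lambda>n. nonlin_form \<sigma>' (U t) (fejer_mean (Suc n) (g t))) \<longlonglongrightarrow> nonlin_form \<sigma>' (U t) (g t)" if t: "0 \<le> t" for t
    by (rule nonlin_form_tendsto_right[OF U(1-3)[OF t] C0 _ chord_lip_g[OF t]])
       (auto intro!: fejer_mean_chord_lip fejer_mean_chord_lip_tendsto chord_lip_g t)
  show m: "(\<lambda>t. nonlin_form \<sigma>' (U t) (fejer_mean (Suc n) (g t))) \<in> borel_measurable half_line" for n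
  proof -
    have "(\<lambda>t. \<Sum>k\<in>{1..<int (Suc n)}. cnj (of_real (1 - of_int k / real (Suc n)) * (\<i> * of_int k * phihat k t)) * nonlin_form \<sigma>' (U t) (\<lambda>x. cis (of_int k * x))) \<in> borel_measurable half_line"
      by (intro borel_measurable_sum borel_measurable_times nonlin_form_mode_measurable continuous_measurable_half_line continuous_intros phihat_continuous)
    moreover have "nonlin_form \<sigma>' (U t) (fejer_mean (Suc n) (g t)) = (\<Sum>k\<in>{1..<int (Suc n)}. cnj (of_real (1 - of_int k / real (Suc n)) * (\<i> * of_int k * phihat k t)) * nonlin_form \<sigma>' (U t) (\<lambda>x. cis (of_int k * x)))"
      if "t \<in> space half_line" for t
    proof -
      have t: "0 \<le> t" using that by simp
      show ?thesis unfolding fejer_mean_g[OF t] by (rule nonlin_form_trig[OF U(1-3)[OF t] C0]) simp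
    qed
    ultimately show ?thesis by (subst measurable_cong) auto
  qed
  show "(\<lambda>t. nonlin_form \<sigma>' (U t) (g t)) \<in> borel_measurable half_line"
    by (rule borel_measurable_LIMSEQ_metric[where f="\<lambda>n t. nonlin_form \<sigma>' (U t) (fejer_mean (Suc n) (g t))"]) (use m lim in auto)
qed

lemma nonlin_form_bound:
  assumes "\<bar>\<sigma>'\<bar> \<le> 1" "0 \<le> t" "chord_lip (4 * B) v" "T \<le> t \<Longrightarrow> v = (\<lambda>x. 0)"
  shows "cmod (nonlin_form \<sigma>' (U t) v) \<le> 4 * B * (50 + 2 * C) * indicator {0..T} t"
proof (cases "t \<le> T")
  case True
  have "cmod (nonlin_form \<sigma>' (U t) v) \<le> 4 * B * (50 + 2 * C)"
    by (rule norm_nonlin_form_le[OF U(1-3)[OF assms(2)] C0 assms(3,1)])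
  then show ?thesis using True assms(2) by simp
next
  case False
  then have "v = (\<lambda>x. 0)" using assms(4) by simp
  then have "nonlin_form \<sigma>' (U t) v = 0" by (simp add: nonlin_form_def nonlocal_density_def[abs_def] local_density_def[abs_def])
  then show ?thesis using B C0 by simp
qed

lemma g_vanish: "T \<le> t \<Longrightarrow> g t = (\<lambda>x. 0)"
  using T(4) by auto

lemma fejer_g_vanish: "T \<le> t \<Longrightarrow> fejer_mean M (g t) = (\<lambda>x. 0)"
  using g_vanish by (simp add: fejer_mean_def[abs_def])

lemma nonlin_form_g_integrable:
  assumes "\<bar>\<sigma>'\<bar> \<le> 1"
  shows "integrable half_line (\<lambda>t. nonlin_form \<sigma>' (U t) (g t))"
  by (rule integrable_half_line_bounded[OF nonlin_form_g_measurable]) (rule nonlin_form_bound[OF assms _ chord_lip_g g_vanish])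

lemma nonlin_form_fejer_tendsto:
  assumes "\<bar>\<sigma>'\<bar> \<le> 1"
  shows "(\<lambda>n. LINT t|half_line. nonlin_form \<sigma>' (U t) (fejer_mean (Suc n) (g t))) \<longlonglongrightarrow> (LINT t|half_line. nonlin_form \<sigma>' (U t) (g t))"
proof (rule integral_dominated_convergence)
  show "integrable half_line (\<lambda>t. 4 * B * (50 + 2 * C) * indicator {0..T} t)" by (rule integrable_half_line_indicator)
  show "AE t in half_line. (\<lambda>n. nonlin_form \<sigma>' (U t) (fejer_mean (Suc n) (g t))) \<longlonglongrightarrow> nonlin_form \<sigma>' (U t) (g t)"
    by (intro AE_I2 nonlin_form_g_tendsto) simp
  show "AE t in half_line. cmod (nonlin_form \<sigma>' (U t) (fejer_mean (Suc n) (g t))) \<le> 4 * B * (50 + 2 * C) * indicator {0..T} t" for n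
    by (intro AE_I2 nonlin_form_bound[OF assms] fejer_mean_chord_lip chord_lip_g fejer_g_vanish) auto
qed (rule nonlin_form_g_measurable nonlin_form_fejer_g_measurable)+

lemma pairing_L1_error:
  assumes v: "v \<in> borel_measurable borel" "\<And>x. x \<in> space circle \<Longrightarrow> cmod (v x) \<le> B"
    and w: "integrable circle w1" "integrable circle w2"
  shows "integrable circle (\<lambda>x. w1 x * cnj (v x))"
    "cmod ((LINT x|circle. w1 x * cnj (v x)) - (LINT x|circle. w2 x * cnj (v x))) \<le> B * (LINT x|circle. cmod (w1 x - w2 x))"
proof -
  have vm: "(\<lambda>x. cnj (v x)) \<in> borel_measurable circle"
    by (rule measurable_circle_borel) (rule measurable_compose[OF v(1) measurable_cnj])
  have i: "integrable circle (\<lambda>x. w x * cnj (v x))" if w: "integrable circle w" for w :: "real \<Rightarrow> complex"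
  proof (rule Bochner_Integration.integrable_bound[of _ "\<lambda>x. w x * of_real B"])
    show "integrable circle (\<lambda>x. w x * of_real B)" using w by simp
    show "(\<lambda>x. w x * cnj (v x)) \<in> borel_measurable circle" using w vm by auto
    show "AE x in circle. norm (w x * cnj (v x)) \<le> norm (w x * of_real B)"
      using v(2) B by (intro AE_I2) (auto simp: norm_mult intro!: mult_left_mono)
  qed
  show "integrable circle (\<lambda>x. w1 x * cnj (v x))" by (rule i[OF w(1)])
  have "(LINT x|circle. w1 x * cnj (v x)) - (LINT x|circle. w2 x * cnj (v x)) = (LINT x|circle. (w1 x - w2 x) * cnj (v x))"
    unfolding left_diff_distrib by (rule Bochner_Integration.integral_diff[symmetric]) (intro i w)+
  also have "cmod \<dots> \<le> (LINT x|circle. B * cmod (w1 x - w2 x))"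
  proof (rule Bochner_Integration.integral_norm_bound_integral)
    show "integrable circle (\<lambda>x. (w1 x - w2 x) * cnj (v x))" by (rule i) (use w in simp)
    show "integrable circle (\<lambda>x. B * cmod (w1 x - w2 x))" using w by simp
    show "norm ((w1 x - w2 x) * cnj (v x)) \<le> B * cmod (w1 x - w2 x)" if "x \<in> space circle" for x
      using mult_left_mono[OF v(2)[OF that], of "cmod (w1 x - w2 x)"] by (simp add: norm_mult mult.commute)
  qed
  finally show "cmod ((LINT x|circle. w1 x * cnj (v x)) - (LINT x|circle. w2 x * cnj (v x))) \<le> B * (LINT x|circle. cmod (w1 x - w2 x))"
    by simp
qed

text \<open>Dominated convergence in time, with the uniform bound on \<open>[0, T]\<close> from \<open>L4_fejer_sum_le\<close>. It also shows that
the inner integral is measurable in time.\<close>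

lemma u_psi_tendsto:
  "(\<lambda>n. LINT t|half_line. (LINT x|circle. fejer_sum (Suc n) (u t) x * cnj (\<psi> t x))) \<longlonglongrightarrow> (LINT t|half_line. (LINT x|circle. U t x * cnj (\<psi> t x)))"
proof (rule integral_dominated_convergence)
  define A where "A = B * (2 * pi + 16 * C)"
  note psi = measurable_slice[OF psi_cont] B_circle(2)
  have lim: "(\<lambda>n. LINT x|circle. fejer_sum (Suc n) (u t) x * cnj (\<psi> t x)) \<longlonglongrightarrow> (LINT x|circle. U t x * cnj (\<psi> t x))"
    if t: "0 \<le> t" for t
  proof -
    interpret bounded_spectrum "u t" C by (rule spectrum[OF t])
    have "(\<lambda>n. LINT x|circle. cmod (fejer_sum (Suc n) (u t) x - U t x)) \<longlonglongrightarrow> 0"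
    proof (rule L4_tendsto_fourier_coeff(1)[where B="\<lambda>n. C / pi * inverse (real (Suc n))"])
      show "L4 (\<lambda>x. fejer_sum (Suc n) (u t) x - U t x) \<le> ennreal (C / pi * inverse (real (Suc n)))" for n
        using L4_fejer_limit_error[of "Suc n"] by (simp add: U_def field_simps)
      show "(\<lambda>n. C / pi * inverse (real (Suc n))) \<longlonglongrightarrow> 0"
        using tendsto_mult_right_zero[OF LIMSEQ_inverse_real_of_nat] by blast
    qed (use U(1,4)[OF t] C0 in auto)
    then have l: "(\<lambda>n. B * (LINT x|circle. cmod (fejer_sum (Suc n) (u t) x - U t x))) \<longlonglongrightarrow> 0"
      by (rule tendsto_mult_right_zero)
    show ?thesis
      by (rule LIM_zero_cancel, rule Lim_null_comparison[OF _ l])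
         (intro always_eventually allI pairing_L1_error(2) psi t U integrable_fejer_sum)
  qed
  have m: "(\<lambda>t. LINT x|circle. fejer_sum (Suc n) (u t) x * cnj (\<psi> t x)) \<in> borel_measurable half_line" for n
  proof -
    have "(\<lambda>t. \<Sum>k\<in>{1..<int (Suc n)}. 2 * of_real pi * (of_real (1 - of_int k / real (Suc n)) * u t k) * cnj (psihat k t)) \<in> borel_measurable half_line"
      by (intro continuous_measurable_half_line continuous_intros u_continuous psihat_continuous)
    moreover have "(LINT x|circle. fejer_sum (Suc n) (u t) x * cnj (\<psi> t x)) = (\<Sum>k\<in>{1..<int (Suc n)}. 2 * of_real pi * (of_real (1 - of_int k / real (Suc n)) * u t k) * cnj (psihat k t))"
      if "t \<in> space half_line" for t
    proof -
      have t: "0 \<le> t" using that by simp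
      show ?thesis unfolding fejer_sum_def psihat_def
        by (rule trig_pairing[OF measurable_slice[OF psi_cont t] B_circle(2)[OF t]]) auto
    qed
    ultimately show ?thesis by (subst measurable_cong) auto
  qed
  show "(\<lambda>t. LINT x|circle. fejer_sum (Suc n) (u t) x * cnj (\<psi> t x)) \<in> borel_measurable half_line" for n by (rule m)
  show "(\<lambda>t. LINT x|circle. U t x * cnj (\<psi> t x)) \<in> borel_measurable half_line"
    by (rule borel_measurable_LIMSEQ_metric[where f="\<lambda>n t. LINT x|circle. fejer_sum (Suc n) (u t) x * cnj (\<psi> t x)"]) (use m lim in auto)
  show "AE t in half_line. (\<lambda>n. LINT x|circle. fejer_sum (Suc n) (u t) x * cnj (\<psi> t x)) \<longlonglongrightarrow> (LINT x|circle. U t x * cnj (\<psi> t x))"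
    by (intro AE_I2 lim) simp
  show "integrable half_line (\<lambda>t. A * indicator {0..T} t)" by (rule integrable_half_line_indicator)
  show "AE t in half_line. cmod (LINT x|circle. fejer_sum (Suc n) (u t) x * cnj (\<psi> t x)) \<le> A * indicator {0..T} t" for n
  proof (rule AE_I2)
    fix t assume "t \<in> space half_line"
    then have t: "0 \<le> t" by simp
    show "cmod (LINT x|circle. fejer_sum (Suc n) (u t) x * cnj (\<psi> t x)) \<le> A * indicator {0..T} t"
    proof (cases "t \<le> T")
      case True
      have L: "L4 (fejer_sum (Suc n) (u t)) \<le> ennreal (16 * C)"
        by (rule L4_fejer_sum_le[OF spectrum[OF t]]) simp
      have "(LINT x|circle. cmod (fejer_sum (Suc n) (u t) x)) \<le> 2 * pi * 1 + (16 * C) / 1 ^ 3"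
        by (rule L4_imp_L1(2)[OF periodic_borel_fejer_sum L]) (use C0 in auto)
      then have "B * (LINT x|circle. cmod (fejer_sum (Suc n) (u t) x)) \<le> A"
        unfolding A_def using B by (intro mult_left_mono) auto
      moreover have "cmod (LINT x|circle. fejer_sum (Suc n) (u t) x * cnj (\<psi> t x)) \<le> B * (LINT x|circle. cmod (fejer_sum (Suc n) (u t) x))"
        using pairing_L1_error(2)[OF measurable_slice[OF psi_cont t] B_circle(2)[OF t] integrable_fejer_sum, of "\<lambda>x. 0" "Suc n" "u t"] by simp
      ultimately show ?thesis using True t by simp
    next
      case False
      then show ?thesis using T(3) B C0 by (simp add: A_def)
    qed
  qed
qed

text \<open>Sum the mode identities with the weights of the Fejer sum. Then \<open>c\<close> and \<open>u t\<close> are paired with \<open>\<phi>\<close> and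
\<open>\<partial>\<^sub>t\<phi>\<close> through their Fejer sums, while on the right-hand side the weights are attached to \<open>\<partial>\<^sub>x\<phi>\<close>.\<close>

lemma fejer_identity:
  assumes M: "M > 0"
  shows "(LINT x|circle. fejer_sum M c x * cnj (\<phi> 0 x)) + (LINT t|half_line. (LINT x|circle. fejer_sum M (u t) x * cnj (\<psi> t x)))
    = (LINT t|half_line. nonlin_form \<sigma> (U t) (fejer_mean M (g t)))"
proof -
  define a where "a k = 2 * complex_of_real pi * of_real (1 - of_int k / real M)" for k :: int
  have 1: "(LINT x|circle. fejer_sum M c x * cnj (\<phi> 0 x)) = (\<Sum>k\<in>{1..<int M}. a k * (c k * cnj (phihat k 0)))"
    unfolding fejer_sum_def
    by (subst trig_pairing[OF measurable_slice[OF phi_cont] B_circle(1)]) (auto simp: a_def phihat_def mult_ac)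
  have "(LINT t|half_line. (LINT x|circle. fejer_sum M (u t) x * cnj (\<psi> t x))) = (LINT t|half_line. (\<Sum>k\<in>{1..<int M}. a k * (u t k * cnj (psihat k t))))"
  proof (rule Bochner_Integration.integral_cong[OF refl])
    fix t assume "t \<in> space half_line"
    then have t: "0 \<le> t" by simp
    show "(LINT x|circle. fejer_sum M (u t) x * cnj (\<psi> t x)) = (\<Sum>k\<in>{1..<int M}. a k * (u t k * cnj (psihat k t)))"
      unfolding fejer_sum_def
      by (subst trig_pairing[OF measurable_slice[OF psi_cont t] B_circle(2)[OF t]]) (auto simp: a_def psihat_def mult_ac)
  qed
  also have "\<dots> = (\<Sum>k\<in>{1..<int M}. a k * (LINT t|half_line. u t k * cnj (psihat k t)))"
    using integrable_u_psihat by (subst Bochner_Integration.integral_sum) auto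
  finally have 2: "(LINT t|half_line. (LINT x|circle. fejer_sum M (u t) x * cnj (\<psi> t x))) = (\<Sum>k\<in>{1..<int M}. a k * (LINT t|half_line. u t k * cnj (psihat k t)))" .
  have "(LINT t|half_line. nonlin_form \<sigma> (U t) (fejer_mean M (g t))) = (LINT t|half_line. (\<Sum>k\<in>{1..<int M}. a k * - (G k t * cnj (phihat k t))))"
  proof (rule Bochner_Integration.integral_cong[OF refl])
    fix t assume "t \<in> space half_line"
    then have t: "0 \<le> t" by simp
    have "nonlin_form \<sigma> (U t) (fejer_mean M (g t)) = (\<Sum>k\<in>{1..<int M}. cnj (of_real (1 - of_int k / real M) * (\<i> * of_int k * phihat k t)) * nonlin_form \<sigma> (U t) (\<lambda>x. cis (of_int k * x)))"
      unfolding fejer_mean_g[OF t] by (rule nonlin_form_trig[OF U(1-3)[OF t] C0]) simp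
    also have "\<dots> = (\<Sum>k\<in>{1..<int M}. a k * - (G k t * cnj (phihat k t)))"
      unfolding G_eq[OF t] U_def a_def by (intro sum.cong refl) simp
    finally show "nonlin_form \<sigma> (U t) (fejer_mean M (g t)) = (\<Sum>k\<in>{1..<int M}. a k * - (G k t * cnj (phihat k t)))" .
  qed
  also have "\<dots> = (\<Sum>k\<in>{1..<int M}. a k * - (LINT t|half_line. G k t * cnj (phihat k t)))"
    using integrable_G_phihat by (subst Bochner_Integration.integral_sum) auto
  also have "\<dots> = (\<Sum>k\<in>{1..<int M}. a k * (c k * cnj (phihat k 0) + (LINT t|half_line. u t k * cnj (psihat k t))))"
    by (intro sum.cong refl) (subst mode_identity, auto)
  finally show ?thesis unfolding 1 2 by (simp add: distrib_left sum.distrib)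
qed

lemma weak_identity:
  assumes v: "periodic_borel v" "integrable circle v" "W_energy v \<le> ennreal C0'" "0 \<le> C0'"
    and cv: "\<And>k. c k = fourier_coeff v k" and pos: "\<And>k. k < 1 \<Longrightarrow> c k = 0"
  shows "(LINT x|circle. v x * cnj (\<phi> 0 x)) + (LINT t|half_line. (LINT x|circle. U t x * cnj (\<psi> t x)))
    = (LINT t|half_line. nonlin_form \<sigma> (U t) (g t))"
proof -
  have cfc: "c = fourier_coeff v" using cv by blast
  have fm: "fejer_sum M c = fejer_mean M v" for M
    unfolding cfc by (rule fejer_mean_eq_fejer_sum[symmetric, OF v(1,2)]) (use pos cv in auto)
  have "(\<lambda>n. LINT x|circle. cmod (fejer_sum (Suc n) c x - v x)) \<longlonglongrightarrow> 0"
  proof (rule L4_tendsto_fourier_coeff(1)[where B="\<lambda>n. C0' / pi * inverse (real (Suc n))"])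
    show "L4 (\<lambda>x. fejer_sum (Suc n) c x - v x) \<le> ennreal (C0' / pi * inverse (real (Suc n)))" for n
    proof -
      have "L4 (\<lambda>x. fejer_mean (Suc n) v x - v x) \<le> ennreal (1 / (pi * real (Suc n))) * W_energy v"
        by (rule fejer_mean_L4_error[OF v(1,2)]) simp
      also have "\<dots> \<le> ennreal (1 / (pi * real (Suc n))) * ennreal C0'" by (intro mult_left_mono v) auto
      also have "\<dots> = ennreal (C0' / pi * inverse (real (Suc n)))"
        using v(4) by (subst ennreal_mult[symmetric]) (auto simp: field_simps)
      finally show ?thesis unfolding fm .
    qed
    show "(\<lambda>n. C0' / pi * inverse (real (Suc n))) \<longlonglongrightarrow> 0"
      using tendsto_mult_right_zero[OF LIMSEQ_inverse_real_of_nat] by blast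
  qed (use v in auto)
  then have l: "(\<lambda>n. B * (LINT x|circle. cmod (fejer_sum (Suc n) c x - v x))) \<longlonglongrightarrow> 0"
    by (rule tendsto_mult_right_zero)
  have "(\<lambda>n. LINT x|circle. fejer_sum (Suc n) c x * cnj (\<phi> 0 x)) \<longlonglongrightarrow> (LINT x|circle. v x * cnj (\<phi> 0 x))"
    by (rule LIM_zero_cancel, rule Lim_null_comparison[OF _ l])
       (intro always_eventually allI pairing_L1_error(2) measurable_slice[OF phi_cont] B_circle(1) v integrable_fejer_sum order_refl)
  from tendsto_add[OF this u_psi_tendsto]
  have "(\<lambda>n. LINT t|half_line. nonlin_form \<sigma> (U t) (fejer_mean (Suc n) (g t)))
    \<longlonglongrightarrow> (LINT x|circle. v x * cnj (\<phi> 0 x)) + (LINT t|half_line. (LINT x|circle. U t x * cnj (\<psi> t x)))"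
    by (simp add: fejer_identity)
  then show ?thesis using nonlin_form_fejer_tendsto[OF sigma] by (rule LIMSEQ_unique)
qed

text \<open>The nonlocal part is \<open>8 \<pi>\<close> times the form with coupling constant 0, and the local part is the difference of the
forms with coupling constants 0 and 1. Both are integrable in time, so the integral may be
split.\<close>

lemma nonlin_form_split:
  "(LINT t|half_line. nonlin_form \<sigma> (U t) (g t))
    = 1 / (8 * of_real pi) * (LINT t|half_line. (LINT y|circle. (LINT x|circle. nonlocal_density (U t) (g t) (x, y))))
      - of_real \<sigma> * (LINT t|half_line. (LINT x|circle. local_density (U t) (g t) x))"
proof -
  have "(LINT y|circle. (LINT x|circle. nonlocal_density (U t) (g t) (x, y))) = 8 * of_real pi * nonlin_form 0 (U t) (g t)"
    if t: "0 \<le> t" for t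
  proof -
    have "integrable circle2 (\<lambda>(x, y). nonlocal_density (U t) (g t) (x, y))"
      using integrable_nonlocal_density(1)[OF U(1,2)[OF t] C0 chord_lip_g[OF t]] by simp
    from circle2.integral_snd[OF this] show ?thesis by (simp add: nonlin_form_def)
  qed
  then have 1: "(LINT t|half_line. (LINT y|circle. (LINT x|circle. nonlocal_density (U t) (g t) (x, y)))) = (LINT t|half_line. 8 * of_real pi * nonlin_form 0 (U t) (g t))"
    by (intro Bochner_Integration.integral_cong refl) simp
  have 2: "(LINT t|half_line. (LINT x|circle. local_density (U t) (g t) x)) = (LINT t|half_line. nonlin_form 0 (U t) (g t) - nonlin_form 1 (U t) (g t))"
    by (intro Bochner_Integration.integral_cong refl) (simp add: nonlin_form_def)
  have 3: "nonlin_form \<sigma> (U t) (g t) = nonlin_form 0 (U t) (g t) - of_real \<sigma> * (nonlin_form 0 (U t) (g t) - nonlin_form 1 (U t) (g t))" for t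
    by (simp add: nonlin_form_def)
  show ?thesis unfolding 1 2 using nonlin_form_g_integrable[of 0] nonlin_form_g_integrable[of 1]
    by (subst 3) simp
qed

end

theorem theorem4p2:
  fixes \<sigma> :: real and u0 :: "real \<Rightarrow> complex"
  assumes "\<sigma> \<in> {0, 1}"
    and "u0 \<in> W_space"
    and "is_P_plus u0 u0"
  shows "\<exists>u :: real \<Rightarrow> real \<Rightarrow> complex. weak_solution \<sigma> \<infinity> u0 u"
proof -
  have s: "0 \<le> \<sigma>" "\<sigma> \<le> 1" using assms(1) by auto
  have u0: "periodic_2pi u0" "u0 \<in> borel_measurable torus_measure" "W_norm_pow4 u0 < \<infinity>"
    using assms(2) by (auto simp: W_space_def)
  obtain v where v: "periodic_borel v" "AE x in circle. v x = u0 x"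
    using borel_representative[OF u0(1,2)] by blast
  have iu: "integrable circle u0" using assms(3) by (simp add: is_P_plus_def circle_def)
  have vm: "v \<in> borel_measurable circle" by (rule measurable_circle_borel[OF periodic_borel_measurable[OF v(1)]])
  have um: "u0 \<in> borel_measurable circle" using u0(2) by (simp add: circle_def)
  have iv: "integrable circle v"
    using integrable_cong_AE[OF vm um v(2)] iu by simp
  have "L4 v + W_energy v < \<infinity>"
    using u0(3) unfolding W_norm_pow4_eq[OF v(1), symmetric] W_norm_pow4_cong_AE[OF v(2)] .
  then have "W_energy v < \<infinity>" by (simp add: less_top)
  then obtain E where E: "W_energy v = ennreal E" "0 \<le> E" by (cases "W_energy v") auto
  define c where "c k = fourier_coeff v k" for k
  have fc: "fourier_coeff v k = fourier_coeff u0 k" for k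
  proof -
    have m: "(\<lambda>x. cis (- (of_int k * x))) \<in> borel_measurable circle"
      using periodic_borel_measurable[OF periodic_borel_cis[of "-k"]] by (intro measurable_circle_borel) simp
    have "(LINT x|circle. v x * cis (- (of_int k * x))) = (LINT x|circle. u0 x * cis (- (of_int k * x)))"
      by (rule integral_cong_AE) (use m vm um v(2) in auto)
    then show ?thesis by (simp add: fourier_coeff_circle)
  qed
  have pos: "c k = 0" if "k < 1" for k
  proof -
    have "fourier_coeff u0 k = indicator {1..} k * fourier_coeff u0 k"
      using assms(3) unfolding is_P_plus_def by blast
    then show ?thesis using that by (simp add: c_def fc)
  qed
  have fm: "fejer_sum M c = fejer_mean M v" for M
  proof -
    have "c = fourier_coeff v" by (simp add: c_def fun_eq_iff)
    then show ?thesis using fejer_mean_eq_fejer_sum[OF v(1) iv, of M] pos by auto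
  qed
  have bd: "W_energy (fejer_sum M c) \<le> ennreal E" if "M > 0" for M
    unfolding fm using fejer_mean_W_energy[OF v(1) iv that] E(1) by simp
  obtain C V u G where "mode_solution \<sigma> c C V u G"
    using mode_solution_exists[OF s E(2) pos bd] by blast
  then interpret mode_solution \<sigma> c C V u G .
  have "weak_solution \<sigma> \<infinity> u0 U"
    unfolding weak_solution_def time_interval_infinity
  proof (intro conjI allI impI)
    show "(0::ereal) < \<infinity>" by simp
    show "u0 \<in> W_space" by fact
    show "U \<in> L_infinity_W {0..}" by (rule U_L_infinity)
    show "AE t in lebesgue_on {0..}. is_P_plus (U t) (U t)"
      by (intro AE_I2 U_positive) simp
    fix \<phi> :: "real \<Rightarrow> real \<Rightarrow> complex"
    assume "test_function \<infinity> \<phi>"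
    then interpret test_fun \<phi> by unfold_locales
    interpret weak_setting \<sigma> c C V u G \<phi> by unfold_locales
    have phi0: "\<phi> 0 \<in> borel_measurable circle"
      by (rule measurable_circle_borel[OF measurable_slice[OF phi_cont]]) simp
    have "(\<lambda>x. cnj (\<phi> 0 x)) \<in> borel_measurable circle"
      by (rule measurable_compose[OF phi0 measurable_cnj])
    then have "(LINT x|circle. u0 x * cnj (\<phi> 0 x)) = (LINT x|circle. v x * cnj (\<phi> 0 x))"
      by (intro integral_cong_AE) (use vm um v(2) in auto)
    also have "\<dots> + (LINT t|half_line. (LINT x|circle. U t x * cnj (\<psi> t x))) = (LINT t|half_line. nonlin_form \<sigma> (U t) (g t))"
      by (rule weak_identity[OF v(1) iv _ E(2)]) (use E pos in \<open>auto simp: c_def\<close>)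
    finally show "(LINT x|torus_measure. u0 x * cnj (\<phi> 0 x)) +
        (LINT t|lebesgue_on {0..}. LINT x|torus_measure. U t x * cnj (partial_t {0..} \<phi> t x)) =
        1 / (8 * of_real pi) *
          (LINT t|lebesgue_on {0..}. LINT y|torus_measure. LINT x|torus_measure.
             of_real (cmod (U t x - U t y) ^ 2) * (U t x - U t y) *
             cnj (partial_x \<phi> t x - partial_x \<phi> t y) / of_real (1 - cos (x - y)))
        - of_real \<sigma> *
          (LINT t|lebesgue_on {0..}. LINT x|torus_measure.
             of_real (cmod (U t x) ^ 2) * U t x * cnj (partial_x \<phi> t x))"
      unfolding nonlin_form_split unfolding nonlocal_density_def local_density_def fst_conv snd_conv \<psi>_def g_def circle_def .
  qed
  then show ?thesis by blast
qed

end
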